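(* Let $D\ge 1$ and $N>2D$ be integers, let $q$ be a prime power, let $\Gamma=J_q(N,D)$, and let $x$ be a vertex of $\Gamma$. Let $\Omega\subseteq\Psi$ be an irreducible $\mathcal{H}$-module, and let $\alpha$ be an integer. Then the following are equivalent: (i) $\Omega$ is alpha-dominant with gap $\alpha$; (ii) $\widetilde{\Omega}$ is an irreducible $T$-submodule of the nucleus $\mathcal{N}=\mathcal{N}(x)$ with endpoint $\alpha$.
   Context: Let $\mathbb{F}_q$ be a finite field with $q$ elements and $\mathcal{V}$ an $N$-dimensional vector space over $\mathbb{F}_q$. The Grassmann graph $\Gamma=J_q(N,D)$ has vertex set $X$ consisting of the $D$-dimensional subspaces of $\mathcal{V}$; $y,z\in X$ are adjacent iff $\dim(y\cap z)=D-1$. Let $\partial$ be the path-length distance; for $N>2D$ the diameter is $D$ and $\partial(y,z)=D-\dim(y\cap z)$. Put $[\ell]=\frac{q^\ell-1}{q-1}$. Terwilliger algebra and nucleus. Let $A\in\mathrm{Mat}_X(\mathbb{C})$ be the adjacency matrix of $\Gamma$ and $V=\mathbb{C}^X$. $A$ has exactly $D+1$ distinct eigenvalues $\theta_0>\cdots>\theta_D$, namely $\theta_i=q[D][N-D]-[i][N-i+1]$; let $E_i$ be the orthogonal projection of $V$ onto the $\theta_i$-eigenspace. For $0\le i\le D$ let $E_i^*$ be the diagonal matrix with $(y,y)$-entry $1$ if $\partial(x,y)=i$ and $0$ otherwise. $T=T(x)$ is the subalgebra of $\mathrm{Mat}_X(\mathbb{C})$ generated by $A,E_0^*,\dots,E_D^*$.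 A $T$-module is a subspace $W\subseteq V$ with $TW\subseteq W$; irreducible means nonzero with no $T$-submodule other than $0$ and $W$. An irreducible $T$-module $W$ has endpoint $r=\min\{i: E_i^*W\ne0\}$, dual endpoint $t=\min\{i: E_iW\neq 0\}$, diameter $d=|\{i: E_i^*W\ne 0\}|-1$, and displacement $r+t-D+d$. The nucleus $\mathcal{N}$ is the span of all irreducible $T$-modules with displacement $0$. The algebra $\mathcal{H}$. Let $P$ be the set of all subspaces of $\mathcal{V}$. For $0\le i\le D$, $0\le j\le N-D$ let $P_{i,j}=\{u\in P: \dim(u\cap x)=i,\ \dim u=i+j\}$; these sets partition $P$. For $u\subseteq v$ in $P$ with $\dim v=\dim u+1$ and $u\in P_{i,j}$: $v$ $/$-covers $u$ if $v\in P_{i+1,j}$, and $v$ $\backslash$-covers $u$ if $v\in P_{i,j+1}$ (exactly one holds). In $\mathrm{Mat}_P(\mathbb{C})$: $E^*_{i,j}$ is the diagonal projection onto coordinates in $P_{i,j}$; $K_1,K_2$ are diagonal with $(u,u)$-entries $q^{D/2-i}$, $q^{(N-D)/2-j}$ for $u\in P_{i,j}$; $L_1$ (resp. $L_2$) has $(u,v)$-entry $1$ if $v$ $/$-covers (resp. $\backslash$-covers) $u$ and $0$ otherwise; $R_1=L_1^\top$, $R_2=L_2^\top$. $\mathcal{H}=\mathcal{H}(x)$ is the subalgebra generated by $L_1,L_2,R_1,R_2,K_1^{\pm1},K_2^{\pm1}$. Let $\Psi=\mathbb{C}^P$; $\mathcal{H}$-modules are $\mathcal{H}$-invariant subspaces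 of $\Psi$, irreducible if nonzero with no $\mathcal{H}$-submodule other than $0$ and itself. For each irreducible $\mathcal{H}$-module $\Omega$ there are unique integers $\alpha,\beta,\rho$ with $\rho\ge0$, $0\le\alpha\le\frac{D-\rho}{2}$, $0\le\beta\le\frac{N-D-\rho}{2}$ such that for $0\le i\le D$, $0\le j\le N-D$, $\dim E^*_{i,j}\Omega=1$ if $\alpha\le i\le D-\rho-\alpha$ and $\rho+\beta\le j\le N-D-\beta$, and $\dim E^*_{i,j}\Omega=0$ otherwise. The triple $(\alpha,\beta,\rho)$ is the type of $\Omega$. $\Omega$ is alpha-dominant with gap $\alpha$ if it has type $(\alpha,0,0)$ with $0\le\alpha\le\frac D2$. Regard $V$ as the subspace $\sum_{j=0}^{D}E^*_{D-j,j}\Psi$ of $\Psi$ (vectors supported on $X\subseteq P$). For an $\mathcal{H}$-submodule $\Omega\subseteq\Psi$ let $\widetilde{\Omega}=\sum_{j=0}^{D}E^*_{D-j,j}\Omega\subseteq V$. *)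

theory Defs
  imports "HOL-Analysis.Analysis"
begin

text \<open>
  For a finite type \<open>'n\<close> and \<open>S \<subseteq> UNIV\<close>, the space \<open>\<complex>^S\<close> is rendered as the subspace
  \<open>supported S\<close> of \<^typ>\<open>complex ^ 'n\<close>, and \<open>Mat_S(\<complex>)\<close> as the matrices vanishing outside
  \<open>S \<times> S\<close>; the identity of the latter is \<open>diag_on S (\<lambda>_. 1)\<close>.  In this way \<open>\<complex>^X\<close> is literally
  a subspace of \<open>\<complex>^P\<close> when \<open>X \<subseteq> P\<close>.
\<close>

definition supported :: "'n set \<Rightarrow> (complex ^ 'n::finite) set" where
  "supported S = {f. \<forall>u. u \<notin> S \<longrightarrow> f $ u = 0}"

definition diag_on :: "'n set \<Rightarrow> ('n \<Rightarrow> complex) \<Rightarrow> complex ^ 'n ^ 'n::finite" where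
  "diag_on S f = (\<chi> u v. if u = v \<and> u \<in> S then f u else 0)"

inductive_set generated_algebra ::
  "complex ^ 'n ^ 'n::finite \<Rightarrow> (complex ^ 'n ^ 'n) set \<Rightarrow> (complex ^ 'n ^ 'n) set"
  for e :: "complex ^ 'n ^ 'n" and G :: "(complex ^ 'n ^ 'n) set"
where
  unit: "e \<in> generated_algebra e G"
| generator: "M \<in> G \<Longrightarrow> M \<in> generated_algebra e G"
| add: "M \<in> generated_algebra e G \<Longrightarrow> M' \<in> generated_algebra e G
    \<Longrightarrow> M + M' \<in> generated_algebra e G"
| scale: "M \<in> generated_algebra e G \<Longrightarrow> (\<chi> u v. c * M $ u $ v) \<in> generated_algebra e G"
| mult: "M \<in> generated_algebra e G \<Longrightarrow> M' \<in> generated_algebra e G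
    \<Longrightarrow> M ** M' \<in> generated_algebra e G"

definition is_module ::
  "(complex ^ 'n ^ 'n) set \<Rightarrow> (complex ^ 'n::finite) set \<Rightarrow> (complex ^ 'n) set \<Rightarrow> bool" where
  "is_module \<A> U W \<longleftrightarrow> vec.subspace W \<and> W \<subseteq> U \<and> (\<forall>M\<in>\<A>. \<forall>w\<in>W. M *v w \<in> W)"

definition irreducible_module ::
  "(complex ^ 'n ^ 'n) set \<Rightarrow> (complex ^ 'n::finite) set \<Rightarrow> (complex ^ 'n) set \<Rightarrow> bool" where
  "irreducible_module \<A> U W \<longleftrightarrow> is_module \<A> U W \<and> W \<noteq> {0} \<and>
     (\<forall>W'. is_module \<A> U W' \<and> W' \<subseteq> W \<longrightarrow> W' = {0} \<or> W' = W)"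

definition hermitian :: "complex ^ 'n::finite \<Rightarrow> complex ^ 'n \<Rightarrow> complex" where
  "hermitian f g = (\<Sum>u\<in>UNIV. f $ u * cnj (g $ u))"

definition orth_proj :: "(complex ^ 'n::finite) set \<Rightarrow> complex ^ 'n \<Rightarrow> complex ^ 'n" where
  "orth_proj S v = (THE w. w \<in> S \<and> (\<forall>z\<in>S. hermitian (v - w) z = 0))"

text \<open>
  The class \<open>finite\<close> on \<open>'v\<close> is no restriction: a finite-dimensional vector space over a finite
  field is finite.
\<close>

locale grassmann = vector_space scale
  for scale :: "'a::{field,finite} \<Rightarrow> 'v::{ab_group_add,finite} \<Rightarrow> 'v" +
  fixes q N D :: nat and x :: "'v set"
  assumes q_eq: "q = CARD('a)"
    and dim_UNIV_eq: "dim (UNIV :: 'v set) = N"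
    and D_pos: "D \<ge> 1"
    and N_gt: "N > 2 * D"
    and subspace_x: "subspace x"
    and dim_x: "dim x = D"
begin

subsection \<open>The Grassmann graph, its Terwilliger algebra and the nucleus\<close>

definition X :: "'v set set" where
  "X = {y. subspace y \<and> dim y = D}"

definition adj :: "'v set rel" where
  "adj = {(y, z). y \<in> X \<and> z \<in> X \<and> dim (y \<inter> z) = D - 1}"

definition gdist :: "'v set \<Rightarrow> 'v set \<Rightarrow> nat" where
  "gdist y z = (LEAST n. (y, z) \<in> adj ^^ n)"

definition V :: "(complex ^ 'v set) set" where
  "V = supported X"

definition A :: "complex ^ 'v set ^ 'v set" where
  "A = (\<chi> y z. if (y, z) \<in> adj then 1 else 0)"

definition qint :: "nat \<Rightarrow> real" where
  "qint l = (real q ^ l - 1) / (real q - 1)"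

definition \<theta> :: "nat \<Rightarrow> real" where
  "\<theta> i = real q * qint D * qint (N - D) - qint i * qint (N - i + 1)"

definition E :: "nat \<Rightarrow> complex ^ 'v set \<Rightarrow> complex ^ 'v set" where
  "E i = orth_proj {v \<in> V. A *v v = complex_of_real (\<theta> i) *s v}"

definition Es :: "nat \<Rightarrow> complex ^ 'v set ^ 'v set" where
  "Es i = diag_on {y \<in> X. gdist x y = i} (\<lambda>_. 1)"

definition T :: "(complex ^ 'v set ^ 'v set) set" where
  "T = generated_algebra (diag_on X (\<lambda>_. 1)) (insert A (Es ` {..D}))"

definition irreducible_T_module :: "(complex ^ 'v set) set \<Rightarrow> bool" where
  "irreducible_T_module W \<longleftrightarrow> irreducible_module T V W"

definition endpoint :: "(complex ^ 'v set) set \<Rightarrow> nat" where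
  "endpoint W = (LEAST i. i \<le> D \<and> (*v) (Es i) ` W \<noteq> {0})"

definition dual_endpoint :: "(complex ^ 'v set) set \<Rightarrow> nat" where
  "dual_endpoint W = (LEAST i. i \<le> D \<and> E i ` W \<noteq> {0})"

definition diameter :: "(complex ^ 'v set) set \<Rightarrow> int" where
  "diameter W = int (card {i. i \<le> D \<and> (*v) (Es i) ` W \<noteq> {0}}) - 1"

definition displacement :: "(complex ^ 'v set) set \<Rightarrow> int" where
  "displacement W = int (endpoint W) + int (dual_endpoint W) - int D + diameter W"

definition nucleus :: "(complex ^ 'v set) set" where
  "nucleus = vec.span (\<Union>{W. irreducible_T_module W \<and> displacement W = 0})"

subsection \<open>The algebra \<open>\<H>\<close>\<close>

definition P :: "'v set set" where
  "P = {u. subspace u}"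

definition Pij :: "nat \<Rightarrow> nat \<Rightarrow> 'v set set" where
  "Pij i j = {u \<in> P. dim (u \<inter> x) = i \<and> dim u = i + j}"

definition slash_covers :: "'v set \<Rightarrow> 'v set \<Rightarrow> bool" where
  "slash_covers v u \<longleftrightarrow> u \<subseteq> v \<and> dim v = dim u + 1 \<and>
     (\<exists>i j. u \<in> Pij i j \<and> v \<in> Pij (i + 1) j)"

definition backslash_covers :: "'v set \<Rightarrow> 'v set \<Rightarrow> bool" where
  "backslash_covers v u \<longleftrightarrow> u \<subseteq> v \<and> dim v = dim u + 1 \<and>
     (\<exists>i j. u \<in> Pij i j \<and> v \<in> Pij i (j + 1))"

definition Esij :: "nat \<Rightarrow> nat \<Rightarrow> complex ^ 'v set ^ 'v set" where
  "Esij i j = diag_on (Pij i j) (\<lambda>_. 1)"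

text \<open>
  For \<open>u \<in> Pij i j\<close> we have \<open>i = dim (u \<inter> x)\<close> and \<open>j = dim u - dim (u \<inter> x)\<close>.
\<close>

definition k1 :: "'v set \<Rightarrow> complex" where
  "k1 u = complex_of_real (real q powr (real D / 2 - real (dim (u \<inter> x))))"

definition k2 :: "'v set \<Rightarrow> complex" where
  "k2 u = complex_of_real
     (real q powr ((real N - real D) / 2 - (real (dim u) - real (dim (u \<inter> x)))))"

definition K1 :: "complex ^ 'v set ^ 'v set" where
  "K1 = diag_on P k1"

definition K1_inv :: "complex ^ 'v set ^ 'v set" where
  "K1_inv = diag_on P (\<lambda>u. inverse (k1 u))"

definition K2 :: "complex ^ 'v set ^ 'v set" where
  "K2 = diag_on P k2"

definition K2_inv :: "complex ^ 'v set ^ 'v set" where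
  "K2_inv = diag_on P (\<lambda>u. inverse (k2 u))"

definition L1 :: "complex ^ 'v set ^ 'v set" where
  "L1 = (\<chi> u v. if slash_covers v u then 1 else 0)"

definition L2 :: "complex ^ 'v set ^ 'v set" where
  "L2 = (\<chi> u v. if backslash_covers v u then 1 else 0)"

definition R1 :: "complex ^ 'v set ^ 'v set" where
  "R1 = transpose L1"

definition R2 :: "complex ^ 'v set ^ 'v set" where
  "R2 = transpose L2"

definition H :: "(complex ^ 'v set ^ 'v set) set" where
  "H = generated_algebra (diag_on P (\<lambda>_. 1)) {L1, L2, R1, R2, K1, K1_inv, K2, K2_inv}"

definition Psi :: "(complex ^ 'v set) set" where
  "Psi = supported P"

definition irreducible_H_module :: "(complex ^ 'v set) set \<Rightarrow> bool" where
  "irreducible_H_module \<Omega> \<longleftrightarrow> irreducible_module H Psi \<Omega>"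

definition has_type :: "(complex ^ 'v set) set \<Rightarrow> int \<Rightarrow> int \<Rightarrow> int \<Rightarrow> bool" where
  "has_type \<Omega> \<alpha> \<beta> \<rho> \<longleftrightarrow>
     0 \<le> \<rho> \<and> 0 \<le> \<alpha> \<and> 2 * \<alpha> \<le> int D - \<rho> \<and> 0 \<le> \<beta> \<and> 2 * \<beta> \<le> int N - int D - \<rho> \<and>
     (\<forall>i\<le>D. \<forall>j\<le>N - D. vec.dim ((*v) (Esij i j) ` \<Omega>) =
        (if \<alpha> \<le> int i \<and> int i \<le> int D - \<rho> - \<alpha> \<and>
            \<rho> + \<beta> \<le> int j \<and> int j \<le> int N - int D - \<beta> then 1 else 0))"

definition alpha_dominant_with_gap :: "(complex ^ 'v set) set \<Rightarrow> int \<Rightarrow> bool" where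
  "alpha_dominant_with_gap \<Omega> \<alpha> \<longleftrightarrow> 0 \<le> \<alpha> \<and> 2 * \<alpha> \<le> int D \<and> has_type \<Omega> \<alpha> 0 0"

definition tilde :: "(complex ^ 'v set) set \<Rightarrow> (complex ^ 'v set) set" where
  "tilde \<Omega> = {\<Sum>j\<le>D. w j | w. \<forall>j\<le>D. w j \<in> (*v) (Esij (D - j) j) ` \<Omega>}"

end

end

theory Submission
  imports Defs
begin

text \<open>
  The relations \<open>L1 R2 = R2 L1\<close>, \<open>R1 R2 = q R2 R1\<close> and two relations of \<open>sl\<^sub>2\<close> type, in which
  \<open>L1 R1 - R1 L1\<close> and \<open>L2 R2 - R2 L2\<close> are expressed by one central operator \<open>Q\<close>, show that an
  irreducible \<open>\<H>\<close>-module is spanned by the vectors \<open>R1\<^sup>k R2\<^sup>l v\<close> with \<open>k \<le> m\<close> and \<open>l \<le> n\<close>, where \<open>v\<close> is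
  a homogeneous vector of degree \<open>(a, b)\<close> killed by \<open>L1\<close> and \<open>L2\<close>, and that the eigenvalue
  \<open>q\<^sup>-\<^sup>\<rho>\<close> of \<open>Q\<close> determines \<open>2a + m = D - \<rho>\<close> and \<open>2b + n = N - D + \<rho>\<close>.  The part of the module in
  degree \<open>D\<close> is an irreducible \<open>T\<close>-module, if it is not zero.  As \<open>A = (R1 + R2)(L1 + L2) - [D]\<close> there,
  its eigenvalues are obtained by descending through the degrees; its dual endpoint is the lowest
  degree \<open>a + b\<close>.  Hence its displacement is \<open>a + b - D + min (D - a) (b + n)\<close>, which vanishes
  exactly for \<open>b = 0\<close> because \<open>N > 2D\<close>, and \<open>b = 0\<close> forces \<open>\<rho> = 0\<close>.  An irreducible \<open>T\<close>-module
  inside the nucleus is not orthogonal to some irreducible module of displacement 0 and therefore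
  shares all its parameters.
\<close>

subsection \<open>Subspaces of a finite vector space\<close>

text \<open>In the coordinates of the lowest vector, alpha-dominance is the single condition b = 0,
  so everything comes down to reading a and b off the degree D part. The obstacle is that the
  relations relative to x do not close: a pair of subspaces whose join gains rank while their meet
  loses none contributes to \<open>L1 R1\<close> but not to \<open>R1 L1\<close>. These pairs form
  the relation \<open>crel\<close>, and its matrix \<open>C\<close> has to be carried along. In the
  whole lattice, upper and lower covers match one to one and \<open>C\<close> disappears, which is
  why it enters the two relations of sl2 type with opposite signs. \<open>C\<close> commutes with
  raising only up to a factor q and an added multiple, both absorbed by the rescaling
  \<open>Q\<close>. Eliminating the eigenvalue of \<open>Q\<close> from the two top conditions gives
  N = 2a + m + 2b + n. Displacement 0 forces b = 0 or a + 2b + n = D, and the latter would give N =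
  a + m + D, at most 2D. When b = 0, the vector v lives on subspaces of x, where \<open>crel\<close>
  relates nothing, so \<open>Q\<close> is the identity there.\<close>

definition gauss :: "nat \<Rightarrow> nat \<Rightarrow> nat" where
  "gauss q n = (\<Sum>i<n. q ^ i)"

lemma gauss_0 [simp]: "gauss q 0 = 0"
  and gauss_1 [simp]: "gauss q (Suc 0) = 1"
  and gauss_Suc: "gauss q (Suc n) = gauss q n + q ^ n"
  by (simp_all add: gauss_def)

lemma gauss_eq: "(q - 1) * gauss q n + 1 = q ^ n" if "q \<ge> 1"
proof (induction n)
  case (Suc n)
  have "q * q ^ n = (q - 1) * q ^ n + q ^ n"
    using that by (cases q) auto
  with Suc show ?case by (simp add: gauss_Suc algebra_simps)
qed (use that in simp)

locale finite_vector_space = vector_space scale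
  for scale :: "'a::{field,finite} \<Rightarrow> 'v::{ab_group_add,finite} \<Rightarrow> 'v"
begin

text \<open>The locale of finite-dimensional spaces is indexed by a basis. Any choice does, and its
  finiteness comes from the finite type.\<close>

definition some_basis :: "'v set" where
  "some_basis = (SOME B. independent B \<and> span B = UNIV)"

lemma some_basis: "independent some_basis" "span some_basis = UNIV"
proof -
  obtain B where "independent B" "span B = UNIV"
    using basis_exists[of UNIV] by (metis top.extremum_uniqueI)
  then have "\<exists>B. independent B \<and> span B = UNIV" by blast
  from someI_ex[OF this] show "independent some_basis" "span some_basis = UNIV"
    by (simp_all add: some_basis_def)
qed

sublocale finite_dimensional_vector_space scale some_basis
  by unfold_locales (simp_all add: some_basis)

definition covers :: "'v set \<Rightarrow> 'v set \<Rightarrow> bool" where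
  "covers v u \<longleftrightarrow> subspace u \<and> subspace v \<and> u \<subseteq> v \<and> dim v = dim u + 1"

definition join :: "'v set \<Rightarrow> 'v set \<Rightarrow> 'v set" where
  "join u v = span (u \<union> v)"

definition adjacent :: "'v set \<Rightarrow> 'v set \<Rightarrow> bool" where
  "adjacent u v \<longleftrightarrow> subspace u \<and> subspace v \<and> dim u = dim v \<and> dim (u \<inter> v) + 1 = dim u"

lemma subspace_join [simp]: "subspace (join u v)"
  by (simp add: join_def)

lemma join_ub: "u \<subseteq> join u v" "v \<subseteq> join u v"
  by (auto simp: join_def span_base)

lemma join_least: "u \<subseteq> w \<Longrightarrow> v \<subseteq> w \<Longrightarrow> subspace w \<Longrightarrow> join u v \<subseteq> w"
  by (simp add: join_def span_minimal)

lemma dim_join: "subspace u \<Longrightarrow> subspace v \<Longrightarrow> dim (join u v) + dim (u \<inter> v) = dim u + dim v"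
  using dim_sums_Int[of u v] by (simp add: join_def span_Un span_eq_iff[THEN iffD2])

lemma card_q_pos: "CARD('a) \<ge> 2"
proof -
  have "card {0, 1::'a} \<le> CARD('a)" by (rule card_mono) auto
  then show ?thesis by simp
qed

text \<open>A vector of the larger span is k b + y for exactly one scalar k and one y in the smaller
  span, so each basis vector contributes a factor q.\<close>

lemma card_span_independent:
  "finite B \<Longrightarrow> independent B \<Longrightarrow> card (span B) = CARD('a) ^ card B"
proof (induction rule: finite_induct)
  case (insert b B)
  have b: "b \<notin> span B" and B: "independent B"
    using insert.prems insert.hyps(2) by (auto simp: independent_insert)
  have "span (insert b B) = (\<lambda>(k, y). scale k b + y) ` (UNIV \<times> span B)"
  proof (intro equalityI subsetI)
    fix v assume "v \<in> span (insert b B)"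
    then obtain k where "v - scale k b \<in> span B" by (auto simp: span_breakdown_eq)
    then show "v \<in> (\<lambda>(k, y). scale k b + y) ` (UNIV \<times> span B)"
      by (intro image_eqI[of _ _ "(k, v - scale k b)"]) auto
  next
    fix v assume "v \<in> (\<lambda>(k, y). scale k b + y) ` (UNIV \<times> span B)"
    then obtain k y where "v = scale k b + y" "y \<in> span B" by auto
    then show "v \<in> span (insert b B)"
      by (auto simp: span_breakdown_eq intro!: exI[of _ k])
  qed
  moreover have "inj_on (\<lambda>(k, y). scale k b + y) (UNIV \<times> span B)"
  proof (rule inj_onI, clarsimp)
    fix k y k' y'
    assume y: "y \<in> span B" "y' \<in> span B" and eq: "scale k b + y = scale k' b + y'"
    have "scale (k - k') b = y' - y"
      using eq by (simp add: scale_left_diff_distrib algebra_simps)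
    then have "scale (k - k') b \<in> span B" using y by (simp add: span_diff)
    then have "k = k'"
      using b span_scale[of "scale (k - k') b" B "inverse (k - k')"] by (cases "k = k'") auto
    then show "k = k' \<and> y = y'" using eq by simp
  qed
  ultimately have "card (span (insert b B)) = CARD('a) * card (span B)"
    by (simp add: card_image card_cartesian_product)
  then show ?case using insert B by simp
qed simp

lemma card_subspace: "subspace u \<Longrightarrow> card u = CARD('a) ^ dim u"
proof -
  assume u: "subspace u"
  obtain B where "B \<subseteq> u" "independent B" "u \<subseteq> span B" "card B = dim u"
    using basis_exists[of u] by blast
  moreover from this u have "span B = u" by (simp add: span_subspace)
  ultimately show ?thesis using card_span_independent[of B] by auto
qed

lemma dim_join_singleton: "subspace u \<Longrightarrow> e \<notin> u \<Longrightarrow> dim (join u {e}) = dim u + 1"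
  using dim_insert[of e u] by (simp add: join_def span_eq_iff[THEN iffD2])

lemma dim_less: "subspace u \<Longrightarrow> subspace v \<Longrightarrow> u \<subseteq> v \<Longrightarrow> u \<noteq> v \<Longrightarrow> dim u < dim v"
  using subspace_dim_equal[of u v] by force

lemma covers_eq: "covers v u \<Longrightarrow> covers w u \<Longrightarrow> v \<subseteq> w \<Longrightarrow> v = w"
  using dim_less[of v w] by (auto simp: covers_def)

lemma covered_eq: "covers w u \<Longrightarrow> covers w v \<Longrightarrow> u \<subseteq> v \<Longrightarrow> u = v"
  using dim_less[of u v] by (auto simp: covers_def)

section \<open>Counting in intervals of the subspace lattice\<close>

definition atoms :: "'v set \<Rightarrow> 'v set \<Rightarrow> 'v set set" where
  "atoms u w = {v. covers v u \<and> v \<subseteq> w}"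

definition coatoms :: "'v set \<Rightarrow> 'v set \<Rightarrow> 'v set set" where
  "coatoms u w = {v. covers w v \<and> u \<subseteq> v}"

lemma covers_join_singleton: "subspace u \<Longrightarrow> e \<notin> u \<Longrightarrow> covers (join u {e}) u"
  by (simp add: covers_def dim_join_singleton join_ub)

lemma covers_eq_join_singleton:
  assumes "covers v u" "e \<in> v" "e \<notin> u"
  shows "v = join u {e}"
proof (rule covers_eq[symmetric, OF covers_join_singleton])
  show "join u {e} \<subseteq> v" using assms by (intro join_least) (auto simp: covers_def)
qed (use assms in \<open>auto simp: covers_def\<close>)

text \<open>A vector of w outside u lies in exactly one atom, so the sets v - u partition w - u into
  blocks of (q - 1) q^(dim u) vectors.\<close>

lemma card_atoms:
  assumes u: "subspace u" and w: "subspace w" and uw: "u \<subseteq> w"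
  shows "card (atoms u w) = gauss CARD('a) (dim w - dim u)"
proof -
  let ?q = "CARD('a)" and ?d = "dim w - dim u"
  have le: "dim u \<le> dim w" by (simp add: dim_subset uw)
  have "w - u = (\<Union>v\<in>atoms u w. v - u)"
  proof (intro equalityI subsetI)
    fix e assume e: "e \<in> w - u"
    then have "join u {e} \<subseteq> w" using u w uw by (intro join_least) auto
    with e have "join u {e} \<in> atoms u w"
      using u by (simp add: atoms_def covers_join_singleton)
    moreover have "e \<in> join u {e}" using join_ub(2)[of "{e}" u] by simp
    ultimately show "e \<in> (\<Union>v\<in>atoms u w. v - u)" using e by blast
  qed (auto simp: atoms_def)
  moreover have "card (\<Union>v\<in>atoms u w. v - u) = (\<Sum>v\<in>atoms u w. card (v - u))"
  proof (rule card_UN_disjoint, simp, simp, intro ballI impI)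
    fix v v' assume v: "v \<in> atoms u w" "v' \<in> atoms u w" "v \<noteq> v'"
    have False if "e \<in> (v - u) \<inter> (v' - u)" for e
      using v that covers_eq_join_singleton[of v u e] covers_eq_join_singleton[of v' u e]
      by (simp add: atoms_def)
    then show "(v - u) \<inter> (v' - u) = {}" by blast
  qed
  moreover have "card (v - u) = (?q - 1) * ?q ^ dim u" if "v \<in> atoms u w" for v
  proof -
    have "card (v - u) = ?q ^ dim v - ?q ^ dim u"
      using that by (simp add: card_Diff_subset atoms_def covers_def card_subspace)
    then show ?thesis using that by (simp add: atoms_def covers_def algebra_simps)
  qed
  ultimately have "card (w - u) = card (atoms u w) * ((?q - 1) * ?q ^ dim u)"
    by simp
  moreover have "card (w - u) = (?q ^ ?d - 1) * ?q ^ dim u"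
  proof -
    have "card (w - u) = ?q ^ dim w - ?q ^ dim u"
      using uw u w by (simp add: card_Diff_subset card_subspace)
    also have "?q ^ dim w = ?q ^ ?d * ?q ^ dim u" by (metis le le_add_diff_inverse2 power_add)
    finally show ?thesis by (simp add: algebra_simps)
  qed
  ultimately have "card (atoms u w) * (?q - 1) = ?q ^ ?d - 1"
    using card_q_pos by (simp add: mult.assoc[symmetric])
  moreover have "(?q - 1) * gauss ?q ?d = ?q ^ ?d - 1"
    using gauss_eq[of ?q ?d] card_q_pos by simp
  ultimately have "(?q - 1) * card (atoms u w) = (?q - 1) * gauss ?q ?d"
    by (simp add: mult.commute)
  then show ?thesis using card_q_pos by simp
qed

lemma adjacent_neq: "adjacent u v \<Longrightarrow> u \<noteq> v"
  by (auto simp: adjacent_def)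

lemma adjacent_sym: "adjacent u v \<Longrightarrow> adjacent v u"
  by (auto simp: adjacent_def Int_commute)

text \<open>Modularity: distinct subspaces with a common lower cover have a common upper cover and
  conversely (\<open>covered_distinct\<close>), and both are unique. Hence off-diagonal entries of
  an up-down product of covering matrices are 0 or 1.\<close>

lemma covers_distinct:
  assumes "covers a u" "covers b u" "a \<noteq> b"
  shows "adjacent a b" "a \<inter> b = u"
proof -
  have s: "subspace (a \<inter> b)" "subspace a" "subspace b" "subspace u"
    using assms by (auto simp: covers_def subspace_inter)
  have "\<not> a \<subseteq> b" using assms covers_eq by blast
  then have "dim (a \<inter> b) < dim a"
    using s by (intro dim_less) auto
  moreover have ub: "u \<subseteq> a \<inter> b" using assms by (auto simp: covers_def)
  then have "dim u \<le> dim (a \<inter> b)" by (rule dim_subset)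
  ultimately have d: "dim (a \<inter> b) = dim u" using assms by (simp add: covers_def)
  then show "adjacent a b" using assms by (simp add: adjacent_def covers_def)
  show "a \<inter> b = u" using subspace_dim_equal[OF s(4,1) ub] d by simp
qed

lemma covered_distinct:
  assumes "covers w a" "covers w b" "a \<noteq> b"
  shows "adjacent a b" "join a b = w"
proof -
  have s: "subspace a" "subspace b" "subspace w"
    using assms by (auto simp: covers_def)
  have "\<not> b \<subseteq> a" using assms covered_eq by blast
  then have "a \<noteq> join a b" using join_ub by blast
  then have "dim a < dim (join a b)"
    using s by (intro dim_less) (auto simp: join_ub)
  moreover have sub: "join a b \<subseteq> w" using assms by (intro join_least) (auto simp: covers_def)
  then have "dim (join a b) \<le> dim w" by (rule dim_subset)
  ultimately have d: "dim (join a b) = dim w" using assms by (simp add: covers_def)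
  then show "adjacent a b" using assms dim_join[of a b] by (auto simp: adjacent_def covers_def)
  show "join a b = w" using subspace_dim_equal[OF subspace_join s(3) sub] d by simp
qed

lemma adjacent_covers:
  assumes "adjacent u v"
  shows "covers u (u \<inter> v)" "covers v (u \<inter> v)" "covers (join u v) u" "covers (join u v) v"
  using assms dim_join[of u v] by (simp_all add: adjacent_def covers_def subspace_inter join_ub)

text \<open>Double counting of the pairs of an atom and a coatom not above it.\<close>

lemma card_coatoms:
  assumes "subspace u" "subspace w" "u \<subseteq> w"
  shows "card (coatoms u w) = gauss CARD('a) (dim w - dim u)"
  using assms
proof (induction "dim w - dim u" arbitrary: u)
  case 0
  then have "u = w" using subspace_dim_equal[of u w] by simp
  then have "coatoms u w = {}" by (auto simp: coatoms_def covers_def)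
  then show ?case using 0 by simp
next
  case (Suc d)
  let ?q = "CARD('a)"
  let ?I = "\<lambda>v h. \<not> v \<subseteq> h"
  have dim: "dim w = dim u + Suc d" using Suc.hyps(2) by simp
  show ?case
  \<comment> \<open>The count below ends by cancelling \<open>gauss ?q d\<close>, which vanishes for
    d = 0.\<close>
  proof (cases "d = 0")
    case True
    then have "coatoms u w = {u}"
      using Suc.prems dim covered_eq[of w u] by (auto simp: coatoms_def covers_def)
    then show ?thesis using True dim by simp
  next
    case False
    have at: "card {v \<in> atoms u w. ?I v h} = ?q ^ d" if "h \<in> coatoms u w" for h
    proof -
      have h: "subspace h" "u \<subseteq> h" "h \<subseteq> w" "dim h - dim u = d"
        using that dim by (auto simp: coatoms_def covers_def)
      have "{v \<in> atoms u w. ?I v h} = atoms u w - atoms u h"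
        using h by (auto simp: atoms_def)
      moreover have "atoms u h \<subseteq> atoms u w" using h by (auto simp: atoms_def)
      ultimately show ?thesis
        using card_atoms[of u w] card_atoms[of u h] h Suc.prems Suc.hyps(2)[symmetric]
        by (simp add: card_Diff_subset gauss_Suc)
    qed
    have coat: "card {h \<in> coatoms u w. ?I v h} = card (coatoms u w) - gauss ?q d"
      and le: "gauss ?q d \<le> card (coatoms u w)"
      if "v \<in> atoms u w" for v
    proof -
      have v: "subspace v" "u \<subseteq> v" "v \<subseteq> w" "d = dim w - dim v"
        using that dim by (auto simp: atoms_def covers_def)
      have sub: "coatoms v w \<subseteq> coatoms u w" using v by (auto simp: coatoms_def)
      have "{h \<in> coatoms u w. ?I v h} = coatoms u w - coatoms v w"
        using v by (auto simp: coatoms_def)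
      moreover have "card (coatoms v w) = gauss ?q d"
        using Suc.hyps(1)[OF v(4) v(1) _ v(3)] Suc.prems v(4) by simp
      ultimately show "card {h \<in> coatoms u w. ?I v h} = card (coatoms u w) - gauss ?q d"
        "gauss ?q d \<le> card (coatoms u w)"
        using sub card_mono[OF _ sub] by (simp_all add: card_Diff_subset)
    qed
    have "(\<Sum>h\<in>coatoms u w. card {v \<in> atoms u w. ?I v h}) =
          (card (coatoms u w) - gauss ?q d) * card (atoms u w)"
      by (rule sum_multicount) (auto simp: coat)
    then have eq: "card (coatoms u w) * ?q ^ d = (card (coatoms u w) - gauss ?q d) * gauss ?q (Suc d)"
      using at card_atoms[of u w] Suc.prems Suc.hyps(2)[symmetric] by simp
    have "card (atoms u w) > 0"
      using card_atoms[of u w] Suc.prems Suc.hyps(2)[symmetric] card_q_pos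
      by (simp add: gauss_Suc)
    then obtain v where "v \<in> atoms u w" by (metis card_gt_0_iff ex_in_conv)
    \<comment> \<open>Writing the count as [d] + e removes the truncated subtraction. With g = [d]
      the equation reads (g + e) q^d = e (g + q^d), so e = q^d.\<close>
    from le[OF this] obtain e where e: "card (coatoms u w) = gauss ?q d + e"
      using le_Suc_ex by blast
    have pos: "gauss ?q d > 0" using False by (cases d) (auto simp: gauss_Suc)
    have "gauss ?q d * ?q ^ d = e * gauss ?q d"
      using eq by (simp add: e gauss_Suc algebra_simps)
    then have "e = ?q ^ d" using pos by simp
    then show ?thesis using e Suc.hyps(2)[symmetric] by (simp add: gauss_Suc)
  qed
qed

end

subsection \<open>Covering relations relative to \<open>x\<close>\<close>

sublocale grassmann \<subseteq> finite_vector_space scale ..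

context grassmann
begin

abbreviation rk :: "'v set \<Rightarrow> nat" where
  "rk u \<equiv> dim (u \<inter> x)"

lemma q_ge_2: "q \<ge> 2"
  using card_q_pos by (simp add: q_eq)

lemma rk_le: "rk u \<le> dim u" "rk u \<le> D"
  using dim_subset[of "u \<inter> x" u] dim_subset[of "u \<inter> x" x] by (simp_all add: dim_x)

lemma rk_mono: "u \<subseteq> v \<Longrightarrow> rk u \<le> rk v"
  by (intro dim_subset) auto

lemma dim_le_N: "dim u \<le> N"
  using dim_subset[of u UNIV] by (simp only: dim_UNIV_eq subset_UNIV)

lemma dim_join_x: "subspace u \<Longrightarrow> dim (join u x) + rk u = dim u + D"
  using dim_join[of u x] subspace_x by (simp add: dim_x)

lemma join_x_mono: "u \<subseteq> v \<Longrightarrow> join u x \<subseteq> join v x"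
  using join_ub(1)[of v x] join_ub(2)[of x v] by (intro join_least) auto

lemma join_x_idem: "u \<subseteq> join v x \<Longrightarrow> join u x \<subseteq> join v x"
  using join_ub(1)[of v x] join_ub(2)[of x v] by (intro join_least) auto

text \<open>The rank cannot drop because the intersection with x grows, and it cannot rise by more
  than 1 because the sum with x grows too.\<close>

lemma covers_rk:
  assumes "covers v u"
  shows "rk v = rk u \<or> rk v = rk u + 1"
proof -
  have "dim (join u x) \<le> dim (join v x)" "rk u \<le> rk v"
    using assms join_x_mono[of u v] by (auto simp: covers_def rk_mono dim_subset)
  then show ?thesis
    using dim_join_x[of u] dim_join_x[of v] assms by (auto simp: covers_def)
qed

lemma slash_covers_iff: "slash_covers v u \<longleftrightarrow> covers v u \<and> rk v = rk u + 1"
  unfolding slash_covers_def covers_def Pij_def P_def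
  by (auto simp: rk_le intro!: exI[of _ "dim u - rk u"])

lemma backslash_covers_iff: "backslash_covers v u \<longleftrightarrow> covers v u \<and> rk v = rk u"
  unfolding backslash_covers_def covers_def Pij_def P_def
  by (auto simp: rk_le intro!: exI[of _ "dim u - rk u"])

text \<open>By the dimension formula, a cover gains rank iff it leaves u + x unchanged. So the slash
  covers of u are the atoms of [u, u + x]. Dually, by \<open>backslash_covers_iff_inter\<close>, the
  subspaces that u backslash-covers are the coatoms of [u \<inter> x, u].\<close>

lemma slash_covers_iff_join: "slash_covers v u \<longleftrightarrow> covers v u \<and> v \<subseteq> join u x"
proof -
  have "rk v = rk u + 1 \<longleftrightarrow> v \<subseteq> join u x" if c: "covers v u"
  proof
    assume "rk v = rk u + 1"
    then have "dim (join v x) = dim (join u x)"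
      using dim_join_x[of u] dim_join_x[of v] c by (auto simp: covers_def)
    then have "join u x = join v x"
      using c by (intro subspace_dim_equal join_x_mono) (auto simp: covers_def)
    then show "v \<subseteq> join u x" using join_ub(1)[of v x] by simp
  next
    assume "v \<subseteq> join u x"
    then have "join v x \<subseteq> join u x" by (rule join_x_idem)
    moreover have "join u x \<subseteq> join v x" using c by (intro join_x_mono) (simp add: covers_def)
    ultimately have "join u x = join v x" by blast
    then show "rk v = rk u + 1"
      using dim_join_x[of u] dim_join_x[of v] c by (auto simp: covers_def)
  qed
  then show ?thesis by (auto simp: slash_covers_iff)
qed

lemma slash_covers_join_eq:
  assumes "slash_covers v u"
  shows "join v x = join u x"
proof
  show "join v x \<subseteq> join u x" using assms by (intro join_x_idem) (simp add: slash_covers_iff_join)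
  show "join u x \<subseteq> join v x"
    using assms by (intro join_x_mono) (simp add: slash_covers_iff_join covers_def)
qed

lemma subspace_inter_x: "subspace u \<Longrightarrow> subspace (u \<inter> x)"
  using subspace_x by (simp add: subspace_inter)

lemma inter_x_eqI: "subspace u \<Longrightarrow> subspace v \<Longrightarrow> u \<inter> x \<subseteq> v \<Longrightarrow> rk u = rk v \<Longrightarrow> u \<inter> x = v \<inter> x"
  by (intro subspace_dim_equal) (auto simp: subspace_inter_x)

lemma backslash_covers_iff_inter: "backslash_covers v u \<longleftrightarrow> covers v u \<and> v \<inter> x = u \<inter> x"
proof -
  have "u \<inter> x = v \<inter> x" if "covers v u" "rk v = rk u"
    using that by (intro inter_x_eqI) (auto simp: covers_def)
  then show ?thesis by (auto simp: backslash_covers_iff)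
qed

lemma covers_cases: "covers v u \<Longrightarrow> slash_covers v u \<longleftrightarrow> \<not> backslash_covers v u"
  using covers_rk[of v u] by (auto simp: slash_covers_iff backslash_covers_iff)

text \<open>
  Modulo \<open>x\<close>, a subspace \<open>u\<close> is the graph of a linear map from \<open>(u + x)/x\<close> to \<open>x/(u \<inter> x)\<close>; the
  relation below says that the maps for \<open>u\<close> and \<open>v\<close> have the same domain and codomain and that
  their difference has rank 1.
\<close>

definition crel :: "'v set \<Rightarrow> 'v set \<Rightarrow> bool" where
  "crel u v \<longleftrightarrow> adjacent u v \<and> u \<inter> x = v \<inter> x \<and> join u x = join v x"

lemma crel_sym: "crel u v \<longleftrightarrow> crel v u"
  by (auto simp: crel_def adjacent_sym)

text \<open>The join is a slash cover of both subspaces while both are backslash covers of the meet.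
  This is the pattern that separates \<open>L1 R1\<close> from \<open>R1 L1\<close>.\<close>

lemma crel_iff_rk:
  "crel u v \<longleftrightarrow> adjacent u v \<and> rk u = rk v \<and> rk (join u v) = rk u + 1 \<and> rk (u \<inter> v) = rk u"
proof
  assume c: "crel u v"
  then have a: "adjacent u v" and xi: "u \<inter> x = v \<inter> x" and xj: "join u x = join v x"
    by (auto simp: crel_def)
  have "join u v \<subseteq> join u x"
    using join_ub(1)[of v x] join_ub(1)[of u x] by (intro join_least) (auto simp: xj)
  then have "slash_covers (join u v) u"
    using adjacent_covers[OF a] by (simp add: slash_covers_iff_join)
  moreover have "u \<inter> v \<inter> x = u \<inter> x" using xi by blast
  ultimately show "adjacent u v \<and> rk u = rk v \<and> rk (join u v) = rk u + 1 \<and> rk (u \<inter> v) = rk u"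
    using a xi by (simp add: slash_covers_iff)
next
  assume r: "adjacent u v \<and> rk u = rk v \<and> rk (join u v) = rk u + 1 \<and> rk (u \<inter> v) = rk u"
  then have "slash_covers (join u v) u" "slash_covers (join u v) v"
    "backslash_covers u (u \<inter> v)" "backslash_covers v (u \<inter> v)"
    using adjacent_covers[of u v] by (auto simp: slash_covers_iff backslash_covers_iff)
  then show "crel u v"
    using r slash_covers_join_eq[of "join u v" u] slash_covers_join_eq[of "join u v" v]
    by (simp add: crel_def backslash_covers_iff_inter)
qed

section \<open>Counts behind the entries of products of covering matrices\<close>

lemma covers_above:
  "u \<noteq> w \<Longrightarrow> {v. covers v u \<and> covers v w} = (if adjacent u w then {join u w} else {})"
  by (rule set_eqI) (use covered_distinct[of _ u w] adjacent_covers[of u w] in \<open>simp; metis\<close>)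

lemma covers_below:
  "u \<noteq> w \<Longrightarrow> {v. covers u v \<and> covers w v} = (if adjacent u w then {u \<inter> w} else {})"
  by (rule set_eqI) (use covers_distinct[of u _ w] adjacent_covers[of u w] in \<open>simp; metis\<close>)

lemma card_if_singleton:
  "{v. Q v} = (if a then {b} else {}) \<Longrightarrow> card {v. Q v \<and> R v} = (if a \<and> R b then 1 else 0)"
proof -
  assume "{v. Q v} = (if a then {b} else {})"
  then have "{v. Q v \<and> R v} = (if a \<and> R b then {b} else {})" by (auto split: if_splits)
  then show ?thesis by simp
qed

lemma card_above:
  "u \<noteq> w \<Longrightarrow> card {v. covers v u \<and> covers v w \<and> R v} = (if adjacent u w \<and> R (join u w) then 1 else 0)"
  using card_if_singleton[OF covers_above, of u w R] by (simp add: conj_assoc)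

lemma card_below:
  "u \<noteq> w \<Longrightarrow> card {v. covers u v \<and> covers w v \<and> R v} = (if adjacent u w \<and> R (u \<inter> w) then 1 else 0)"
  using card_if_singleton[OF covers_below, of u w R] by (simp add: conj_assoc)

text \<open>Entries of \<open>L1 R2\<close> and \<open>R2 L1\<close>. When rk w = rk u + 1, the
  ranks of the join and of the meet are squeezed from both sides, so both counts are 1 or 0
  according to adjacency.\<close>

lemma card_slash_backslash_above:
  "card {v. slash_covers v u \<and> backslash_covers v w} =
   card {v. backslash_covers u v \<and> slash_covers w v}"
proof (cases "rk w = rk u + 1")
  case True
  then have ne: "u \<noteq> w" by auto
  have "card {v. slash_covers v u \<and> backslash_covers v w} =
        card {v. covers v u \<and> covers v w \<and> rk v = rk w}"
    using True by (intro arg_cong[of _ _ card]) (auto simp: slash_covers_iff backslash_covers_iff)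
  also have "\<dots> = (if adjacent u w then 1 else 0)"
    using card_above[OF ne] covers_rk[of "join u w" u] covers_rk[of "join u w" w]
      adjacent_covers[of u w] True by auto
  also have "\<dots> = card {v. covers u v \<and> covers w v \<and> rk v = rk u}"
    using card_below[OF ne] covers_rk[of u "u \<inter> w"] covers_rk[of w "u \<inter> w"]
      adjacent_covers[of u w] True by auto
  also have "\<dots> = card {v. backslash_covers u v \<and> slash_covers w v}"
    using True by (intro arg_cong[of _ _ card]) (auto simp: slash_covers_iff backslash_covers_iff)
  finally show ?thesis .
next
  case False
  then have "{v. slash_covers v u \<and> backslash_covers v w} = {}"
    "{v. backslash_covers u v \<and> slash_covers w v} = {}"
    by (auto simp: slash_covers_iff backslash_covers_iff)
  then show ?thesis by (simp only: card.empty)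
qed

text \<open>Off-diagonal entries of \<open>L1 R1\<close> and \<open>R1 L1\<close>. A rank loss at
  the meet forces a rank gain at the join but not conversely; the failures of the converse are the
  pairs in \<open>crel\<close>.\<close>

lemma card_slash_above_below:
  assumes "u \<noteq> w"
  shows "card {v. slash_covers v u \<and> slash_covers v w} =
    card {v. slash_covers u v \<and> slash_covers w v} + (if crel u w then 1 else 0)"
proof (cases "rk u = rk w")
  case True
  have "card {v. slash_covers v u \<and> slash_covers v w} =
        card {v. covers v u \<and> covers v w \<and> rk v = rk u + 1}"
    using True by (intro arg_cong[of _ _ card]) (auto simp: slash_covers_iff)
  also have "\<dots> = (if adjacent u w \<and> rk (join u w) = rk u + 1 then 1 else 0)"
    by (rule card_above[OF assms])
  finally have above: "card {v. slash_covers v u \<and> slash_covers v w} = \<dots>" .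
  have "card {v. slash_covers u v \<and> slash_covers w v} =
        card {v. covers u v \<and> covers w v \<and> rk u = rk v + 1}"
    using True by (intro arg_cong[of _ _ card]) (auto simp: slash_covers_iff)
  also have "\<dots> = (if adjacent u w \<and> rk u = rk (u \<inter> w) + 1 then 1 else 0)"
    by (rule card_below[OF assms])
  finally have below: "card {v. slash_covers u v \<and> slash_covers w v} = \<dots>" .
  \<comment> \<open>If the join gained no rank, then u and w would meet x in the same subspace,
    which would lie in u \<inter> w and leave no rank to lose.\<close>
  have "rk (join u w) = rk u + 1" if a: "adjacent u w" "rk u = rk (u \<inter> w) + 1"
  proof (rule ccontr)
    assume "rk (join u w) \<noteq> rk u + 1"
    then have "backslash_covers (join u w) u" "backslash_covers (join u w) w"
      using covers_rk[of "join u w" u] adjacent_covers[OF a(1)] True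
      by (auto simp: backslash_covers_iff)
    then have "u \<inter> x = w \<inter> x" by (simp add: backslash_covers_iff_inter)
    then have "u \<inter> w \<inter> x = u \<inter> x" by blast
    then show False using a(2) by simp
  qed
  moreover have "rk (u \<inter> w) = rk u \<or> rk u = rk (u \<inter> w) + 1" if "adjacent u w"
    using covers_rk[of u "u \<inter> w"] adjacent_covers[OF that] by auto
  ultimately show ?thesis
    unfolding above below crel_iff_rk using True by auto
next
  case False
  then have "{v. slash_covers v u \<and> slash_covers v w} = {}"
    "{v. slash_covers u v \<and> slash_covers w v} = {}" "\<not> crel u w"
    by (auto simp: slash_covers_iff crel_iff_rk)
  then show ?thesis by (simp only: card.empty) simp
qed

lemma card_covers_above_below:
  "u \<noteq> w \<Longrightarrow> card {v. covers v u \<and> covers v w} = card {v. covers u v \<and> covers w v}"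
  using card_above[of u w "\<lambda>_. True"] card_below[of u w "\<lambda>_. True"] by simp

lemma card_slash_above:
  assumes "subspace u"
  shows "card {v. slash_covers v u} = gauss q (D - rk u)"
proof -
  have "{v. slash_covers v u} = atoms u (join u x)"
    by (auto simp: atoms_def slash_covers_iff_join)
  then have "card {v. slash_covers v u} = gauss q (dim (join u x) - dim u)"
    using card_atoms[of u "join u x"] assms join_ub(1)[of u x] by (simp add: q_eq)
  also have "dim (join u x) - dim u = D - rk u"
    using dim_join_x[OF assms] rk_le[of u] by linarith
  finally show ?thesis .
qed

lemma card_covers_above:
  assumes "subspace u"
  shows "card {v. covers v u} = gauss q (N - dim u)"
  using card_atoms[of u UNIV] assms unfolding dim_UNIV_eq by (simp add: atoms_def q_eq)

lemma card_covers_below: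
  assumes "subspace u"
  shows "card {v. covers u v} = gauss q (dim u)"
proof -
  have "{v. covers u v} = coatoms {0} u"
    by (auto simp: coatoms_def covers_def subspace_0)
  then show ?thesis using card_coatoms[of "{0}" u] assms by (simp add: q_eq subspace_0)
qed

lemma card_slash_below:
  assumes "subspace u"
  shows "card {v. slash_covers u v} + gauss q (dim u - rk u) = gauss q (dim u)"
proof -
  let ?c = "coatoms (u \<inter> x) u"
  have "covers u v \<Longrightarrow> backslash_covers u v \<longleftrightarrow> u \<inter> x \<subseteq> v" for v
    unfolding backslash_covers_iff_inter covers_def by blast
  then have "{v. slash_covers u v} = {v. covers u v} - ?c"
    using covers_cases by (auto simp: coatoms_def slash_covers_iff_join)
  moreover have "?c \<subseteq> {v. covers u v}" by (auto simp: coatoms_def)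
  ultimately have "card {v. slash_covers u v} + card ?c = card {v. covers u v}"
    by (simp add: card_Diff_subset card_mono)
  moreover have "card ?c = gauss q (dim u - rk u)"
    using card_coatoms[of "u \<inter> x" u] assms by (simp add: q_eq subspace_inter_x)
  ultimately show ?thesis using card_covers_below[OF assms] by simp
qed

text \<open>Entries of \<open>R1 R2\<close> and \<open>R2 R1\<close>. An interval of length 2 has q
  + 1 atoms. If the rank grows by 1 along it, the only atom that gains rank at the first step is u +
  (w \<inter> x); the other q gain it at the second.\<close>

lemma card_backslash_slash:
  "card {v. backslash_covers v u \<and> slash_covers w v} =
   q * card {v. slash_covers v u \<and> backslash_covers w v}"
proof (cases "\<exists>v. covers v u \<and> covers w v \<and> rk w = rk u + 1")
  case True
  then obtain v0 where v0: "covers v0 u" "covers w v0" and rk: "rk w = rk u + 1" by blast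
  have u: "subspace u" "subspace w" "u \<subseteq> w" "dim w = dim u + 2"
    using v0 by (auto simp: covers_def)
  let ?s = "{v. slash_covers v u \<and> backslash_covers w v}"
  let ?b = "{v. backslash_covers v u \<and> slash_covers w v}"
  have at: "covers v u \<and> covers w v \<longleftrightarrow> v \<in> atoms u w" for v
    using u by (auto simp: atoms_def covers_def)
  have "atoms u w = ?s \<union> ?b"
  proof (intro equalityI subsetI)
    fix v assume "v \<in> atoms u w"
    then have c: "covers v u" "covers w v" by (simp_all flip: at)
    then show "v \<in> ?s \<union> ?b"
      using covers_rk[of v u] rk by (auto simp: slash_covers_iff backslash_covers_iff)
  qed (auto simp: slash_covers_iff backslash_covers_iff simp flip: at)
  moreover have "?s \<inter> ?b = {}" by (auto simp: slash_covers_iff backslash_covers_iff)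
  ultimately have "card (atoms u w) = card ?s + card ?b"
    by (simp add: card_Un_disjoint)
  moreover have "card (atoms u w) = q + 1"
    using card_atoms[of u w] u by (simp add: q_eq gauss_def eval_nat_numeral)
  moreover have "?s = {join u (w \<inter> x)}"
  proof -
    let ?v = "join u (w \<inter> x)"
    have v: "?v \<subseteq> w" using u by (intro join_least) auto
    have "u \<inter> (w \<inter> x) = u \<inter> x" using u by auto
    then have d: "dim ?v = dim u + 1"
      using dim_join[of u "w \<inter> x"] u rk by (simp add: subspace_inter_x)
    then have c: "covers ?v u" using u join_ub(1)[of u "w \<inter> x"] by (simp add: covers_def)
    have c': "covers w ?v" using u d v by (simp add: covers_def)
    have "w \<inter> x \<subseteq> ?v \<inter> x" using join_ub(2)[of "w \<inter> x" u] by auto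
    with v have "?v \<inter> x = w \<inter> x" by auto
    then have "?v \<in> ?s" using c c' rk by (simp add: slash_covers_iff backslash_covers_iff)
    moreover have "v = ?v" if "v \<in> ?s" for v
    proof (rule covers_eq[symmetric])
      show "?v \<subseteq> v"
        using that by (intro join_least) (auto simp: slash_covers_iff backslash_covers_iff_inter covers_def)
    qed (use that c in \<open>auto simp: slash_covers_iff\<close>)
    ultimately show ?thesis by blast
  qed
  ultimately show ?thesis by simp
next
  case False
  then have "{v. backslash_covers v u \<and> slash_covers w v} = {}"
    "{v. slash_covers v u \<and> backslash_covers w v} = {}"
    by (auto simp: slash_covers_iff backslash_covers_iff)
  then show ?thesis by (simp only: card.empty)
qed

text \<open>Entries of \<open>R1 C\<close>, \<open>C R1\<close> and \<open>R1\<close>. If w is a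
  slash cover of u, the solutions on the left are the coatoms of [u \<inter> x, w] other than u that
  do not contain w \<inter> x: there are [j + 1] - [j] - 1 of them for j = dim u - rk u. Otherwise a
  solution on the right is unique, and when it exists the q + 1 atoms of [u \<inter> w, w] supply q
  solutions on the left.\<close>

lemma card_crel_slash:
  "card {v. crel u v \<and> slash_covers w v} =
   q * card {v. slash_covers v u \<and> crel v w} +
   (if slash_covers w u then q ^ (dim u - rk u) - 1 else 0)"
proof (cases "slash_covers w u")
  case True
  then have c: "covers w u" and sub: "subspace u" "subspace w" "u \<subseteq> w" "dim w = dim u + 1"
    and rk: "rk w = rk u + 1"
    by (auto simp: slash_covers_iff covers_def)
  let ?a = "coatoms (u \<inter> x) w" and ?b = "coatoms (w \<inter> x) w"
  \<comment> \<open>Here v and w would be two covers of u, so their meet is u, of smaller rank than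
    v; but \<open>crel\<close> preserves the rank in the meet.\<close>
  have "{v. slash_covers v u \<and> crel v w} = {}"
  proof safe
    fix v assume v: "slash_covers v u" "crel v w"
    then have "v \<noteq> w" by (auto simp: crel_def adjacent_def)
    then have "v \<inter> w = u" using covers_distinct(2)[of v u w] v c by (auto simp: slash_covers_iff)
    then show "v \<in> {}" using v by (auto simp: crel_iff_rk slash_covers_iff)
  qed
  moreover have "{v. crel u v \<and> slash_covers w v} = ?a - ?b - {u}"
  proof (intro equalityI subsetI)
    fix v assume "v \<in> {v. crel u v \<and> slash_covers w v}"
    then have v: "crel u v" "slash_covers w v" by auto
    then have "u \<inter> x \<subseteq> v" "v \<noteq> u" by (auto simp: crel_def adjacent_def)
    moreover have "\<not> w \<inter> x \<subseteq> v"
    proof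
      assume "w \<inter> x \<subseteq> v"
      then have "rk w \<le> rk v" by (intro dim_subset) auto
      then show False using v by (simp add: slash_covers_iff)
    qed
    ultimately show "v \<in> ?a - ?b - {u}" using v by (auto simp: coatoms_def slash_covers_iff)
  next
    fix v assume "v \<in> ?a - ?b - {u}"
    then have v: "covers w v" "u \<inter> x \<subseteq> v" "\<not> w \<inter> x \<subseteq> v" "v \<noteq> u" by (auto simp: coatoms_def)
    then have "\<not> backslash_covers w v" by (auto simp: backslash_covers_iff_inter)
    then have s: "slash_covers w v" using v covers_cases by blast
    have "adjacent u v" "join u v = w" using covered_distinct[OF c v(1)] v by auto
    moreover have "rk (u \<inter> v) = rk u" using v by (metis Int_absorb2 inf.left_commute inf_commute)
    ultimately have "crel u v" using s rk by (simp add: crel_iff_rk slash_covers_iff)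
    with s show "v \<in> {v. crel u v \<and> slash_covers w v}" by simp
  qed
  moreover have "card (?a - ?b - {u}) = q ^ (dim u - rk u) - 1"
  proof -
    have "u \<notin> ?b"
    proof
      assume "u \<in> ?b"
      then have "w \<inter> x \<subseteq> u \<inter> x" by (auto simp: coatoms_def)
      then show False using dim_subset[of "w \<inter> x" "u \<inter> x"] rk by simp
    qed
    then have "u \<in> ?a - ?b" using c by (auto simp: coatoms_def)
    moreover have "?b \<subseteq> ?a" using sub by (auto simp: coatoms_def)
    moreover have "card ?a = gauss q (Suc (dim u - rk u))"
      using card_coatoms[of "u \<inter> x" w] sub rk_le[of u]
      by (auto simp: q_eq subspace_inter_x Suc_diff_le)
    moreover have "card ?b = gauss q (dim u - rk u)"
      using card_coatoms[of "w \<inter> x" w] sub rk by (simp add: q_eq subspace_inter_x)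
    ultimately show ?thesis by (simp add: card_Diff_subset gauss_Suc)
  qed
  ultimately show ?thesis using True by simp
next
  case False
  \<comment> \<open>The only candidate on the right: such a v meets x where w does, so it contains w
    \<inter> x, which is not contained in u.\<close>
  let ?v0 = "join u (w \<inter> x)"
  have uniq: "v = ?v0" if v: "slash_covers v u" "crel v w" for v
  proof -
    have s: "subspace u" "subspace v" "u \<subseteq> v" "dim v = dim u + 1" "w \<inter> x = v \<inter> x" "rk v = rk u + 1"
      using v by (auto simp: slash_covers_iff covers_def crel_def)
    have sub: "?v0 \<subseteq> v" using s by (intro join_least) auto
    have "u \<noteq> ?v0"
    proof
      assume "u = ?v0"
      then have "w \<inter> x \<subseteq> u \<inter> x" using join_ub(2)[of "w \<inter> x" u] by auto
      then show False using dim_subset[of "w \<inter> x" "u \<inter> x"] s by simp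
    qed
    then have "dim u < dim ?v0" using s join_ub(1) by (intro dim_less) auto
    then have "?v0 = v" using s sub by (intro subspace_dim_equal) auto
    then show ?thesis by simp
  qed
  show ?thesis
  proof (cases "slash_covers ?v0 u \<and> crel ?v0 w")
    case True
    then have s0: "slash_covers ?v0 u" and c0: "crel ?v0 w" by auto
    then have s: "subspace u" "subspace w" "dim w = dim u + 1" "dim ?v0 = dim u + 1"
      and rk: "rk w = rk u + 1" and ix: "?v0 \<inter> x = w \<inter> x" and jx: "join ?v0 x = join w x"
      and a0: "adjacent ?v0 w" and cov0: "covers ?v0 u"
      by (auto simp: slash_covers_iff covers_def crel_def adjacent_def)
    have nsub: "\<not> u \<subseteq> w"
    proof
      assume "u \<subseteq> w"
      then have "slash_covers w u" using s rk by (simp add: slash_covers_iff covers_def)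
      then show False using False by simp
    qed
    have uw: "u \<inter> w = u \<inter> (?v0 \<inter> w)" using join_ub(1)[of u "w \<inter> x"] by blast
    have "u \<noteq> ?v0 \<inter> w" using nsub by auto
    then have "adjacent u (?v0 \<inter> w)"
      using covered_distinct[OF cov0 adjacent_covers(1)[OF a0]] by simp
    then have duw: "dim (u \<inter> w) + 1 = dim u" unfolding uw by (simp add: adjacent_def)
    have suw: "subspace (u \<inter> w)" using s by (simp add: subspace_inter)
    have "u \<inter> x \<subseteq> ?v0 \<inter> x" using cov0 by (auto simp: covers_def)
    then have uxw: "u \<inter> x \<subseteq> w" using ix by auto
    have w_le: "w \<subseteq> join u x"
    proof -
      have "w \<subseteq> join ?v0 x" using join_ub(1)[of w x] jx by simp
      then show ?thesis using slash_covers_join_eq[OF s0] by simp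
    qed
    have at0: "?v0 \<inter> w \<in> atoms (u \<inter> w) w"
    proof -
      have "subspace (?v0 \<inter> w)" using s by (simp add: subspace_inter)
      moreover have "dim (?v0 \<inter> w) = dim u" using a0 s by (simp add: adjacent_def)
      ultimately show ?thesis using suw duw join_ub(1)[of u "w \<inter> x"]
        by (auto simp: atoms_def covers_def)
    qed
    \<comment> \<open>All solutions have the same meet u \<inter> w with u. The excluded atom is the
      one containing w \<inter> x, below which no rank is lost.\<close>
    have "{v. crel u v \<and> slash_covers w v} = atoms (u \<inter> w) w - {?v0 \<inter> w}"
    proof (intro equalityI subsetI)
      fix v assume "v \<in> {v. crel u v \<and> slash_covers w v}"
      then have c: "crel u v" and sl: "slash_covers w v" by auto
      then have v: "subspace v" "v \<subseteq> w" "dim v = dim u" "dim (u \<inter> v) + 1 = dim u"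
        by (auto simp: crel_def adjacent_def slash_covers_iff covers_def)
      have "u \<inter> v \<subseteq> u \<inter> w" using v by auto
      then have "u \<inter> v = u \<inter> w"
        using v duw s suw by (intro subspace_dim_equal) (auto simp: subspace_inter)
      then have "u \<inter> w \<subseteq> v" by blast
      then have "v \<in> atoms (u \<inter> w) w" using v suw duw by (simp add: atoms_def covers_def)
      moreover have "v \<noteq> ?v0 \<inter> w"
      proof
        assume "v = ?v0 \<inter> w"
        then have "v \<inter> x = w \<inter> x" using ix by blast
        then show False using sl by (simp add: slash_covers_iff)
      qed
      ultimately show "v \<in> atoms (u \<inter> w) w - {?v0 \<inter> w}" by simp
    next
      fix v assume "v \<in> atoms (u \<inter> w) w - {?v0 \<inter> w}"
      then have cv: "covers v (u \<inter> w)" and vw: "v \<subseteq> w" and ne: "v \<noteq> ?v0 \<inter> w"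
        by (auto simp: atoms_def)
      then have v: "subspace v" "dim v = dim u" "u \<inter> w \<subseteq> v" using duw by (auto simp: covers_def)
      have cw: "covers w v" using v vw s by (simp add: covers_def)
      have "\<not> backslash_covers w v"
      proof
        assume "backslash_covers w v"
        then have vx: "w \<inter> x \<subseteq> v" by (auto simp: backslash_covers_iff_inter)
        have "v \<inter> (?v0 \<inter> w) = u \<inter> w"
          using covers_distinct(2)[OF cv _ ne] at0 by (simp add: atoms_def)
        moreover have "w \<inter> x \<subseteq> v \<inter> (?v0 \<inter> w)" using vx ix by blast
        ultimately have "w \<inter> x \<subseteq> u \<inter> x" by blast
        then show False using dim_subset[of "w \<inter> x" "u \<inter> x"] rk by simp
      qed
      then have sl: "slash_covers w v" using cw covers_cases by blast
      have vu: "v \<noteq> u" using nsub vw by auto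
      have "u \<inter> v = u \<inter> w" using v vw by blast
      then have a: "adjacent u v" using duw s v by (simp add: adjacent_def)
      have "u \<inter> v \<inter> x = u \<inter> x" using \<open>u \<inter> v = u \<inter> w\<close> uxw by blast
      moreover have "join u v \<subseteq> join u x"
        using join_ub(1)[of u x] vw w_le by (intro join_least) auto
      then have "slash_covers (join u v) u"
        using adjacent_covers(3)[OF a] by (simp add: slash_covers_iff_join)
      ultimately have "crel u v" using a sl rk by (simp add: crel_iff_rk slash_covers_iff)
      with sl show "v \<in> {v. crel u v \<and> slash_covers w v}" by simp
    qed
    moreover have "card (atoms (u \<inter> w) w) = q + 1"
    proof -
      have "dim w - dim (u \<inter> w) = 2" using duw s by simp
      then show ?thesis
        using card_atoms[of "u \<inter> w" w] suw s by (simp add: q_eq gauss_def eval_nat_numeral)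
    qed
    ultimately have "card {v. crel u v \<and> slash_covers w v} = q"
      using at0 by simp
    moreover have "{v. slash_covers v u \<and> crel v w} = {?v0}" using uniq s0 c0 by blast
    ultimately show ?thesis using False by simp
  next
    case F0: False
    \<comment> \<open>A solution on the left would force \<open>?v0\<close> to be a solution on the
      right.\<close>
    have "{v. crel u v \<and> slash_covers w v} = {}"
    proof safe
      fix v assume c: "crel u v" and sl: "slash_covers w v"
      then have s: "subspace u" "subspace v" "subspace w" "v \<subseteq> w" "dim v = dim u"
        "dim w = dim u + 1" "rk w = rk u + 1" "dim (u \<inter> v) + 1 = dim u" "u \<inter> x = v \<inter> x"
        and a: "adjacent u v"
        by (auto simp: crel_def adjacent_def slash_covers_iff covers_def)
      have nsub: "\<not> u \<subseteq> w"
      proof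
        assume "u \<subseteq> w"
        then have "slash_covers w u" using s by (simp add: slash_covers_iff covers_def)
        then show False using False by simp
      qed
      have "u \<inter> (w \<inter> x) = u \<inter> x" using s by blast
      then have d0: "dim ?v0 = dim u + 1"
        using dim_join[of u "w \<inter> x"] s by (simp add: subspace_inter_x)
      then have c0: "covers ?v0 u" using s join_ub(1) by (simp add: covers_def)
      have wx: "w \<inter> x \<subseteq> ?v0 \<inter> x" using join_ub(2)[of "w \<inter> x" u] by auto
      then have rk0: "rk ?v0 = rk u + 1"
        using covers_rk[OF c0] dim_subset[OF wx] s by auto
      then have s0: "slash_covers ?v0 u" using c0 by (simp add: slash_covers_iff)
      have ix: "w \<inter> x = ?v0 \<inter> x"
        using wx rk0 s by (intro subspace_dim_equal) (auto simp: subspace_inter_x)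
      have ne: "?v0 \<noteq> w" using nsub join_ub(1)[of u "w \<inter> x"] by auto
      have "?v0 \<inter> w \<noteq> u \<inter> v"
      proof
        assume "?v0 \<inter> w = u \<inter> v"
        then have "w \<inter> x \<subseteq> u \<inter> x" using ix by blast
        then show False using dim_subset[of "w \<inter> x" "u \<inter> x"] s by simp
      qed
      moreover have "u \<inter> v \<subseteq> ?v0 \<inter> w" using s join_ub(1)[of u "w \<inter> x"] by auto
      ultimately have "dim (u \<inter> v) < dim (?v0 \<inter> w)"
        using s by (intro dim_less) (auto simp: subspace_inter)
      moreover have "dim (?v0 \<inter> w) < dim w"
      proof (rule dim_less)
        show "?v0 \<inter> w \<noteq> w"
          using ne d0 s subspace_dim_equal[of w ?v0] by auto
      qed (use s in \<open>auto simp: subspace_inter\<close>)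
      ultimately have a0: "adjacent ?v0 w" using s d0 by (simp add: adjacent_def)
      have "join ?v0 x = join u x" by (rule slash_covers_join_eq[OF s0])
      also have "\<dots> = join v x" using c by (simp add: crel_def)
      also have "\<dots> = join w x" by (rule slash_covers_join_eq[OF sl, symmetric])
      finally have "crel ?v0 w" using a0 ix by (simp add: crel_def)
      then show "v \<in> {}" using s0 F0 by simp
    qed
    moreover have "{v. slash_covers v u \<and> crel v w} = {}" using uniq F0 by blast
    ultimately show ?thesis using False by (simp del: Collect_empty_eq)
  qed
qed

text \<open>Entries of \<open>C R2\<close>, \<open>R2 C\<close> and \<open>R2\<close>: the mirror
  image of \<open>card_crel_slash\<close>, with joins and meets exchanged and u + x in the role of u
  \<inter> x. The constant counts the atoms of [u, w + x] other than w that are not contained in u +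
  x.\<close>

lemma card_backslash_crel:
  "card {v. backslash_covers v u \<and> crel v w} =
   q * card {v. crel u v \<and> backslash_covers w v} +
   (if backslash_covers w u then q ^ (D - rk u) - 1 else 0)"
proof (cases "backslash_covers w u")
  case True
  then have c: "covers w u" and sub: "subspace u" "subspace w" "u \<subseteq> w" "dim w = dim u + 1"
    and rk: "rk w = rk u" and ix: "w \<inter> x = u \<inter> x" and ns: "\<not> w \<subseteq> join u x"
    using covers_cases[of w u]
    by (auto simp: backslash_covers_iff_inter covers_def slash_covers_iff_join)
  let ?a = "atoms u (join w x)" and ?b = "atoms u (join u x)"
  have "{v. crel u v \<and> backslash_covers w v} = {}"
  proof safe
    fix v assume v: "crel u v" "backslash_covers w v"
    then have "u \<noteq> v" by (auto simp: crel_def adjacent_def)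
    then have "join u v = w"
      using covered_distinct(2)[of w u v] v c by (auto simp: backslash_covers_iff)
    then show "v \<in> {}" using v rk by (auto simp: crel_iff_rk)
  qed
  moreover have "{v. backslash_covers v u \<and> crel v w} = ?a - ?b - {w}"
  proof (intro equalityI subsetI)
    fix v assume "v \<in> {v. backslash_covers v u \<and> crel v w}"
    then have v: "backslash_covers v u" "crel v w" by auto
    then have "v \<subseteq> join w x" "v \<noteq> w"
      using join_ub(1)[of v x] by (auto simp: crel_def adjacent_def)
    moreover have "\<not> v \<subseteq> join u x"
      using v covers_cases[of v u] by (auto simp: backslash_covers_iff slash_covers_iff_join)
    ultimately show "v \<in> ?a - ?b - {w}" using v by (auto simp: atoms_def backslash_covers_iff)
  next
    fix v assume "v \<in> ?a - ?b - {w}"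
    then have v: "covers v u" "v \<subseteq> join w x" "\<not> v \<subseteq> join u x" "v \<noteq> w" by (auto simp: atoms_def)
    then have b: "backslash_covers v u" using covers_cases by (auto simp: slash_covers_iff_join)
    have "adjacent v w" using covers_distinct[OF v(1) c] v by auto
    moreover have "v \<inter> x = w \<inter> x" using b ix by (simp add: backslash_covers_iff_inter)
    moreover have "join v x = join w x"
    proof (rule subspace_dim_equal)
      show "join v x \<subseteq> join w x" by (rule join_x_idem[OF v(2)])
      show "dim (join w x) \<le> dim (join v x)"
        using dim_join_x[of v] dim_join_x[of w] v sub \<open>v \<inter> x = w \<inter> x\<close> by (simp add: covers_def)
    qed auto
    ultimately show "v \<in> {v. backslash_covers v u \<and> crel v w}" using b by (simp add: crel_def)
  qed
  moreover have "card (?a - ?b - {w}) = q ^ (D - rk u) - 1"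
  proof -
    have d: "dim (join u x) - dim u = D - rk u" "dim (join w x) - dim u = Suc (D - rk u)"
      using dim_join_x[of u] dim_join_x[of w] sub rk rk_le[of u] by linarith+
    have "w \<in> ?a - ?b" using c ns join_ub(1)[of w x] by (auto simp: atoms_def)
    moreover have "?b \<subseteq> ?a" using join_x_mono[OF sub(3)] by (auto simp: atoms_def)
    moreover have "card ?a = gauss q (Suc (D - rk u))"
      using card_atoms[of u "join w x"] sub join_ub(1)[of w x] d by (simp add: q_eq)
    moreover have "card ?b = gauss q (D - rk u)"
      using card_atoms[of u "join u x"] sub join_ub(1)[of u x] d by (simp add: q_eq)
    ultimately show ?thesis by (simp add: card_Diff_subset gauss_Suc)
  qed
  ultimately show ?thesis using True by simp
next
  case False
  \<comment> \<open>The only candidate on the right: such a v has the same sum with x as u, and w is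
    not contained in that sum.\<close>
  let ?u0 = "w \<inter> join u x"
  have uniq: "v = ?u0" if v: "crel u v" "backslash_covers w v" for v
  proof -
    have s: "subspace w" "subspace v" "v \<subseteq> w" "dim w = dim v + 1" "join u x = join v x" "\<not> w \<subseteq> join v x"
      using v covers_cases[of w v]
      by (auto simp: backslash_covers_iff covers_def crel_def slash_covers_iff_join)
    have sub: "v \<subseteq> ?u0" using s join_ub(1)[of v x] by auto
    have "dim ?u0 < dim w" using s by (intro dim_less) (auto simp: subspace_inter)
    then show ?thesis using s sub by (intro subspace_dim_equal) (auto simp: subspace_inter)
  qed
  show ?thesis
  proof (cases "crel u ?u0 \<and> backslash_covers w ?u0")
    case True
    then have s0: "backslash_covers w ?u0" and c0: "crel u ?u0" by auto
    then have s: "subspace u" "subspace w" "dim w = dim u + 1" "dim ?u0 = dim u"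
      and rk: "rk w = rk u" and ix: "u \<inter> x = w \<inter> x" and jx: "join u x = join ?u0 x"
      and a0: "adjacent u ?u0" and cov0: "covers w ?u0"
      by (auto simp: backslash_covers_iff_inter covers_def crel_def adjacent_def)
    have nw: "\<not> w \<subseteq> join u x"
    proof
      assume "w \<subseteq> join u x"
      then have "?u0 = w" by blast
      then show False using s by simp
    qed
    have nsub: "\<not> u \<subseteq> w"
    proof
      assume "u \<subseteq> w"
      then have "u \<subseteq> ?u0" using join_ub(1)[of u x] by auto
      then have "u = ?u0" using s by (intro subspace_dim_equal) (auto simp: subspace_inter)
      then show False using adjacent_neq[OF a0] by simp
    qed
    let ?j = "join u w"
    have "u \<inter> w = u \<inter> ?u0" using join_ub(1)[of u x] by auto
    then have "dim (u \<inter> w) + 1 = dim u" using a0 by (simp add: adjacent_def)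
    then have dj: "dim ?j = dim u + 2" using dim_join[of u w] s by simp
    have at0: "join u ?u0 \<in> atoms u ?j"
      using adjacent_covers(3)[OF a0] join_ub(1)[of u w] join_ub(2)[of w u]
        join_least[of u ?j ?u0]
      by (simp add: atoms_def le_infI1)
    have j0: "join u ?u0 \<subseteq> join u x" using join_ub(1)[of u x] by (intro join_least) auto
    \<comment> \<open>The dual count: of the q + 1 atoms of [u, u + w], only u + \<open>?u0\<close>
      lies in u + x and is therefore a slash cover.\<close>
    have "{v. backslash_covers v u \<and> crel v w} = atoms u ?j - {join u ?u0}"
    proof (intro equalityI subsetI)
      fix v assume "v \<in> {v. backslash_covers v u \<and> crel v w}"
      then have b: "backslash_covers v u" and c: "crel v w" by auto
      then have v: "subspace v" "u \<subseteq> v" "covers v u" and a: "adjacent v w"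
        by (auto simp: crel_def backslash_covers_iff covers_def)
      have "?j \<subseteq> join v w" using v join_ub(1)[of v w] join_ub(2)[of w v] by (intro join_least) auto
      moreover have "dim (join v w) = dim u + 2"
        using adjacent_covers(4)[OF a] s by (simp add: covers_def)
      ultimately have "?j = join v w" using dj by (intro subspace_dim_equal) auto
      then have "v \<in> atoms u ?j" using v join_ub(1)[of v w] by (simp add: atoms_def)
      moreover have "v \<noteq> join u ?u0"
        using j0 b covers_cases[OF v(3)] v(3) by (auto simp: slash_covers_iff_join)
      ultimately show "v \<in> atoms u ?j - {join u ?u0}" by simp
    next
      fix v assume "v \<in> atoms u ?j - {join u ?u0}"
      then have cv: "covers v u" and vj: "v \<subseteq> ?j" and ne: "v \<noteq> join u ?u0"
        by (auto simp: atoms_def)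
      then have v: "subspace v" "dim v = dim u + 1" "u \<subseteq> v" by (auto simp: covers_def)
      have "\<not> v \<subseteq> join u x"
      proof
        assume vx: "v \<subseteq> join u x"
        have c: "covers (join u ?u0) u" using at0 by (simp add: atoms_def)
        have "dim (join v (join u ?u0)) = dim u + 2"
          using adjacent_covers(3)[OF covers_distinct(1)[OF cv c ne]] v by (simp add: covers_def)
        moreover have "join v (join u ?u0) \<subseteq> ?j"
          using join_least[OF vj, of "join u ?u0"] at0 by (simp add: atoms_def)
        ultimately have "join v (join u ?u0) = ?j" using dj by (intro subspace_dim_equal) auto
        moreover have "join v (join u ?u0) \<subseteq> join u x" by (rule join_least[OF vx j0]) simp
        ultimately show False using nw join_ub(2)[of w u] by auto
      qed
      then have b: "backslash_covers v u"
        using cv covers_cases by (auto simp: slash_covers_iff_join)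
      have vx: "v \<inter> x = w \<inter> x" using b ix by (simp add: backslash_covers_iff_inter)
      have "join v w \<subseteq> ?j" using vj join_ub(2)[of w u] by (intro join_least) auto
      then have "dim (join v w) \<le> dim u + 2" using dj by (metis dim_subset)
      then have ge: "dim u \<le> dim (v \<inter> w)" using dim_join[of v w] v s by simp
      have "v \<noteq> w" using nsub v by auto
      then have "v \<inter> w \<noteq> w" using v s subspace_dim_equal[of w v] by auto
      then have "dim (v \<inter> w) < dim w"
        using v s by (intro dim_less) (auto simp: subspace_inter)
      then have a: "adjacent v w" using ge v s by (simp add: adjacent_def)
      have "u \<subseteq> join w x"
        using join_ub(1)[of u x] jx join_x_mono[of ?u0 w] by auto
      then have "?j \<subseteq> join w x" using join_ub(1)[of w x] by (intro join_least) auto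
      then have "join v x \<subseteq> join w x" using vj by (intro join_x_idem) auto
      moreover have "dim (join v x) = dim (join w x)"
        using dim_join_x[of v] dim_join_x[of w] v s vx by simp
      ultimately have "join v x = join w x" by (intro subspace_dim_equal) auto
      then have "crel v w" using a vx by (simp add: crel_def)
      with b show "v \<in> {v. backslash_covers v u \<and> crel v w}" by simp
    qed
    moreover have "card (atoms u ?j) = q + 1"
      using card_atoms[of u ?j] s dj join_ub(1)[of u w] by (simp add: q_eq gauss_def eval_nat_numeral)
    ultimately have "card {v. backslash_covers v u \<and> crel v w} = q"
      using at0 by simp
    moreover have "{v. crel u v \<and> backslash_covers w v} = {?u0}" using uniq s0 c0 by blast
    ultimately show ?thesis using False by simp
  next
    case F0: False
    have "{v. backslash_covers v u \<and> crel v w} = {}"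
    proof safe
      fix v assume b: "backslash_covers v u" and c: "crel v w"
      then have s: "subspace u" "subspace v" "subspace w" "u \<subseteq> v" "dim v = dim u + 1"
        "dim w = dim u + 1" "rk w = rk u" "dim (v \<inter> w) = dim u" "u \<inter> x = w \<inter> x" "join v x = join w x"
        and a: "adjacent v w" and cv: "covers v u"
        by (auto simp: crel_def adjacent_def backslash_covers_iff_inter covers_def)
      have nsub: "\<not> u \<subseteq> w"
      proof
        assume "u \<subseteq> w"
        then have "backslash_covers w u" using s by (simp add: backslash_covers_iff covers_def)
        then show False using False by simp
      qed
      have dux: "dim (join w x) = dim (join u x) + 1"
        using dim_join_x[OF s(1)] dim_join_x[OF s(3)] s(6,7) by linarith
      have nw: "\<not> w \<subseteq> join u x"
      proof
        assume "w \<subseteq> join u x"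
        then have "dim (join w x) \<le> dim (join u x)" by (intro dim_subset join_x_idem)
        then show False using dux by simp
      qed
      have "join w (join u x) \<subseteq> join w x"
        using join_x_mono[OF s(4)] s(10) join_ub(1)[of w x] by (simp add: join_least)
      then have "dim (join w (join u x)) \<le> dim (join u x) + 1" using dux by (metis dim_subset)
      then have "dim u \<le> dim ?u0" using dim_join[OF s(3), of "join u x"] s(6) by simp
      moreover have "dim ?u0 < dim w"
        using nw s(3) by (intro dim_less) (auto simp: subspace_inter)
      ultimately have d0: "dim ?u0 = dim u" using s(6) by linarith
      have sub0: "subspace ?u0" using s(3) by (simp add: subspace_inter)
      have cov0: "covers w ?u0" using d0 s(3,6) sub0 by (simp add: covers_def)
      have ix0: "?u0 \<inter> x = w \<inter> x" using join_ub(2)[of x u] by auto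
      then have b0: "backslash_covers w ?u0" using cov0 by (simp add: backslash_covers_iff_inter)
      have "join ?u0 x = join u x"
      proof (rule subspace_dim_equal)
        show "join ?u0 x \<subseteq> join u x" by (rule join_x_idem) auto
        show "dim (join u x) \<le> dim (join ?u0 x)"
          using dim_join_x[OF s(1)] dim_join_x[OF sub0] s(7) d0 unfolding ix0 by linarith
      qed auto
      moreover have "adjacent u ?u0"
      proof -
        have ne: "u \<noteq> v \<inter> w" using nsub by auto
        have "adjacent u (v \<inter> w)"
          using covered_distinct(1)[OF cv adjacent_covers(1)[OF a] ne] .
        moreover have "u \<inter> (v \<inter> w) = u \<inter> ?u0" using s(4) join_ub(1)[of u x] by auto
        ultimately show ?thesis using s(1) sub0 d0 by (simp add: adjacent_def)
      qed
      ultimately have "crel u ?u0" using ix0 s(9) by (simp only: crel_def)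
      then show "v \<in> {}" using b0 F0 by simp
    qed
    moreover have "{v. crel u v \<and> backslash_covers w v} = {}" using uniq F0 by blast
    ultimately show ?thesis using False by (simp del: Collect_empty_eq)
  qed
qed

end

subsection \<open>Commutation relations\<close>

definition rel_mat :: "('n \<Rightarrow> 'n \<Rightarrow> bool) \<Rightarrow> complex ^ 'n ^ 'n::finite" where
  "rel_mat R = (\<chi> u v. if R u v then 1 else 0)"

lemma rel_mat_entry: "rel_mat R $ u $ v = (if R u v then 1 else 0)"
  by (simp add: rel_mat_def)

lemma rel_mat_mult: "(rel_mat R ** rel_mat S) $ u $ w = of_nat (card {v. R u v \<and> S v w})"
proof -
  have "(rel_mat R ** rel_mat S) $ u $ w = (\<Sum>v\<in>UNIV. if R u v \<and> S v w then 1 else 0)"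
    unfolding rel_mat_def matrix_matrix_mult_def by (auto intro!: sum.cong)
  also have "\<dots> = of_nat (card {v. R u v \<and> S v w})"
    by (simp add: sum.If_cases)
  finally show ?thesis .
qed

text \<open>The second coefficient may vary with the row because powers such as q^j depend on the
  subspace; \<open>scale_supported\<close> turns it into a scalar on homogeneous vectors.\<close>

lemma mult_vec_linear_comb:
  assumes "\<And>u w. M $ u $ w = c * M1 $ u $ w + d u * M2 $ u $ w"
  shows "M *v f = c *s (M1 *v f) + (\<chi> u. d u * (M2 *v f) $ u)"
  by (simp add: vec_eq_iff matrix_vector_mult_def assms algebra_simps sum.distrib sum_distrib_left)

lemma mult_vec_cong: "(\<And>u w. M $ u $ w = M' $ u $ w) \<Longrightarrow> M *v f = M' *v f"
  by (simp add: matrix_vector_mult_def)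

lemma mult_vec_scale: "(\<And>u w. M $ u $ w = c * M' $ u $ w) \<Longrightarrow> M *v f = c *s (M' *v f)"
  by (simp add: vec_eq_iff matrix_vector_mult_def sum_distrib_left mult.assoc)

lemma mult_vec_funpow_scale: "((*v) (M :: complex ^ 'n ^ 'n::finite)  ^^ k) (a *s f) = a *s ((*v) M ^^ k) f"
  by (induction k) (simp_all add: vector_scalar_commute)

lemma mult_vec_funpow_diff:
  "((*v) (M :: complex ^ 'n ^ 'n::finite) ^^ k) (f - g) = ((*v) M ^^ k) f - ((*v) M ^^ k) g"
  by (induction k) (simp_all add: matrix_vector_mult_diff_distrib)

lemma mult_vec_funpow_0: "((*v) (M :: complex ^ 'n ^ 'n::finite) ^^ k) 0 = 0"
  by (induction k) simp_all

lemma mult_vec_funpow_eq_0_mono: "((*v) (M :: complex ^ 'n ^ 'n::finite) ^^ k) f = 0 \<Longrightarrow> k \<le> l \<Longrightarrow> ((*v) M ^^ l) f = 0"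
  using funpow_add[of "l - k" k "(*v) M"] by (simp add: mult_vec_funpow_0)

lemma supported_subspace: "vec.subspace (supported S)"
  by (auto simp: vec.subspace_def supported_def)

lemma supported_mono: "S \<subseteq> S' \<Longrightarrow> supported S \<subseteq> supported S'"
  by (auto simp: supported_def)

lemma supported_empty: "supported {} = {0}"
  by (auto simp: supported_def vec_eq_iff)

lemma diag_on_mult_vec: "(diag_on S d *v f) $ u = (if u \<in> S then d u * f $ u else 0)"
proof -
  have "(diag_on S d *v f) $ u = (\<Sum>v\<in>UNIV. if u = v then (if u \<in> S then d u * f $ u else 0) else 0)"
    unfolding diag_on_def matrix_vector_mult_def vec_lambda_beta by (rule sum.cong) auto
  then show ?thesis by simp
qed

lemma scale_supported:
  assumes "g \<in> supported S" "\<And>u. u \<in> S \<Longrightarrow> d u = c"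
  shows "(\<chi> u. d u * g $ u) = c *s g"
proof (rule vec_eq_iff[THEN iffD2], rule allI)
  fix u
  show "(\<chi> u. d u * g $ u) $ u = (c *s g) $ u"
    using assms by (cases "u \<in> S") (simp_all add: supported_def)
qed

lemma rel_mat_mult_supported:
  assumes "f \<in> supported S" "\<And>u v. R u v \<Longrightarrow> v \<in> S \<Longrightarrow> u \<in> S'"
  shows "rel_mat R *v f \<in> supported S'"
  unfolding supported_def matrix_vector_mult_def rel_mat_def
proof (intro CollectI allI impI, simp, intro sum.neutral ballI)
  fix u v assume "u \<notin> S'"
  then show "(if R u v then 1 else 0) * f $ v = 0"
    using assms by (auto simp: supported_def)
qed

context grassmann
begin

abbreviation hom :: "nat \<Rightarrow> nat \<Rightarrow> (complex ^ 'v set) set" where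
  "hom i j \<equiv> supported (Pij i j)"

definition C :: "complex ^ 'v set ^ 'v set" where
  "C = rel_mat crel"

abbreviation qc :: complex where
  "qc \<equiv> of_nat q"

lemma L1_eq: "L1 = rel_mat (\<lambda>u v. slash_covers v u)"
  and L2_eq: "L2 = rel_mat (\<lambda>u v. backslash_covers v u)"
  and R1_eq: "R1 = rel_mat slash_covers"
  and R2_eq: "R2 = rel_mat backslash_covers"
  by (simp_all add: L1_def L2_def R1_def R2_def rel_mat_def transpose_def)

lemmas mat_eqs = L1_eq L2_eq R1_eq R2_eq C_def

lemma Pij_iff: "u \<in> Pij i j \<longleftrightarrow> subspace u \<and> rk u = i \<and> dim u = i + j"
  by (auto simp: Pij_def P_def)

lemma qc_neq: "qc \<noteq> 0" "qc \<noteq> 1"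
  using q_ge_2 by auto

lemma gauss_complex: "(qc - 1) * of_nat (gauss q n) = qc ^ n - 1"
  by (induction n) (simp_all add: gauss_Suc algebra_simps)

lemma Pij_bounds:
  assumes "Pij i j \<noteq> {}"
  shows "i \<le> D" "j \<le> N - D"
proof -
  obtain u where "u \<in> Pij i j" using assms by blast
  then have u: "subspace u" "rk u = i" "dim u = i + j" by (auto simp: Pij_iff)
  then show "i \<le> D" using rk_le[of u] by simp
  show "j \<le> N - D" using dim_join_x[of u] u dim_le_N[of "join u x"] by simp
qed

text \<open>Vectors of an impossible degree are 0; this makes \<open>R1\<close> and
  \<open>R2\<close> nilpotent on homogeneous vectors.\<close>

lemma hom_bounds:
  assumes "f \<in> hom i j" "f \<noteq> 0"
  shows "i \<le> D" "j \<le> N - D"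
  using assms Pij_bounds[of i j] by (cases "Pij i j = {}"; simp add: supported_empty)+

lemma hom_subspace: "vec.subspace (hom i j)"
  by (rule supported_subspace)

lemma R1_hom: "f \<in> hom i j \<Longrightarrow> R1 *v f \<in> hom (Suc i) j"
  unfolding R1_eq
  by (rule rel_mat_mult_supported) (auto simp: Pij_iff slash_covers_iff covers_def)

lemma R2_hom: "f \<in> hom i j \<Longrightarrow> R2 *v f \<in> hom i (Suc j)"
  unfolding R2_eq
  by (rule rel_mat_mult_supported) (auto simp: Pij_iff backslash_covers_iff covers_def)

lemma L1_hom: "f \<in> hom (Suc i) j \<Longrightarrow> L1 *v f \<in> hom i j"
  unfolding L1_eq
  by (rule rel_mat_mult_supported) (auto simp: Pij_iff slash_covers_iff covers_def)

lemma L2_hom: "f \<in> hom i (Suc j) \<Longrightarrow> L2 *v f \<in> hom i j"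
  unfolding L2_eq
  by (rule rel_mat_mult_supported) (auto simp: Pij_iff backslash_covers_iff covers_def)

lemma L1_hom_0:
  assumes "f \<in> hom 0 j"
  shows "L1 *v f = 0"
proof -
  have "L1 *v f \<in> supported {}"
    unfolding L1_eq using assms
    by (rule rel_mat_mult_supported) (auto simp: Pij_iff slash_covers_iff covers_def)
  then show ?thesis by (simp add: supported_empty)
qed

lemma L2_hom_0:
  assumes "f \<in> hom i 0"
  shows "L2 *v f = 0"
proof -
  have "rk u < dim v" if "backslash_covers v u" for u v
    using that rk_le(1)[of u] by (auto simp: backslash_covers_iff covers_def)
  then have "L2 *v f \<in> supported {}"
    unfolding L2_eq using assms
    by (rule_tac rel_mat_mult_supported) (fastforce simp: Pij_iff backslash_covers_iff)+
  then show ?thesis by (simp add: supported_empty)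
qed

lemma C_hom: "f \<in> hom i j \<Longrightarrow> C *v f \<in> hom i j"
  unfolding C_def
  by (rule rel_mat_mult_supported) (auto simp: Pij_iff crel_def adjacent_def)

lemma L1_R2: "L1 *v (R2 *v f) = R2 *v (L1 *v f)"
  unfolding matrix_vector_mul_assoc mat_eqs
  by (rule mult_vec_cong) (simp add: rel_mat_mult card_slash_backslash_above)

lemma L2_R1: "L2 *v (R1 *v f) = R1 *v (L2 *v f)"
  unfolding matrix_vector_mul_assoc mat_eqs
  by (rule mult_vec_cong) (simp add: rel_mat_mult card_slash_backslash_above[symmetric] conj_commute)

lemma R1_R2: "R1 *v (R2 *v f) = qc *s (R2 *v (R1 *v f))"
  unfolding matrix_vector_mul_assoc mat_eqs
proof (rule mult_vec_scale)
  fix u w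
  show "(rel_mat slash_covers ** rel_mat backslash_covers) $ u $ w =
        qc * (rel_mat backslash_covers ** rel_mat slash_covers) $ u $ w"
    using card_backslash_slash[of w u] by (simp add: rel_mat_mult conj_commute)
qed

text \<open>The off-diagonal part of the commutator is \<open>C\<close>; the diagonal part compares
  [D - i] slash covers above a subspace with [i + j] - [j] below it.\<close>

lemma L1_R1:
  assumes f: "f \<in> hom i j"
  shows "L1 *v (R1 *v f) = R1 *v (L1 *v f) + C *v f +
    (of_nat (gauss q (D - i)) + of_nat (gauss q j) - of_nat (gauss q (i + j))) *s f"
proof (intro vec_eq_iff[THEN iffD2] allI)
  fix u
  let ?d = "of_nat (gauss q (D - i)) + of_nat (gauss q j) - of_nat (gauss q (i + j)) :: complex"
  let ?M = "L1 ** R1" and ?M' = "R1 ** L1"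
  have "?M $ u $ w * f $ w = ?M' $ u $ w * f $ w + C $ u $ w * f $ w + (if w = u then ?d * f $ w else 0)" for w
  proof (cases "w = u")
    case False
    then have "?M $ u $ w = ?M' $ u $ w + C $ u $ w"
      unfolding mat_eqs rel_mat_mult using card_slash_above_below[of u w]
      by (simp add: rel_mat_def)
    then show ?thesis using False by (simp add: algebra_simps)
  next
    case True
    show ?thesis
    proof (cases "w \<in> Pij i j")
      case F: False
      then have "f $ w = 0" using f by (simp add: supported_def)
      then show ?thesis using True by simp
    next
      case T: True
      have "?M $ w $ w = of_nat (gauss q (D - i))"
        using T card_slash_above[of w] by (simp add: mat_eqs rel_mat_mult Pij_iff)
      moreover have "?M' $ w $ w + of_nat (gauss q j) = of_nat (gauss q (i + j))"
        using T arg_cong[OF card_slash_below[of w], of "of_nat :: nat \<Rightarrow> complex"]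
        by (simp add: mat_eqs rel_mat_mult Pij_iff)
      moreover have "C $ w $ w = 0" by (simp add: C_def rel_mat_def crel_def adjacent_def)
      ultimately show ?thesis using True by (simp add: algebra_simps flip: \<open>_ + _ = of_nat (gauss q (i+j))\<close>)
    qed
  qed
  then have "(\<Sum>w\<in>UNIV. ?M $ u $ w * f $ w) =
     (\<Sum>w\<in>UNIV. ?M' $ u $ w * f $ w + C $ u $ w * f $ w + (if w = u then ?d * f $ w else 0))"
    by (intro sum.cong) auto
  then show "(L1 *v (R1 *v f)) $ u = (R1 *v (L1 *v f) + C *v f + ?d *s f) $ u"
    unfolding matrix_vector_mul_assoc by (simp add: matrix_vector_mult_def sum.distrib algebra_simps)
qed

section \<open>Covers of both kinds together, without reference to x\<close>

definition L :: "complex ^ 'v set ^ 'v set" where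
  "L = rel_mat (\<lambda>u v. covers v u)"

definition R :: "complex ^ 'v set ^ 'v set" where
  "R = rel_mat covers"

lemma L_eq: "L *v f = L1 *v f + L2 *v f"
proof -
  have "L = L1 + L2"
    using covers_cases by (auto simp: vec_eq_iff L_def L1_eq L2_eq rel_mat_def slash_covers_iff backslash_covers_iff)
  then show ?thesis by (simp add: matrix_vector_mult_add_rdistrib)
qed

lemma R_eq: "R *v f = R1 *v f + R2 *v f"
proof -
  have "R = R1 + R2"
    using covers_cases by (auto simp: vec_eq_iff R_def R1_eq R2_eq rel_mat_def slash_covers_iff backslash_covers_iff)
  then show ?thesis by (simp add: matrix_vector_mult_add_rdistrib)
qed

abbreviation level :: "nat \<Rightarrow> 'v set set" where
  "level h \<equiv> {u. subspace u \<and> dim u = h}"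

text \<open>Common upper and common lower covers of distinct subspaces match, so the commutator is
  diagonal: [N - h] covers above against [h] below.\<close>

lemma L_R:
  assumes f: "f \<in> supported (level h)"
  shows "L *v (R *v f) = R *v (L *v f) + (of_nat (gauss q (N - h)) - of_nat (gauss q h)) *s f"
proof (intro vec_eq_iff[THEN iffD2] allI)
  fix u
  let ?d = "of_nat (gauss q (N - h)) - of_nat (gauss q h) :: complex"
  let ?M = "L ** R" and ?M' = "R ** L"
  have "?M $ u $ w * f $ w = ?M' $ u $ w * f $ w + (if w = u then ?d * f $ w else 0)" for w
  proof (cases "w = u")
    case False
    then have "?M $ u $ w = ?M' $ u $ w"
      unfolding L_def R_def rel_mat_mult using card_covers_above_below[of u w] by simp
    then show ?thesis using False by simp
  next
    case True
    show ?thesis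
    proof (cases "w \<in> level h")
      case F: False
      then have "f $ w = 0" using f by (simp add: supported_def)
      then show ?thesis using True by simp
    next
      case T: True
      then have "?M $ w $ w = of_nat (gauss q (N - h))" "?M' $ w $ w = of_nat (gauss q h)"
        using card_covers_above[of w] card_covers_below[of w]
        by (simp_all add: L_def R_def rel_mat_mult)
      then show ?thesis using True by (simp add: algebra_simps)
    qed
  qed
  then have "(\<Sum>w\<in>UNIV. ?M $ u $ w * f $ w) =
     (\<Sum>w\<in>UNIV. ?M' $ u $ w * f $ w + (if w = u then ?d * f $ w else 0))"
    by (intro sum.cong) auto
  then show "(L *v (R *v f)) $ u = (R *v (L *v f) + ?d *s f) $ u"
    unfolding matrix_vector_mul_assoc by (simp add: matrix_vector_mult_def sum.distrib algebra_simps)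
qed

lemma Pij_level: "Pij i j \<subseteq> level (i + j)"
  by (auto simp: Pij_iff)

lemma hom_level: "f \<in> hom i j \<Longrightarrow> f \<in> supported (level (i + j))"
  using supported_mono[OF Pij_level] by auto

text \<open>The relation of \<open>L_R\<close> minus that of \<open>L1_R1\<close>: the mixed terms
  commute and cancel, leaving \<open>C\<close> with the opposite sign.\<close>

lemma L2_R2:
  assumes f: "f \<in> hom i j"
  shows "L2 *v (R2 *v f) = R2 *v (L2 *v f) - C *v f +
    (of_nat (gauss q (N - (i + j))) - of_nat (gauss q (D - i)) - of_nat (gauss q j)) *s f"
proof -
  have "L *v (R *v f) = L1 *v (R1 *v f) + L2 *v (R1 *v f) + L1 *v (R2 *v f) + L2 *v (R2 *v f)"
    by (simp add: L_eq R_eq matrix_vector_right_distrib)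
  moreover have "R *v (L *v f) = R1 *v (L1 *v f) + R2 *v (L1 *v f) + R1 *v (L2 *v f) + R2 *v (L2 *v f)"
    by (simp add: L_eq R_eq matrix_vector_right_distrib)
  ultimately show ?thesis
    using L_R[OF hom_level[OF f]] L1_R1[OF f]
    by (simp add: L1_R2 L2_R1 algebra_simps vec.scale_left_distrib vec.scale_left_diff_distrib)
qed

lemma R1_C:
  assumes f: "f \<in> hom i j"
  shows "R1 *v (C *v f) = qc *s (C *v (R1 *v f)) + (qc ^ j - 1) *s (R1 *v f)"
proof -
  have "R1 *v (C *v f) = qc *s (C *v (R1 *v f)) + (\<chi> u. (qc ^ (dim u - rk u) - 1) * (R1 *v f) $ u)"
    unfolding matrix_vector_mul_assoc
  proof (rule mult_vec_linear_comb)
    fix u w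
    have "slash_covers u w \<Longrightarrow> dim w - rk w = dim u - rk u"
      by (auto simp: slash_covers_iff covers_def)
    then show "(R1 ** C) $ u $ w = qc * (C ** R1) $ u $ w + (qc ^ (dim u - rk u) - 1) * R1 $ u $ w"
      using card_crel_slash[of w u] q_ge_2
      by (simp add: mat_eqs rel_mat_mult rel_mat_entry of_nat_diff conj_commute crel_sym)
  qed
  also have "(\<chi> u. (qc ^ (dim u - rk u) - 1) * (R1 *v f) $ u) = (qc ^ j - 1) *s (R1 *v f)"
    by (rule scale_supported[OF R1_hom[OF f]]) (auto simp: Pij_iff)
  finally show ?thesis .
qed

lemma C_R2:
  assumes f: "f \<in> hom i j"
  shows "C *v (R2 *v f) = qc *s (R2 *v (C *v f)) + (qc ^ (D - i) - 1) *s (R2 *v f)"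
proof -
  have "C *v (R2 *v f) = qc *s (R2 *v (C *v f)) + (\<chi> u. (qc ^ (D - rk u) - 1) * (R2 *v f) $ u)"
    unfolding matrix_vector_mul_assoc
  proof (rule mult_vec_linear_comb)
    fix u w
    have "backslash_covers u w \<Longrightarrow> rk w = rk u"
      by (auto simp: backslash_covers_iff)
    then show "(C ** R2) $ u $ w = qc * (R2 ** C) $ u $ w + (qc ^ (D - rk u) - 1) * R2 $ u $ w"
      using card_backslash_crel[of w u] q_ge_2
      by (simp add: mat_eqs rel_mat_mult rel_mat_entry of_nat_diff conj_commute crel_sym)
  qed
  also have "(\<chi> u. (qc ^ (D - rk u) - 1) * (R2 *v f) $ u) = (qc ^ (D - i) - 1) *s (R2 *v f)"
    by (rule scale_supported[OF R2_hom[OF f]]) (auto simp: Pij_iff)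
  finally show ?thesis .
qed

text \<open>
  On bilinear forms of rank \<open>\<rho>\<close> (the characters of the additive group of linear maps) \<open>C\<close> has the
  eigenvalue \<open>(q\<^sup>D\<^sup>-\<^sup>i\<^sup>+\<^sup>j\<^sup>-\<^sup>\<rho> - q\<^sup>D\<^sup>-\<^sup>i - q\<^sup>j + 1) / (q - 1)\<close>; the operator \<open>Q\<close> is normalized to have the eigenvalue
  \<open>q\<^sup>-\<^sup>\<rho>\<close>, which does not depend on \<open>i\<close> and \<open>j\<close>.
\<close>

definition Q :: "nat \<Rightarrow> nat \<Rightarrow> complex ^ 'v set \<Rightarrow> complex ^ 'v set" where
  "Q i j f = inverse (qc ^ (D - i) * qc ^ j) *s ((qc - 1) *s (C *v f) + (qc ^ (D - i) + qc ^ j - 1) *s f)"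

lemma Q_hom: "f \<in> hom i j \<Longrightarrow> Q i j f \<in> hom i j"
  unfolding Q_def by (intro vec.subspace_scale vec.subspace_add hom_subspace C_hom)

lemma C_eq_Q:
  "(qc - 1) *s (C *v f) = (qc ^ (D - i) * qc ^ j) *s Q i j f - (qc ^ (D - i) + qc ^ j - 1) *s f"
proof -
  have inv: "(qc ^ (D - i) * qc ^ j) * inverse (qc ^ (D - i) * qc ^ j) = 1"
    using qc_neq by (intro right_inverse) simp
  have "(qc ^ (D - i) * qc ^ j) *s Q i j f = (qc - 1) *s (C *v f) + (qc ^ (D - i) + qc ^ j - 1) *s f"
    by (simp only: Q_def vec.scale_scale inv vec.scale_one)
  then show ?thesis by (simp only: add_diff_cancel_right')
qed

text \<open>The factor q - 1 clears the q-integers, and the constant q^(D-i) + q^j - 1 inside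
  \<open>Q\<close> cancels against them, so that only monomials in q remain.\<close>

lemma L1_R1_Q:
  assumes f: "f \<in> hom i j"
  shows "(qc - 1) *s (L1 *v (R1 *v f)) = (qc - 1) *s (R1 *v (L1 *v f)) +
    (qc ^ j * qc ^ (D - i)) *s Q i j f - (qc ^ j * qc ^ i) *s f"
proof -
  have "(qc - 1) * (of_nat (gauss q (D - i)) + of_nat (gauss q j) - of_nat (gauss q (i + j))) =
    qc ^ (D - i) + qc ^ j - 1 - qc ^ i * qc ^ j"
    unfolding distrib_left right_diff_distrib gauss_complex power_add by simp
  then have "(qc - 1) *s (L1 *v (R1 *v f)) = (qc - 1) *s (R1 *v (L1 *v f)) + (qc - 1) *s (C *v f) +
    (qc ^ (D - i) + qc ^ j - 1 - qc ^ i * qc ^ j) *s f"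
    by (simp only: L1_R1[OF f] vec.scale_right_distrib vec.scale_scale)
  then show ?thesis
    unfolding C_eq_Q[of f i j] by (simp add: vec_eq_iff algebra_simps)
qed

lemma L2_R2_Q:
  assumes f: "f \<in> hom i j" and i: "i \<le> D" and j: "j \<le> N - D"
  shows "(qc - 1) *s (L2 *v (R2 *v f)) = (qc - 1) *s (R2 *v (L2 *v f)) +
    (qc ^ (D - i) * qc ^ (N - D - j)) *s f - (qc ^ (D - i) * qc ^ j) *s Q i j f"
proof -
  have e: "N - (i + j) = (D - i) + (N - D - j)" using i j N_gt by simp
  have "(qc - 1) * (of_nat (gauss q (N - (i + j))) - of_nat (gauss q (D - i)) - of_nat (gauss q j)) =
    qc ^ (D - i) * qc ^ (N - D - j) - (qc ^ (D - i) + qc ^ j - 1)"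
    unfolding e right_diff_distrib gauss_complex power_add by simp
  then have "(qc - 1) *s (L2 *v (R2 *v f)) = (qc - 1) *s (R2 *v (L2 *v f)) - (qc - 1) *s (C *v f) +
    (qc ^ (D - i) * qc ^ (N - D - j) - (qc ^ (D - i) + qc ^ j - 1)) *s f"
    by (simp only: L2_R2[OF f] vec.scale_right_distrib vec.scale_right_diff_distrib vec.scale_scale)
  then show ?thesis
    unfolding C_eq_Q[of f i j] by (simp add: vec_eq_iff algebra_simps)
qed

text \<open>The factor q and the constant in \<open>R1_C\<close> are exactly what the change of
  normalization from i to i + 1 absorbs.\<close>

lemma Q_R1:
  assumes f: "f \<in> hom i j"
  shows "Q (Suc i) j (R1 *v f) = R1 *v Q i j f"
\<comment> \<open>At i = D the truncated difference D - (i + 1) would spoil the normalization, but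
  there both sides vanish.\<close>
proof (cases "i < D")
  case False
  then have "R1 *v f = 0" using hom_bounds(1)[OF R1_hom[OF f]] by auto
  moreover have "R1 *v Q i j f = 0" using False hom_bounds(1)[OF R1_hom[OF Q_hom[OF f]]] by auto
  ultimately show ?thesis by (simp add: Q_def)
next
  case True
  let ?a = "qc ^ (D - Suc i)"
  have i: "qc ^ (D - i) = qc * ?a" using True by (metis Suc_diff_Suc power_Suc)
  have "R1 *v Q i j f = inverse (qc * ?a * qc ^ j) *s
      ((qc - 1) *s (R1 *v (C *v f)) + (qc * ?a + qc ^ j - 1) *s (R1 *v f))"
    by (simp only: Q_def i matrix_vector_right_distrib vector_scalar_commute)
  also have "(qc - 1) *s (R1 *v (C *v f)) + (qc * ?a + qc ^ j - 1) *s (R1 *v f) =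
     qc *s ((qc - 1) *s (C *v (R1 *v f)) + (?a + qc ^ j - 1) *s (R1 *v f))"
    unfolding R1_C[OF f] by (simp add: vec_eq_iff algebra_simps)
  also have "inverse (qc * ?a * qc ^ j) *s \<dots> = Q (Suc i) j (R1 *v f)"
  proof -
    have "inverse (qc * ?a * qc ^ j) * qc = inverse (?a * qc ^ j)" using qc_neq by simp
    then show ?thesis by (simp only: Q_def vec.scale_scale)
  qed
  finally show ?thesis ..
qed

lemma Q_R2:
  assumes f: "f \<in> hom i j"
  shows "Q i (Suc j) (R2 *v f) = R2 *v Q i j f"
proof -
  let ?a = "qc ^ (D - i)"
  have "(qc - 1) *s (C *v (R2 *v f)) + (?a + qc ^ Suc j - 1) *s (R2 *v f) =
     qc *s ((qc - 1) *s (R2 *v (C *v f)) + (?a + qc ^ j - 1) *s (R2 *v f))"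
    unfolding C_R2[OF f] by (simp add: vec_eq_iff algebra_simps)
  then have "Q i (Suc j) (R2 *v f) = (inverse (?a * qc ^ Suc j) * qc) *s
     ((qc - 1) *s (R2 *v (C *v f)) + (?a + qc ^ j - 1) *s (R2 *v f))"
    by (simp only: Q_def vec.scale_scale)
  also have "inverse (?a * qc ^ Suc j) * qc = inverse (?a * qc ^ j)" using qc_neq by simp
  also have "inverse (?a * qc ^ j) *s ((qc - 1) *s (R2 *v (C *v f)) + (?a + qc ^ j - 1) *s (R2 *v f)) =
     R2 *v Q i j f"
    by (simp only: Q_def matrix_vector_right_distrib vector_scalar_commute)
  finally show ?thesis .
qed

text \<open>In degree (i, 0) the subspaces lie in x. If such a v were related to u, then v = v
  \<inter> x = u \<inter> x would lie in u and equal it by dimension. So \<open>C\<close>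
  vanishes.\<close>

lemma Q_j0:
  assumes f: "f \<in> hom i 0"
  shows "Q i 0 f = f"
proof -
  have "C *v f = 0"
  proof -
    have "C *v f \<in> supported {}"
      unfolding C_def using f
    proof (rule rel_mat_mult_supported)
      fix u v assume c: "crel u v" and "v \<in> Pij i 0"
      then have v: "subspace v" "rk v = dim v" by (auto simp: Pij_iff)
      then have "v \<inter> x = v" by (intro subspace_dim_equal) (auto simp: subspace_inter_x)
      then have "v \<subseteq> u" using c by (auto simp: crel_def)
      then show "u \<in> {}"
        using c by (auto simp: crel_def adjacent_def Int_absorb1)
    qed
    then show ?thesis by (simp add: supported_empty)
  qed
  then show ?thesis using qc_neq by (simp add: Q_def vec.scale_scale)
qed

end

subsection \<open>Irreducible \<open>\<H>\<close>-modules\<close>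

lemma is_moduleD:
  assumes "is_module (generated_algebra e G) U W"
  shows "vec.subspace W" "W \<subseteq> U" "\<And>M w. M \<in> G \<Longrightarrow> w \<in> W \<Longrightarrow> M *v w \<in> W"
  using assms by (auto simp: is_module_def intro: generated_algebra.generator)

lemma is_moduleI:
  assumes W: "vec.subspace W" "W \<subseteq> U"
    and e: "\<And>w. w \<in> W \<Longrightarrow> e *v w \<in> W"
    and G: "\<And>M w. M \<in> G \<Longrightarrow> w \<in> W \<Longrightarrow> M *v w \<in> W"
  shows "is_module (generated_algebra e G) U W"
proof -
  have "M *v w \<in> W" if "M \<in> generated_algebra e G" "w \<in> W" for M w
    using that
  proof (induction arbitrary: w rule: generated_algebra.induct)
    case (scale M c)
    have "(\<chi> u v. c * M $ u $ v) *v w = c *s (M *v w)"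
      by (simp add: vec_eq_iff matrix_vector_mult_def sum_distrib_left mult.assoc)
    then show ?case using scale W by (simp add: vec.subspace_scale)
  qed (use W e G in \<open>auto simp: matrix_vector_mult_add_rdistrib vec.subspace_add
         simp flip: matrix_vector_mul_assoc\<close>)
  then show ?thesis using W by (simp add: is_module_def)
qed

lemma subspace_mult_vec_image:
  fixes B :: "complex ^ 'n ^ 'n::finite"
  assumes "vec.subspace W"
  shows "vec.subspace ((*v) B ` W)"
proof (rule vec.subspaceI)
  show "0 \<in> (*v) B ` W" using vec.subspace_0[OF assms] by (auto intro: rev_image_eqI)
  fix f g assume "f \<in> (*v) B ` W" "g \<in> (*v) B ` W"
  then obtain f' g' where "f' \<in> W" "g' \<in> W" "f = B *v f'" "g = B *v g'" by blast
  then show "f + g \<in> (*v) B ` W"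
    using assms by (auto intro!: rev_image_eqI[of "f' + g'"] simp: vec.subspace_add matrix_vector_right_distrib)
next
  fix t f assume "f \<in> (*v) B ` W"
  then obtain f' where "f' \<in> W" "f = B *v f'" by blast
  then show "t *s f \<in> (*v) B ` W"
    using assms by (auto intro!: rev_image_eqI[of "t *s f'"] simp: vec.subspace_scale vector_scalar_commute)
qed

lemma diag_on_one: "f \<in> supported S \<Longrightarrow> diag_on S (\<lambda>_. 1) *v f = f"
  by (auto simp: vec_eq_iff diag_on_mult_vec supported_def)

lemma diag_on_one_supported: "diag_on S (\<lambda>_. 1) *v f \<in> supported S"
  by (simp add: supported_def diag_on_mult_vec)

lemma diag_on_const: "f \<in> supported S \<Longrightarrow> S \<subseteq> S' \<Longrightarrow> (\<And>u. u \<in> S \<Longrightarrow> d u = c) \<Longrightarrow> diag_on S' d *v f = c *s f"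
  by (rule vec_eq_iff[THEN iffD2]) (auto simp: diag_on_mult_vec supported_def)

text \<open>Lagrange interpolation: the product \<open>\<Prod>d\<in>F. (k - d)\<close> kills all eigenvalues but \<open>c\<close>.\<close>

lemma eigenspace_projection:
  fixes W :: "(complex ^ 'n::finite) set"
  assumes W: "vec.subspace W" "W \<subseteq> supported S"
    and inv: "\<And>w. w \<in> W \<Longrightarrow> diag_on S k *v w \<in> W" and w: "w \<in> W"
  shows "diag_on {u \<in> S. k u = c} (\<lambda>_. 1) *v w \<in> W"
proof -
  have *: "(\<chi> u. (\<Prod>d\<in>F. k u - d) * w $ u) \<in> W" if "finite F" for F
    using that
  proof induction
    case empty
    then show ?case using w by simp
  next
    case (insert d F)
    let ?g = "\<chi> u. (\<Prod>d\<in>F. k u - d) * w $ u"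
    have "(\<chi> u. (\<Prod>d\<in>insert d F. k u - d) * w $ u) = diag_on S k *v ?g - d *s ?g"
      using W(2) w insert.hyps
      by (auto simp: vec_eq_iff diag_on_mult_vec supported_def algebra_simps)
    then show ?case using insert.IH W inv by (simp add: vec.subspace_diff vec.subspace_scale)
  qed
  let ?F = "k ` UNIV - {c}"
  let ?p = "\<Prod>d\<in>?F. c - d"
  have "?p \<noteq> 0" by auto
  have "diag_on {u \<in> S. k u = c} (\<lambda>_. 1) *v w = inverse ?p *s (\<chi> u. (\<Prod>d\<in>?F. k u - d) * w $ u)"
  proof (rule vec_eq_iff[THEN iffD2], rule allI)
    fix u
    have "(\<Prod>d\<in>?F. k u - d) = (if k u = c then ?p else 0)" by auto
    then show "(diag_on {u \<in> S. k u = c} (\<lambda>_. 1) *v w) $ u =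
        (inverse ?p *s (\<chi> u. (\<Prod>d\<in>?F. k u - d) * w $ u)) $ u"
      using \<open>?p \<noteq> 0\<close> W(2) w by (auto simp: diag_on_mult_vec supported_def)
  qed
  also have "\<dots> \<in> W" by (intro vec.subspace_scale W(1) *) simp
  finally show ?thesis .
qed

context grassmann
begin

abbreviation is_H_module :: "(complex ^ 'v set) set \<Rightarrow> bool" where
  "is_H_module W \<equiv> is_module H Psi W"

lemma H_moduleD:
  assumes "is_H_module W"
  shows "vec.subspace W" "W \<subseteq> Psi"
    and "w \<in> W \<Longrightarrow> L1 *v w \<in> W" "w \<in> W \<Longrightarrow> L2 *v w \<in> W" "w \<in> W \<Longrightarrow> R1 *v w \<in> W" "w \<in> W \<Longrightarrow> R2 *v w \<in> W"
    and "w \<in> W \<Longrightarrow> K1 *v w \<in> W" "w \<in> W \<Longrightarrow> K2 *v w \<in> W"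
  using is_moduleD[OF assms[unfolded H_def]] by auto

lemma powr_q_inj: "real q powr s = real q powr t \<longleftrightarrow> s = t"
  using q_ge_2 by (simp add: powr_inj)

text \<open>The eigenvalues of \<open>K1\<close> and \<open>K2\<close> together determine (i, j), as
  powers of q > 1 are distinct; so every module is the sum of its homogeneous parts.\<close>

lemma H_module_Esij:
  assumes W: "is_H_module W" and w: "w \<in> W"
  shows "Esij i j *v w \<in> W"
proof -
  note M = H_moduleD[OF W]
  let ?c1 = "complex_of_real (real q powr (real D / 2 - real i))"
  let ?c2 = "complex_of_real (real q powr ((real N - real D) / 2 - real j))"
  let ?w = "diag_on {u \<in> P. k1 u = ?c1} (\<lambda>_. 1) *v w"
  have 1: "?w \<in> W"
    using M w by (rule_tac eigenspace_projection) (auto simp: Psi_def K1_def)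
  then have 2: "diag_on {u \<in> P. k2 u = ?c2} (\<lambda>_. 1) *v ?w \<in> W"
    using M by (rule_tac eigenspace_projection) (auto simp: Psi_def K2_def)
  have "u \<in> Pij i j \<longleftrightarrow> u \<in> P \<and> k1 u = ?c1 \<and> k2 u = ?c2" for u
    using rk_le(1)[of u] by (auto simp: Pij_iff P_def k1_def k2_def powr_q_inj)
  then have "diag_on {u \<in> P. k2 u = ?c2} (\<lambda>_. 1) *v ?w = Esij i j *v w"
    by (auto simp: vec_eq_iff Esij_def diag_on_mult_vec)
  then show ?thesis using 2 by simp
qed

lemma Esij_hom: "Esij i j *v w \<in> hom i j"
  by (simp add: Esij_def diag_on_one_supported)

lemma Esij_of_hom: "w \<in> hom i j \<Longrightarrow> Esij i' j' *v w = (if i = i' \<and> j = j' then w else 0)"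
  by (auto simp: vec_eq_iff Esij_def diag_on_mult_vec supported_def Pij_iff)

lemma Pij_P: "Pij i j \<subseteq> P"
  by (auto simp: Pij_def)

lemma K_hom:
  assumes "w \<in> hom i j"
  obtains c1 c2 where "K1 *v w = c1 *s w" "K2 *v w = c2 *s w"
    "K1_inv *v w = inverse c1 *s w" "K2_inv *v w = inverse c2 *s w"
proof
  let ?c1 = "complex_of_real (real q powr (real D / 2 - real i))"
  let ?c2 = "complex_of_real (real q powr ((real N - real D) / 2 - real j))"
  show "K1 *v w = ?c1 *s w" "K2 *v w = ?c2 *s w"
    "K1_inv *v w = inverse ?c1 *s w" "K2_inv *v w = inverse ?c2 *s w"
    unfolding K1_def K2_def K1_inv_def K2_inv_def
    by (rule diag_on_const[OF assms Pij_P]; simp add: Pij_iff k1_def k2_def)+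
qed

lemma Psi_component:
  assumes "w \<in> Psi" "w \<noteq> 0"
  obtains i j where "Esij i j *v w \<noteq> 0"
proof -
  obtain u where u: "w $ u \<noteq> 0" using assms by (auto simp: vec_eq_iff)
  then have "u \<in> P" using assms by (auto simp: Psi_def supported_def)
  then have "u \<in> Pij (rk u) (dim u - rk u)" using rk_le(1)[of u] by (simp add: Pij_iff P_def)
  then have "(Esij (rk u) (dim u - rk u) *v w) $ u \<noteq> 0" using u by (simp add: Esij_def diag_on_mult_vec)
  then show thesis using that by (metis zero_index)
qed

section \<open>Powers of the raising operators\<close>

abbreviation R1p :: "nat \<Rightarrow> complex ^ 'v set \<Rightarrow> complex ^ 'v set" where
  "R1p k \<equiv> ((*v) R1) ^^ k"

abbreviation R2p :: "nat \<Rightarrow> complex ^ 'v set \<Rightarrow> complex ^ 'v set" where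
  "R2p k \<equiv> ((*v) R2) ^^ k"

lemma R1p_hom: "f \<in> hom i j \<Longrightarrow> R1p k f \<in> hom (i + k) j"
  by (induction k) (auto intro: R1_hom)

lemma R2p_hom: "f \<in> hom i j \<Longrightarrow> R2p k f \<in> hom i (j + k)"
  by (induction k) (auto intro: R2_hom)

lemma Q_R1p: "f \<in> hom i j \<Longrightarrow> Q (i + k) j (R1p k f) = R1p k (Q i j f)"
  by (induction k) (auto simp: Q_R1[OF R1p_hom])

lemma Q_R2p: "f \<in> hom i j \<Longrightarrow> Q i (j + k) (R2p k f) = R2p k (Q i j f)"
  by (induction k) (auto simp: Q_R2[OF R2p_hom])

lemma L1_R2p: "L1 *v R2p k f = R2p k (L1 *v f)"
  by (induction k) (simp_all add: L1_R2)

lemma L2_R1p: "L2 *v R1p k f = R1p k (L2 *v f)"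
  by (induction k) (simp_all add: L2_R1)

lemma R1p_R2: "R1p k (R2 *v f) = qc ^ k *s (R2 *v R1p k f)"
  by (induction k) (simp_all add: R1_R2 vector_scalar_commute vec.scale_scale mult.commute)

lemma R1p_R2p: "R1p k (R2p l f) = qc ^ (k * l) *s R2p l (R1p k f)"
  by (induction l) (simp_all add: R1p_R2 vector_scalar_commute vec.scale_scale power_add)

lemma gauss_Suc_left: "gauss q (Suc n) = q * gauss q n + 1"
proof (induction n)
  case (Suc n)
  have "gauss q (Suc (Suc n)) = q * (gauss q n + q ^ n) + 1"
    unfolding gauss_Suc[of q "Suc n"] Suc.IH by (simp add: distrib_left)
  then show ?case by (simp only: gauss_Suc)
qed simp

lemma gauss_qc_neq: "(of_nat (gauss q (Suc k)) :: complex) \<noteq> 0"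
  unfolding of_nat_eq_0_iff gauss_Suc_left by simp

text \<open>The usual sl2 summation of commutators. \<open>Q i j f\<close> stays a vector of its own
  because this formula is later used to show that a suitable f is an eigenvector of
  \<open>Q\<close>.\<close>

lemma L1_R1p:
  assumes f: "f \<in> hom i j" "L1 *v f = 0" and k: "i + k \<le> D"
  shows "(qc - 1) *s (L1 *v R1p (Suc k) f) = (qc ^ j * of_nat (gauss q (Suc k))) *s
     (qc ^ (D - i - k) *s R1p k (Q i j f) - qc ^ i *s R1p k f)"
  using k
proof (induction k)
  case 0
  then show ?case using L1_R1_Q[OF f(1)] f(2) by (simp add: vec_eq_iff algebra_simps)
next
  case (Suc k)
  let ?r = "R1p (Suc k) f" and ?s = "R1p (Suc k) (Q i j f)"
  let ?g = "of_nat (gauss q (Suc k)) :: complex"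
  have e: "qc ^ (D - i - k) = qc * qc ^ (D - i - Suc k)"
    using Suc.prems by (metis Suc_diff_Suc Suc_le_lessD add_Suc_right diff_diff_left power_Suc)
  have "(qc - 1) *s (L1 *v R1p (Suc (Suc k)) f) = R1 *v ((qc - 1) *s (L1 *v ?r)) +
     (qc ^ j * qc ^ (D - (i + Suc k))) *s ?s - (qc ^ j * qc ^ (i + Suc k)) *s ?r"
    using L1_R1_Q[OF R1p_hom[OF f(1)], of "Suc k"] Q_R1p[OF f(1), of "Suc k"]
    by (simp add: vector_scalar_commute matrix_vector_mult_diff_distrib del: add_Suc_right)
  also have "R1 *v ((qc - 1) *s (L1 *v ?r)) =
    (qc ^ j * ?g) *s ((qc * qc ^ (D - i - Suc k)) *s ?s - qc ^ i *s ?r)"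
    using Suc.prems
    by (subst Suc.IH)
      (simp_all only: vector_scalar_commute matrix_vector_mult_diff_distrib e funpow.simps comp_apply)
  finally have "(qc - 1) *s (L1 *v R1p (Suc (Suc k)) f) =
    (qc ^ j * ((qc * ?g + 1) * qc ^ (D - i - Suc k))) *s ?s - (qc ^ j * ((?g + qc ^ Suc k) * qc ^ i)) *s ?r"
    by (simp add: vec_eq_iff algebra_simps power_add)
  \<comment> \<open>The two recursions of the q-integer, one for each of the two
    coefficients.\<close>
  moreover have "qc * ?g + 1 = of_nat (gauss q (Suc (Suc k)))"
    by (simp add: gauss_Suc_left[of "Suc k"])
  moreover have "?g + qc ^ Suc k = of_nat (gauss q (Suc (Suc k)))"
    by (simp add: gauss_Suc[of q "Suc k"])
  ultimately have "(qc - 1) *s (L1 *v R1p (Suc (Suc k)) f) =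
    (qc ^ j * (of_nat (gauss q (Suc (Suc k))) * qc ^ (D - i - Suc k))) *s ?s -
    (qc ^ j * (of_nat (gauss q (Suc (Suc k))) * qc ^ i)) *s ?r"
    by (simp only:)
  then show ?case
    by (simp only: vec.scale_right_diff_distrib vec.scale_scale mult.assoc)
qed

lemma L2_R2p:
  assumes f: "f \<in> hom i j" "L2 *v f = 0" and i: "i \<le> D" and k: "j + k \<le> N - D"
  shows "(qc - 1) *s (L2 *v R2p (Suc k) f) = (qc ^ (D - i) * of_nat (gauss q (Suc k))) *s
     (qc ^ (N - D - j - k) *s R2p k f - qc ^ j *s R2p k (Q i j f))"
  using k
proof (induction k)
  case 0
  then show ?case using L2_R2_Q[OF f(1) i] f(2) by (simp add: vec_eq_iff algebra_simps)
next
  case (Suc k)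
  let ?r = "R2p (Suc k) f" and ?s = "R2p (Suc k) (Q i j f)"
  let ?g = "of_nat (gauss q (Suc k)) :: complex"
  have e: "qc ^ (N - D - j - k) = qc * qc ^ (N - D - j - Suc k)"
    using Suc.prems by (metis Suc_diff_Suc Suc_le_lessD add_Suc_right diff_diff_left power_Suc)
  have "(qc - 1) *s (L2 *v R2p (Suc (Suc k)) f) = R2 *v ((qc - 1) *s (L2 *v ?r)) +
     (qc ^ (D - i) * qc ^ (N - D - (j + Suc k))) *s ?r - (qc ^ (D - i) * qc ^ (j + Suc k)) *s ?s"
    using L2_R2_Q[OF R2p_hom[OF f(1)] i, of "Suc k"] Q_R2p[OF f(1), of "Suc k"] Suc.prems
    by (simp add: vector_scalar_commute matrix_vector_mult_diff_distrib del: add_Suc_right)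
  also have "R2 *v ((qc - 1) *s (L2 *v ?r)) =
    (qc ^ (D - i) * ?g) *s ((qc * qc ^ (N - D - j - Suc k)) *s ?r - qc ^ j *s ?s)"
    using Suc.prems
    by (subst Suc.IH)
      (simp_all only: vector_scalar_commute matrix_vector_mult_diff_distrib e funpow.simps comp_apply)
  finally have "(qc - 1) *s (L2 *v R2p (Suc (Suc k)) f) =
    (qc ^ (D - i) * ((qc * ?g + 1) * qc ^ (N - D - j - Suc k))) *s ?r -
    (qc ^ (D - i) * ((?g + qc ^ Suc k) * qc ^ j)) *s ?s"
    by (simp add: vec_eq_iff algebra_simps power_add)
  moreover have "qc * ?g + 1 = of_nat (gauss q (Suc (Suc k)))"
    by (simp add: gauss_Suc_left[of "Suc k"])
  moreover have "?g + qc ^ Suc k = of_nat (gauss q (Suc (Suc k)))"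
    by (simp add: gauss_Suc[of q "Suc k"])
  ultimately have "(qc - 1) *s (L2 *v R2p (Suc (Suc k)) f) =
    (qc ^ (D - i) * (of_nat (gauss q (Suc (Suc k))) * qc ^ (N - D - j - Suc k))) *s ?r -
    (qc ^ (D - i) * (of_nat (gauss q (Suc (Suc k))) * qc ^ j)) *s ?s"
    by (simp only:)
  then show ?case
    by (simp only: vec.scale_right_diff_distrib vec.scale_scale mult.assoc)
qed

end

text \<open>
  In terms of the type \<open>(\<alpha>, \<beta>, \<rho>)\<close> of the module \<open>M\<close> below: \<open>a = \<alpha>\<close>, \<open>b = \<rho> + \<beta>\<close>, \<open>m = D - \<rho> - 2\<alpha>\<close>,
  \<open>n = N - D - \<rho> - 2\<beta>\<close> and \<open>c = q\<^sup>-\<^sup>\<rho>\<close>.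
\<close>

locale lowest_vector = grassmann scale q N D x
  for scale :: "'a::{field,finite} \<Rightarrow> 'v::{ab_group_add,finite} \<Rightarrow> 'v" and q N D :: nat and x :: "'v set" +
  fixes a b m n :: nat and c :: complex and v :: "complex ^ 'v set"
  assumes v_hom: "v \<in> hom a b" and L1_v: "L1 *v v = 0" and L2_v: "L2 *v v = 0"
    and Q_v: "Q a b v = c *s v"
    and R1p_m: "R1p m v \<noteq> 0" "R1p (Suc m) v = 0"
    and R2p_n: "R2p n v \<noteq> 0" "R2p (Suc n) v = 0"
begin

lemma a_m_le: "a + m \<le> D" and b_n_le: "b + n \<le> N - D"
  using hom_bounds(1)[OF R1p_hom[OF v_hom] R1p_m(1)] hom_bounds(2)[OF R2p_hom[OF v_hom] R2p_n(1)]
  by simp_all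

text \<open>\<open>R2\<close> commutes with \<open>L1\<close> and \<open>Q\<close>, so
  \<open>R2p l v\<close> is again killed by \<open>L1\<close> with the same eigenvalue c, and
  \<open>L1_R1p\<close> applies to it.\<close>

lemma L1_R1p_R2p:
  assumes k: "a + k \<le> D"
  shows "(qc - 1) *s (L1 *v R1p (Suc k) (R2p l v)) =
    (qc ^ (b + l) * of_nat (gauss q (Suc k)) * (qc ^ (D - a - k) * c - qc ^ a)) *s R1p k (R2p l v)"
proof -
  have "L1 *v R2p l v = 0" by (simp add: L1_R2p L1_v mult_vec_funpow_0)
  moreover have "Q a (b + l) (R2p l v) = c *s R2p l v"
    by (simp only: Q_R2p[OF v_hom] Q_v mult_vec_funpow_scale)
  ultimately show ?thesis
    using L1_R1p[OF R2p_hom[OF v_hom, of l] _ k]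
    by (simp only: mult_vec_funpow_scale vec.scale_scale vec.scale_left_diff_distrib[symmetric])
qed

lemma L2_R2p_v:
  assumes k: "b + l \<le> N - D"
  shows "(qc - 1) *s (L2 *v R2p (Suc l) v) =
    (qc ^ (D - a) * of_nat (gauss q (Suc l)) * (qc ^ (N - D - b - l) - qc ^ b * c)) *s R2p l v"
  using L2_R2p[OF v_hom L2_v _ k] a_m_le
  by (simp only: mult_vec_funpow_scale vec.scale_scale vec.scale_left_diff_distrib[symmetric] Q_v
      add_leD1)

text \<open>\<open>L1\<close> sends R1^(m+1) v = 0 to a multiple of the nonzero R1^m v, so the
  coefficient vanishes. With c = q^(-\<rho>) this says 2a + m = D - \<rho>; likewise
  \<open>c_n\<close> says 2b + n = N - D + \<rho>.\<close>

lemma c_m: "qc ^ (D - a - m) * c = qc ^ a"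
  using L1_R1p_R2p[of m 0] a_m_le R1p_m gauss_qc_neq[of m] qc_neq
  by (simp del: funpow.simps(2) of_nat_eq_0_iff)

lemma c_n: "qc ^ (N - D - b - n) = qc ^ b * c"
  using L2_R2p_v[of n] b_n_le R2p_n gauss_qc_neq[of n] qc_neq
  by (simp del: funpow.simps(2) of_nat_eq_0_iff)

lemma qc_power_neq_1: "k > 0 \<Longrightarrow> qc ^ k \<noteq> 1"
  using q_ge_2 by (metis of_nat_eq_1_iff of_nat_power one_less_power less_le_trans one_less_numeral_iff
      semiring_norm(76) less_irrefl)

definition w :: "nat \<Rightarrow> nat \<Rightarrow> complex ^ 'v set" where
  "w k l = R1p k (R2p l v)"

lemma w_hom: "w k l \<in> hom (a + k) (b + l)"
  unfolding w_def by (intro R1p_hom R2p_hom v_hom)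

lemma w_supported: "w k l \<in> supported P"
  using w_hom[of k l] supported_mono[OF Pij_P, of "a + k" "b + l"] by blast

lemma w_eq_0: "k > m \<or> l > n \<Longrightarrow> w k l = 0"
proof (elim disjE)
  assume "k > m"
  then have "R1p k v = 0" using mult_vec_funpow_eq_0_mono[OF R1p_m(2), of k] by simp
  then show "w k l = 0" by (simp add: w_def R1p_R2p mult_vec_funpow_0)
next
  assume "l > n"
  then have "R2p l v = 0" using mult_vec_funpow_eq_0_mono[OF R2p_n(2), of l] by simp
  then show "w k l = 0" by (simp add: w_def mult_vec_funpow_0)
qed

text \<open>Eliminating c by \<open>c_m\<close> leaves the factor q^a (q^(m-k) - 1), nonzero below
  the top. Only the power q^l in the coefficient depends on l.\<close>

lemma L1_w:
  assumes "k < m"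
  obtains s where "s \<noteq> 0" "\<And>l. L1 *v w (Suc k) l = (qc ^ l * s) *s w k l"
proof -
  have d: "D - a - k = (m - k) + (D - a - m)" using assms a_m_le by simp
  have e: "qc ^ (D - a - k) * c = qc ^ (m - k) * qc ^ a" unfolding d power_add mult.assoc c_m ..
  define s where "s = qc ^ b * of_nat (gauss q (Suc k)) * (qc ^ (m - k) * qc ^ a - qc ^ a) / (qc - 1)"
  have "qc ^ (m - k) \<noteq> 1" using assms by (intro qc_power_neq_1) simp
  then have "s \<noteq> 0" using gauss_qc_neq[of k] qc_neq by (simp add: s_def)
  moreover have "L1 *v w (Suc k) l = (qc ^ l * s) *s w k l" for l
  proof -
    have "(qc - 1) *s (L1 *v w (Suc k) l) = (qc - 1) *s ((qc ^ l * s) *s w k l)"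
      using L1_R1p_R2p[of k l] assms a_m_le qc_neq
      unfolding w_def e s_def vec.scale_scale
      by (simp add: power_add mult_ac del: funpow.simps(2))
    then show ?thesis using qc_neq by (simp only: vec.scale_cancel_left) simp
  qed
  ultimately show thesis using that by blast
qed

lemma L2_w:
  assumes "l < n"
  obtains s where "s \<noteq> 0" "\<And>k. L2 *v w k (Suc l) = s *s w k l"
proof -
  have d: "N - D - b - l = (n - l) + (N - D - b - n)" using assms b_n_le by simp
  have e: "qc ^ (N - D - b - l) = qc ^ (n - l) * (qc ^ b * c)" unfolding d power_add c_n ..
  define s where "s = qc ^ (D - a) * of_nat (gauss q (Suc l)) * (qc ^ (n - l) * (qc ^ b * c) - qc ^ b * c) / (qc - 1)"
  have "qc ^ (n - l) \<noteq> 1" using assms by (intro qc_power_neq_1) simp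
  moreover have "c \<noteq> 0" using c_n qc_neq by auto
  ultimately have "s \<noteq> 0" using gauss_qc_neq[of l] qc_neq by (simp add: s_def)
  moreover have "L2 *v w k (Suc l) = s *s w k l" for k
  proof -
    have "(qc - 1) *s (L2 *v R2p (Suc l) v) = (qc - 1) *s (s *s R2p l v)"
      using L2_R2p_v[of l] assms b_n_le qc_neq
      unfolding e s_def vec.scale_scale
      by (simp add: mult_ac del: funpow.simps(2))
    then have "L2 *v R2p (Suc l) v = s *s R2p l v"
      using qc_neq by (simp only: vec.scale_cancel_left) simp
    then show ?thesis by (simp only: w_def L2_R1p mult_vec_funpow_scale)
  qed
  ultimately show thesis using that by blast
qed

lemma L1_w_0: "L1 *v w 0 l = 0"
  by (simp add: w_def L1_R2p L1_v mult_vec_funpow_0)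

lemma L2_w_0: "L2 *v w k 0 = 0"
  by (simp add: w_def L2_R1p L2_v mult_vec_funpow_0)

lemma R1_w: "R1 *v w k l = w (Suc k) l"
  by (simp add: w_def)

lemma R2_w: "R2 *v w k l = inverse (qc ^ k) *s w k (Suc l)"
  using qc_neq by (simp add: w_def R1p_R2 vec.scale_scale)

lemma w_neq_0: "k \<le> m \<Longrightarrow> l \<le> n \<Longrightarrow> w k l \<noteq> 0"
proof (induction k)
  case 0
  then show ?case using mult_vec_funpow_eq_0_mono[where M = R2 and k = l and f = v and l = n] R2p_n(1) by (auto simp: w_def)
next
  case (Suc k)
  then obtain s where "s \<noteq> 0" "\<And>l. L1 *v w (Suc k) l = (qc ^ l * s) *s w k l"
    using L1_w[of k] by auto
  then have "L1 *v w (Suc k) l \<noteq> 0" using Suc qc_neq by (auto simp: vec.scale_eq_0_iff)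
  then show ?case by auto
qed

lemma w_eq_0_iff: "w k l = 0 \<longleftrightarrow> \<not> (k \<le> m \<and> l \<le> n)"
  using w_neq_0 w_eq_0 by (meson not_le)

definition M :: "(complex ^ 'v set) set" where
  "M = vec.span (range (\<lambda>(k, l). w k l))"

lemma w_in_M: "w k l \<in> M"
  unfolding M_def by (rule vec.span_base) (auto intro: range_eqI[of _ _ "(k, l)"])

lemma M_subspace: "vec.subspace M"
  by (simp add: M_def)

lemma mult_vec_M:
  assumes "\<And>k l. B *v w k l \<in> W" "vec.subspace W" "f \<in> M"
  shows "B *v f \<in> W"
  using assms(3) unfolding M_def
proof (induction rule: vec.span_induct_alt)
  case base
  then show ?case using assms(2) by (simp add: vec.subspace_0)
next
  case (step t y z)
  then show ?case using assms(1,2)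
    by (auto simp: matrix_vector_right_distrib vector_scalar_commute intro!: vec.subspace_add vec.subspace_scale)
qed

lemma M_H_module: "is_H_module M"
  unfolding H_def
proof (rule is_moduleI)
  show "M \<subseteq> Psi"
    unfolding M_def Psi_def
    by (rule vec.span_minimal) (auto simp: supported_subspace w_supported)
  show "diag_on P (\<lambda>_. 1) *v f \<in> M" if "f \<in> M" for f
    using \<open>M \<subseteq> Psi\<close> that by (auto simp: Psi_def diag_on_one)
  have "L1 *v w k l \<in> M" for k l
  proof (cases k)
    case (Suc k')
    show ?thesis
    proof (cases "k' < m")
      case True
      then show ?thesis using L1_w[of k'] Suc w_in_M M_subspace by (metis vec.subspace_scale)
    qed (use Suc in \<open>simp add: w_eq_0 M_subspace vec.subspace_0\<close>)
  qed (simp add: L1_w_0 M_subspace vec.subspace_0)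
  moreover have "L2 *v w k l \<in> M" for k l
  proof (cases l)
    case (Suc l')
    show ?thesis
    proof (cases "l' < n")
      case True
      then show ?thesis using L2_w[of l'] Suc w_in_M M_subspace by (metis vec.subspace_scale)
    qed (use Suc in \<open>simp add: w_eq_0 M_subspace vec.subspace_0\<close>)
  qed (simp add: L2_w_0 M_subspace vec.subspace_0)
  moreover have "R1 *v w k l \<in> M" "R2 *v w k l \<in> M" for k l
    by (simp_all add: R1_w R2_w w_in_M vec.subspace_scale M_subspace)
  moreover have "K1 *v w k l \<in> M" "K2 *v w k l \<in> M" "K1_inv *v w k l \<in> M" "K2_inv *v w k l \<in> M" for k l
    using K_hom[OF w_hom] w_in_M M_subspace by (metis vec.subspace_scale)+
  ultimately show "B *v f \<in> M" if "B \<in> {L1, L2, R1, R2, K1, K1_inv, K2, K2_inv}" "f \<in> M" for B f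
    using that by (auto intro: mult_vec_M M_subspace)
qed (rule M_subspace)

lemma Esij_M:
  "(*v) (Esij i j) ` M = vec.span (if a \<le> i \<and> b \<le> j then {w (i - a) (j - b)} else {})"
proof -
  let ?S = "vec.span (if a \<le> i \<and> b \<le> j then {w (i - a) (j - b)} else {})"
  have E: "Esij i j *v w k l = (if a + k = i \<and> b + l = j then w k l else 0)" for k l
    using Esij_of_hom[OF w_hom] by simp
  have "Esij i j *v w k l \<in> ?S" for k l
    by (auto simp: E vec.span_zero intro: vec.span_base)
  then have "(*v) (Esij i j) ` M \<subseteq> ?S" using mult_vec_M[of "Esij i j" ?S] vec.subspace_span by blast
  moreover have "?S \<subseteq> (*v) (Esij i j) ` M"
  proof (rule vec.span_minimal)
    show "(if a \<le> i \<and> b \<le> j then {w (i - a) (j - b)} else {}) \<subseteq> (*v) (Esij i j) ` M"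
      using E[of "i - a" "j - b"] w_in_M[of "i - a" "j - b"] by (auto intro: rev_image_eqI)
    show "vec.subspace ((*v) (Esij i j) ` M)"
      by (rule subspace_mult_vec_image[OF M_subspace])
  qed
  ultimately show ?thesis by blast
qed

lemma dim_Esij_M:
  "vec.dim ((*v) (Esij i j) ` M) = (if a \<le> i \<and> i \<le> a + m \<and> b \<le> j \<and> j \<le> b + n then 1 else 0)"
  by (auto simp: Esij_M w_eq_0_iff)

end

context grassmann
begin

text \<open>
  Among the vectors of lowest degree, \<open>v\<close> is chosen with \<open>R1\<^sup>m\<^sup>+\<^sup>1 v = 0\<close> for the least possible \<open>m\<close>.
  Then \<open>L1 R1\<^sup>m\<^sup>+\<^sup>1 v = 0\<close> says that \<open>R1\<^sup>m\<close> kills \<open>(Q - c) v\<close> for an explicit \<open>c\<close>, so that \<open>(Q - c) v = 0\<close>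
  by minimality.
\<close>

theorem irreducible_H_module_lowest_vector:
  assumes irr: "irreducible_H_module \<Omega>"
  obtains a b m n c v where "lowest_vector scale q N D x a b m n c v"
    "\<Omega> = lowest_vector.M scale x v"
proof -
  have mod: "is_H_module \<Omega>" and ne: "\<Omega> \<noteq> {0}"
    and irr': "\<And>W. is_H_module W \<Longrightarrow> W \<subseteq> \<Omega> \<Longrightarrow> W = {0} \<or> W = \<Omega>"
    using irr by (auto simp: irreducible_H_module_def irreducible_module_def)
  note S = H_moduleD[OF mod]
  define deg where "deg t \<longleftrightarrow> (\<exists>i j f. i + j = t \<and> f \<in> \<Omega> \<and> f \<in> hom i j \<and> f \<noteq> 0)" for t
  obtain f0 where "f0 \<in> \<Omega>" "f0 \<noteq> 0" using ne S(1) vec.subspace_0 by blast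
  moreover then obtain i j where "Esij i j *v f0 \<noteq> 0" using Psi_component S(2) by blast
  ultimately have "deg (i + j)"
    unfolding deg_def using H_module_Esij[OF mod] Esij_hom by blast
  then have "\<exists>t. deg t" by blast
  then obtain t where t: "deg t" "\<And>t'. t' < t \<Longrightarrow> \<not> deg t'"
    using LeastI_ex not_less_Least by metis
  from t(1) obtain a b f1 where ab: "a + b = t" and f1: "f1 \<in> \<Omega>" "f1 \<in> hom a b" "f1 \<noteq> 0"
    unfolding deg_def by blast
  \<comment> \<open>Both lowering operators would produce a vector of total degree below the minimum
    t.\<close>
  have low: "L1 *v f = 0" "L2 *v f = 0" if f: "f \<in> \<Omega>" "f \<in> hom a b" for f
  proof -
    show "L1 *v f = 0"
    proof (cases a)
      case (Suc a')
      then have "L1 *v f \<in> hom a' b" using f L1_hom by simp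
      then show ?thesis using t(2)[of "a' + b"] S(3)[OF f(1)] ab Suc unfolding deg_def by auto
    qed (use f L1_hom_0 in simp)
    show "L2 *v f = 0"
    proof (cases b)
      case (Suc b')
      then have "L2 *v f \<in> hom a b'" using f L2_hom by simp
      then show ?thesis using t(2)[of "a + b'"] S(4)[OF f(1)] ab Suc unfolding deg_def by auto
    qed (use f L2_hom_0 in simp)
  qed
  define nil where "nil k \<longleftrightarrow> (\<exists>f. f \<in> \<Omega> \<and> f \<in> hom a b \<and> f \<noteq> 0 \<and> R1p (Suc k) f = 0)" for k
  have "R1p (Suc D) f1 = 0" using hom_bounds(1)[OF R1p_hom[OF f1(2)], of "Suc D"] by auto
  then have "nil D" using f1 unfolding nil_def by blast
  then have "\<exists>k. nil k" by blast
  then obtain m where m: "nil m" "\<And>k. k < m \<Longrightarrow> \<not> nil k"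
    using LeastI_ex not_less_Least by metis
  from m(1) obtain v where v: "v \<in> \<Omega>" "v \<in> hom a b" "v \<noteq> 0" "R1p (Suc m) v = 0"
    unfolding nil_def by blast
  \<comment> \<open>Minimality of m makes R1^m injective on the whole degree (a, b) part, not just
    nonzero at v.\<close>
  have inj: "g = 0" if "g \<in> \<Omega>" "g \<in> hom a b" "R1p m g = 0" for g
    using m(2)[of "m - 1"] that unfolding nil_def by (cases m) auto
  have vm: "R1p m v \<noteq> 0" using inj v by blast
  have am: "a + m \<le> D" using hom_bounds(1)[OF R1p_hom[OF v(2)] vm] by simp
  \<comment> \<open>The value that makes the coefficient in \<open>L1_R1p\<close> vanish.\<close>
  define c where "c = qc ^ a / qc ^ (D - a - m)"
  \<comment> \<open>\<open>C\<close> is not among the generators, but \<open>L1_R1\<close> expresses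
    its action on v through them.\<close>
  have Q\<Omega>: "Q a b v \<in> \<Omega>"
  proof -
    let ?d = "of_nat (gauss q (D - a)) + of_nat (gauss q b) - of_nat (gauss q (a + b)) :: complex"
    have "C *v v = L1 *v (R1 *v v) - R1 *v (L1 *v v) - ?d *s v"
      using L1_R1[OF v(2)] by simp
    then have "C *v v \<in> \<Omega>" using S v(1) by (simp only: vec.subspace_diff vec.subspace_scale)
    then show ?thesis unfolding Q_def using S(1) v(1) by (intro vec.subspace_scale vec.subspace_add)
  qed
  have Qv: "Q a b v = c *s v"
  proof -
    let ?g = "qc ^ (D - a - m) *s Q a b v - qc ^ a *s v"
    have "(qc ^ b * of_nat (gauss q (Suc m))) *s R1p m ?g = (qc - 1) *s (L1 *v R1p (Suc m) v)"
      by (simp only: L1_R1p[OF v(2) low(1)[OF v(1,2)] am] mult_vec_funpow_diff mult_vec_funpow_scale)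
    also have "\<dots> = 0" by (simp only: v(4) matrix_vector_mult_0_right vec.scale_zero_right)
    finally have "R1p m ?g = 0"
      using gauss_qc_neq[of m] qc_neq unfolding vec.scale_eq_0_iff by simp
    moreover have "?g \<in> \<Omega>" using S(1) Q\<Omega> v by (intro vec.subspace_diff vec.subspace_scale)
    moreover have "?g \<in> hom a b"
      using hom_subspace Q_hom v by (intro vec.subspace_diff vec.subspace_scale)
    ultimately have "?g = 0" by (rule inj[rotated 2])
    then have "c *s v = inverse (qc ^ (D - a - m)) *s (qc ^ (D - a - m) *s Q a b v)"
      by (simp add: c_def divide_inverse mult.commute vec.scale_scale)
    then show ?thesis using qc_neq by (simp only: vec.scale_scale) simp
  qed
  have "R2p (Suc N) v = 0" using hom_bounds(2)[OF R2p_hom[OF v(2)], of "Suc N"]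
    by (cases "R2p (Suc N) v = 0") auto
  then have "\<exists>n. R2p (Suc n) v = 0" by blast
  then obtain n where n: "R2p (Suc n) v = 0" "\<And>k. k < n \<Longrightarrow> R2p (Suc k) v \<noteq> 0"
    using LeastI_ex[of "\<lambda>n. R2p (Suc n) v = 0"] not_less_Least[of _ "\<lambda>n. R2p (Suc n) v = 0"] by metis
  have vn: "R2p n v \<noteq> 0" using n(2)[of "n - 1"] v(3) by (cases n) auto
  interpret lowest_vector scale q N D x a b m n c v
    using v low vm vn n Qv by unfold_locales auto
  have R1p\<Omega>: "R1p k f \<in> \<Omega>" if "f \<in> \<Omega>" for k f using S(5) that by (induction k) auto
  have R2p\<Omega>: "R2p k f \<in> \<Omega>" if "f \<in> \<Omega>" for k f using S(6) that by (induction k) auto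
  have "M \<subseteq> \<Omega>"
    unfolding M_def using S(1) v(1) R1p\<Omega> R2p\<Omega> by (intro vec.span_minimal) (auto simp: w_def)
  moreover have "M \<noteq> {0}" using w_in_M[of 0 0] v(3) by (auto simp: w_def)
  ultimately have "\<Omega> = M" using irr'[OF M_H_module] by blast
  then show thesis using that[OF lowest_vector_axioms] by blast
qed

end

subsection \<open>\<open>T\<close>-modules and the nucleus\<close>

lemma hermitian_add: "hermitian (f + g) h = hermitian f h + hermitian g h"
  and hermitian_diff: "hermitian (f - g) h = hermitian f h - hermitian g h"
  and hermitian_scale: "hermitian (a *s f) h = a * hermitian f h"
  and hermitian_scale_right: "hermitian h (a *s f) = cnj a * hermitian h f"
  and hermitian_0 [simp]: "hermitian 0 h = 0" "hermitian h 0 = 0"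
  by (simp_all add: hermitian_def algebra_simps sum.distrib sum_subtractf sum_distrib_left)

lemma hermitian_cnj: "hermitian g f = cnj (hermitian f g)"
  by (simp add: hermitian_def mult.commute)

lemma hermitian_self_eq_0: "hermitian f f = 0 \<Longrightarrow> f = 0"
proof -
  assume 0: "hermitian f f = 0"
  have "hermitian f f = of_real (\<Sum>u\<in>UNIV. (cmod (f $ u))\<^sup>2)"
    by (simp add: hermitian_def flip: complex_norm_square)
  with 0 have "(\<Sum>u\<in>UNIV. (cmod (f $ u))\<^sup>2) = 0" by (simp only: of_real_eq_0_iff)
  then show "f = 0" by (simp add: sum_nonneg_eq_0_iff vec_eq_iff)
qed

lemma hermitian_mult_vec:
  assumes "\<And>u v. M $ u $ v = cnj (M $ v $ u)"
  shows "hermitian (M *v f) g = hermitian f (M *v g)"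
proof -
  have "hermitian (M *v f) g = (\<Sum>u\<in>UNIV. \<Sum>v\<in>UNIV. M $ u $ v * f $ v * cnj (g $ u))"
    by (simp add: hermitian_def matrix_vector_mult_def sum_distrib_right)
  also have "\<dots> = (\<Sum>v\<in>UNIV. \<Sum>u\<in>UNIV. M $ u $ v * f $ v * cnj (g $ u))"
    by (rule sum.swap)
  also have "\<dots> = (\<Sum>v\<in>UNIV. \<Sum>u\<in>UNIV. f $ v * (cnj (M $ v $ u) * cnj (g $ u)))"
    by (intro sum.cong refl) (simp add: assms[symmetric] mult_ac)
  also have "\<dots> = hermitian f (M *v g)"
    by (simp add: hermitian_def matrix_vector_mult_def sum_distrib_left)
  finally show ?thesis .
qed

text \<open>\<open>orth_proj\<close> is a definite description; it is evaluated where a witness is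
  at hand, on vectors of S and on vectors orthogonal to S.\<close>

lemma orth_proj_unique:
  assumes S: "vec.subspace S" and w: "w \<in> S" "\<And>z. z \<in> S \<Longrightarrow> hermitian (v - w) z = 0"
  shows "orth_proj S v = w"
  unfolding orth_proj_def
proof (rule the_equality)
  fix w' assume w': "w' \<in> S \<and> (\<forall>z\<in>S. hermitian (v - w') z = 0)"
  have d: "w' - w \<in> S" using S w w' by (simp add: vec.subspace_diff)
  then have "hermitian (v - w) (w' - w) - hermitian (v - w') (w' - w) = 0" using w w' by simp
  then have "hermitian (w' - w) (w' - w) = 0" by (simp flip: hermitian_diff)
  then show "w' = w" using hermitian_self_eq_0[of "w' - w"] by simp
qed (use w in simp)

lemma orth_proj_in: "vec.subspace S \<Longrightarrow> w \<in> S \<Longrightarrow> orth_proj S w = w"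
  by (rule orth_proj_unique) auto

lemma orth_proj_perp: "vec.subspace S \<Longrightarrow> (\<And>z. z \<in> S \<Longrightarrow> hermitian w z = 0) \<Longrightarrow> orth_proj S w = 0"
  by (rule orth_proj_unique) (auto simp: vec.subspace_0)

context grassmann
begin

section \<open>Distances from x, the adjacency matrix and the degree D part\<close>

lemma x_X: "x \<in> X"
  using subspace_x dim_x by (simp add: X_def)

lemma X_level: "X = level D"
  by (auto simp: X_def)

lemma adj_iff: "(y, z) \<in> adj \<longleftrightarrow> y \<in> X \<and> adjacent y z"
  using D_pos by (auto simp: adj_def X_def adjacent_def)

lemma adj_power_rk: "(x, y) \<in> adj ^^ n \<Longrightarrow> y \<in> X \<and> D \<le> rk y + n"
proof (induction n arbitrary: y)
  case 0
  then show ?case using x_X dim_x by simp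
next
  case (Suc n)
  then obtain z where z: "(x, z) \<in> adj ^^ n" "(z, y) \<in> adj" by auto
  then have a: "adjacent z y" by (simp add: adj_iff)
  have "rk z \<le> rk (z \<inter> y) + 1" using covers_rk[OF adjacent_covers(1)[OF a]] by auto
  moreover have "rk (z \<inter> y) \<le> rk y" by (intro rk_mono) auto
  ultimately show ?case using Suc.IH[OF z(1)] z(2) by (auto simp: adj_def)
qed

text \<open>A neighbour of y one step closer to x arises by an exchange: keep a hyperplane of y
  containing y \<inter> x and adjoin a vector of x outside y.\<close>

lemma rk_adj_power: "y \<in> X \<Longrightarrow> rk y + n = D \<Longrightarrow> (x, y) \<in> adj ^^ n"
proof (induction n arbitrary: y)
  case 0
  then have y: "subspace y" "dim y = D" "rk y = D" by (auto simp: X_def)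
  have "y \<inter> x = x"
    by (rule subspace_dim_equal) (use y dim_x subspace_x in \<open>simp_all add: subspace_inter\<close>)
  moreover have "y \<inter> x = y"
    by (rule subspace_dim_equal) (use y subspace_x in \<open>simp_all add: subspace_inter\<close>)
  ultimately show ?case by simp
next
  case (Suc n)
  then have y: "subspace y" "dim y = D" "rk y < D" by (auto simp: X_def)
  have "card (coatoms (y \<inter> x) y) > 0"
    using card_coatoms[of "y \<inter> x" y] y by (cases "D - rk y") (auto simp: subspace_inter_x gauss_Suc q_eq)
  then obtain h where "h \<in> coatoms (y \<inter> x) y" by (metis card_gt_0_iff ex_in_conv)
  then have h: "covers y h" "y \<inter> x \<subseteq> h" by (auto simp: coatoms_def)
  have "\<not> x \<subseteq> y"
  proof
    assume "x \<subseteq> y"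
    then have "y \<inter> x = x" by blast
    then show False using y dim_x by simp
  qed
  then obtain e where e: "e \<in> x" "e \<notin> y" by blast
  have hy: "h \<subseteq> y" "subspace h" using h by (auto simp: covers_def)
  let ?z = "join h {e}"
  have c: "covers ?z h" using hy e by (intro covers_join_singleton) auto
  have ez: "e \<in> ?z" using join_ub(2)[of "{e}" h] by simp
  then have a: "adjacent ?z y" using covers_distinct(1)[OF c h(1)] e by auto
  have "\<not> backslash_covers ?z h" using ez e hy by (auto simp: backslash_covers_iff_inter)
  then have "rk ?z = rk h + 1" using c covers_rk[OF c] by (auto simp: backslash_covers_iff)
  moreover have "h \<inter> x = y \<inter> x" using h hy by blast
  ultimately have "rk ?z + n = D" using Suc.prems by simp
  moreover have zX: "?z \<in> X" using a y by (simp add: X_def adjacent_def)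
  ultimately have "(x, ?z) \<in> adj ^^ n" by (intro Suc.IH)
  moreover have "(?z, y) \<in> adj" using a zX by (simp add: adj_iff)
  ultimately show ?case by auto
qed

lemma gdist_x:
  assumes "y \<in> X"
  shows "gdist x y = D - rk y"
  unfolding gdist_def
proof (rule Least_equality)
  show "(x, y) \<in> adj ^^ (D - rk y)" using assms rk_le(2)[of y] by (intro rk_adj_power) auto
  show "D - rk y \<le> n" if "(x, y) \<in> adj ^^ n" for n using adj_power_rk[OF that] by linarith
qed

lemma Es_eq: "j \<le> D \<Longrightarrow> Es j = Esij (D - j) j"
proof -
  assume j: "j \<le> D"
  have "{y \<in> X. gdist x y = j} = Pij (D - j) j"
  proof (intro set_eqI)
    fix y
    show "y \<in> {y \<in> X. gdist x y = j} \<longleftrightarrow> y \<in> Pij (D - j) j"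
      using j gdist_x[of y] rk_le(2)[of y] by (auto simp: Pij_iff X_def)
  qed
  then show ?thesis by (simp add: Es_def Esij_def)
qed

text \<open>Off the diagonal, R L counts the common hyperplanes of two vertices, one iff they are
  adjacent; on the diagonal it counts the [D] hyperplanes of a vertex.\<close>

lemma A_eq:
  assumes f: "f \<in> V"
  shows "A *v f = R *v (L *v f) - of_nat (gauss q D) *s f"
proof (rule vec_eq_iff[THEN iffD2], rule allI)
  fix u
  have "A $ u $ w * f $ w = (R ** L) $ u $ w * f $ w - (if w = u then of_nat (gauss q D) * f $ w else 0)" for w
  proof (cases "w \<in> X")
    case False
    then have "f $ w = 0" using f by (simp add: V_def supported_def)
    then show ?thesis by auto
  next
    case True
    then have w: "subspace w" "dim w = D" by (auto simp: X_def)
    show ?thesis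
    proof (cases "w = u")
      case True
      moreover have "(w, w) \<notin> adj" using adjacent_neq by (auto simp: adj_iff)
      ultimately show ?thesis
        using w card_covers_below[of w] by (simp add: A_def L_def R_def rel_mat_mult)
    next
      case False
      have "(u, w) \<in> adj \<longleftrightarrow> adjacent u w" using w by (auto simp: adj_iff X_def adjacent_def)
      then show ?thesis
        using False card_below[of u w "\<lambda>_. True"] by (simp add: A_def L_def R_def rel_mat_mult)
    qed
  qed
  then have "(\<Sum>w\<in>UNIV. A $ u $ w * f $ w) =
    (\<Sum>w\<in>UNIV. (R ** L) $ u $ w * f $ w - (if w = u then of_nat (gauss q D) * f $ w else 0))"
    by (intro sum.cong) auto
  then show "(A *v f) $ u = (R *v (L *v f) - of_nat (gauss q D) *s f) $ u"
    unfolding matrix_vector_mul_assoc by (simp add: matrix_vector_mult_def sum_subtractf)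
qed

abbreviation is_T_module :: "(complex ^ 'v set) set \<Rightarrow> bool" where
  "is_T_module W \<equiv> is_module T V W"

lemma T_moduleD:
  assumes "is_T_module W"
  shows "vec.subspace W" "W \<subseteq> V" "w \<in> W \<Longrightarrow> A *v w \<in> W" "w \<in> W \<Longrightarrow> j \<le> D \<Longrightarrow> Es j *v w \<in> W"
  using is_moduleD[OF assms[unfolded T_def]] by auto

lemma T_moduleI:
  assumes "vec.subspace W" "W \<subseteq> V" "\<And>w. w \<in> W \<Longrightarrow> A *v w \<in> W"
    "\<And>w j. w \<in> W \<Longrightarrow> j \<le> D \<Longrightarrow> Es j *v w \<in> W"
  shows "is_T_module W"
  unfolding T_def
proof (rule is_moduleI)
  show "diag_on X (\<lambda>_. 1) *v w \<in> W" if "w \<in> W" for w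
    using that assms(2) diag_on_one[of w X] by (auto simp: V_def)
qed (use assms in auto)

lemma V_components:
  assumes f: "f \<in> V"
  shows "f = (\<Sum>j\<le>D. Esij (D - j) j *v f)"
proof (rule vec_eq_iff[THEN iffD2], rule allI)
  fix u
  have "(\<Sum>j\<le>D. Esij (D - j) j *v f) $ u = (\<Sum>j\<le>D. if j = D - rk u then (if u \<in> X then f $ u else 0) else 0)"
    unfolding sum_component
    using rk_le[of u] by (intro sum.cong refl) (auto simp: Esij_def diag_on_mult_vec Pij_iff X_def)
  then show "f $ u = (\<Sum>j\<le>D. Esij (D - j) j *v f) $ u"
    using f by (auto simp: V_def supported_def)
qed

lemma tilde_eq:
  assumes W: "is_H_module \<Omega>"
  shows "tilde \<Omega> = \<Omega> \<inter> V"
proof (intro equalityI subsetI)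
  fix f assume "f \<in> tilde \<Omega>"
  then obtain w where f: "f = (\<Sum>j\<le>D. w j)" and w: "\<And>j. j \<le> D \<Longrightarrow> w j \<in> (*v) (Esij (D - j) j) ` \<Omega>"
    by (auto simp: tilde_def)
  have "w j \<in> \<Omega> \<inter> V" if j: "j \<le> D" for j
  proof -
    have "Pij (D - j) j \<subseteq> X" using that by (auto simp: Pij_iff X_def)
    then have "hom (D - j) j \<subseteq> V" unfolding V_def by (rule supported_mono)
    moreover obtain g where "g \<in> \<Omega>" "w j = Esij (D - j) j *v g" using w[OF j] by auto
    ultimately show ?thesis using H_module_Esij[OF W, of g] Esij_hom[of "D - j" j g] by auto
  qed
  moreover have "vec.subspace (\<Omega> \<inter> V)"
    using H_moduleD(1)[OF W] by (simp add: vec.subspace_inter V_def supported_subspace)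
  ultimately show "f \<in> \<Omega> \<inter> V" unfolding f by (intro vec.subspace_sum) auto
next
  fix f assume f: "f \<in> \<Omega> \<inter> V"
  have "f = (\<Sum>j\<le>D. Esij (D - j) j *v f)" using f by (intro V_components) auto
  then show "f \<in> tilde \<Omega>"
    unfolding tilde_def using f by (auto intro!: exI[of _ "\<lambda>j. Esij (D - j) j *v f"])
qed

lemma H_module_L_R:
  assumes "is_H_module \<Omega>" "f \<in> \<Omega>"
  shows "L *v f \<in> \<Omega>" "R *v f \<in> \<Omega>"
  using H_moduleD[OF assms(1)] assms(2) by (auto simp: L_eq R_eq vec.subspace_add)

lemma A_V: "A *v f \<in> V"
  by (simp add: V_def supported_def matrix_vector_mult_def A_def adj_def)

lemma H_module_inter_V:
  assumes W: "is_H_module \<Omega>"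
  shows "is_T_module (\<Omega> \<inter> V)"
proof (rule T_moduleI)
  note S = H_moduleD[OF W]
  show "vec.subspace (\<Omega> \<inter> V)"
    using S(1) by (simp add: vec.subspace_inter V_def supported_subspace)
  show "A *v w \<in> \<Omega> \<inter> V" if "w \<in> \<Omega> \<inter> V" for w
  proof -
    have "R *v (L *v w) - of_nat (gauss q D) *s w \<in> \<Omega>"
      using that H_module_L_R[OF W] S(1) by (intro vec.subspace_diff vec.subspace_scale) auto
    then show ?thesis using that A_V[of w] by (simp add: A_eq)
  qed
  show "Es j *v w \<in> \<Omega> \<inter> V" if "w \<in> \<Omega> \<inter> V" "j \<le> D" for w j
    using that H_module_Esij[OF W] by (auto simp: Es_eq V_def supported_def Esij_def diag_on_mult_vec)
qed auto

lemma hermitian_A: "hermitian (A *v f) g = hermitian f (A *v g)"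
  by (rule hermitian_mult_vec) (auto simp: A_def adj_def Int_commute)

lemma hermitian_Es: "hermitian (Es j *v f) g = hermitian f (Es j *v g)"
  by (rule hermitian_mult_vec) (auto simp: Es_def diag_on_def)

definition perp :: "(complex ^ 'v set) set \<Rightarrow> (complex ^ 'v set) set \<Rightarrow> bool" where
  "perp U W \<longleftrightarrow> (\<forall>u\<in>U. \<forall>w\<in>W. hermitian u w = 0)"

lemma perp_sym: "perp U W \<Longrightarrow> perp W U"
  by (metis complex_cnj_zero hermitian_cnj perp_def)

text \<open>The generators of \<open>T\<close> are self-adjoint, so the vectors of W orthogonal to
  W' form a submodule; it is proper, hence 0.\<close>

lemma irreducible_inter_perp:
  assumes irr: "irreducible_T_module W" and W': "is_T_module W'" and np: "\<not> perp W W'"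
    and f: "f \<in> W" "\<And>z. z \<in> W' \<Longrightarrow> hermitian f z = 0"
  shows "f = 0"
proof -
  have W: "is_T_module W" and irr': "\<And>U. is_T_module U \<Longrightarrow> U \<subseteq> W \<Longrightarrow> U = {0} \<or> U = W"
    using irr by (auto simp: irreducible_T_module_def irreducible_module_def)
  let ?U = "{f \<in> W. \<forall>z\<in>W'. hermitian f z = 0}"
  note S = T_moduleD[OF W] and S' = T_moduleD[OF W']
  have "is_T_module ?U"
  proof (rule T_moduleI)
    show "vec.subspace ?U"
      using S(1) by (auto intro!: vec.subspaceI simp: hermitian_add hermitian_scale
          vec.subspace_0 vec.subspace_add vec.subspace_scale)
  qed (use S S' in \<open>auto simp: hermitian_A hermitian_Es\<close>)
  moreover have "?U \<noteq> W" using np by (auto simp: perp_def)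
  ultimately have "?U = {0}" using irr'[of ?U] by auto
  then show ?thesis using f by auto
qed

definition eigenspace :: "nat \<Rightarrow> (complex ^ 'v set) set" where
  "eigenspace i = {v \<in> V. A *v v = complex_of_real (\<theta> i) *s v}"

lemma E_eq: "E i = orth_proj (eigenspace i)"
  by (simp add: E_def eigenspace_def)

lemma eigenspace_subspace: "vec.subspace (eigenspace i)"
  by (auto intro!: vec.subspaceI simp: eigenspace_def V_def vec.subspace_0[OF supported_subspace]
      vec.subspace_add[OF supported_subspace] vec.subspace_scale[OF supported_subspace]
      matrix_vector_right_distrib vector_scalar_commute vec.scale_right_distrib vec.scale_scale mult.commute)

text \<open>If \<open>A - \<theta>\<close> is injective on \<open>W\<close>, it is surjective on \<open>W\<close>; being self-adjoint, it then maps
  \<open>W\<close> into the orthogonal complement of its kernel.\<close>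

lemma no_eigenvector_perp:
  assumes W: "is_T_module W" and none: "\<And>z. z \<in> W \<Longrightarrow> z \<in> eigenspace i \<Longrightarrow> z = 0"
  shows "perp W (eigenspace i)"
proof -
  note S = T_moduleD[OF W]
  let ?t = "complex_of_real (\<theta> i)"
  let ?B = "A - mat ?t"
  have mat: "mat ?t *v f = ?t *s f" for f :: "complex ^ 'v set"
    by (simp add: vec_eq_iff matrix_vector_mult_def mat_def if_distrib[where f = "\<lambda>x. x * _"] cong: if_cong)
  have B: "?B *v f = A *v f - ?t *s f" for f
    by (simp add: matrix_vector_mult_diff_rdistrib mat)
  have "inj_on ((*v) ?B) W"
  proof (rule inj_onI)
    fix f g assume fg: "f \<in> W" "g \<in> W" "?B *v f = ?B *v g"
    then have "?B *v (f - g) = 0" by (simp add: matrix_vector_mult_diff_distrib)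
    then have "A *v (f - g) = ?t *s (f - g)" by (simp only: B) simp
    moreover have "f - g \<in> W" using fg S(1) by (simp add: vec.subspace_diff)
    ultimately have "f - g = 0" using S(2) by (intro none) (auto simp: eigenspace_def)
    then show "f = g" by simp
  qed
  then have "vec.dim ((*v) ?B ` W) = vec.dim W"
    using S(1) by (intro vec.dim_image_eq) (simp_all add: vec.span_eq_iff[THEN iffD2])
  moreover have "(*v) ?B ` W \<subseteq> W" using S by (auto simp: B intro!: vec.subspace_diff vec.subspace_scale)
  ultimately have surj: "(*v) ?B ` W = W"
    using S(1) by (intro vec.subspace_dim_equal subspace_mult_vec_image) auto
  show ?thesis
    unfolding perp_def
  proof (intro ballI)
    fix f z assume "f \<in> W" and z: "z \<in> eigenspace i"
    then obtain g where "f = ?B *v g" using surj by (metis imageE)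
    then have "hermitian f z = hermitian g (A *v z) - ?t * hermitian g z"
      by (simp only: B hermitian_diff hermitian_A hermitian_scale)
    then show "hermitian f z = 0" using z by (simp add: eigenspace_def hermitian_scale_right)
  qed
qed

text \<open>Allows the dual endpoint to be read off the eigenvectors inside W: without one,
  \<open>no_eigenvector_perp\<close> makes the projection vanish on W.\<close>

lemma E_nonzero_iff:
  assumes W: "is_T_module W"
  shows "E i ` W \<noteq> {0} \<longleftrightarrow> (\<exists>z\<in>W. z \<in> eigenspace i \<and> z \<noteq> 0)"
proof
  show "\<exists>z\<in>W. z \<in> eigenspace i \<and> z \<noteq> 0" if "E i ` W \<noteq> {0}"
  proof (rule ccontr)
    assume "\<not> ?thesis"
    then have "perp W (eigenspace i)" using W by (intro no_eigenvector_perp) auto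
    then have "E i w = 0" if "w \<in> W" for w
      unfolding E_eq using that by (intro orth_proj_perp eigenspace_subspace) (auto simp: perp_def)
    moreover have "W \<noteq> {}" using T_moduleD(1)[OF W] vec.subspace_0 by blast
    ultimately show False using that by auto
  qed
next
  assume "\<exists>z\<in>W. z \<in> eigenspace i \<and> z \<noteq> 0"
  then obtain z where "z \<in> W" "z \<in> eigenspace i" "z \<noteq> 0" by blast
  moreover from this have "E i z = z" by (simp add: E_eq orth_proj_in eigenspace_subspace)
  ultimately show "E i ` W \<noteq> {0}" by (metis image_eqI singletonD)
qed

text \<open>If \<open>Es i\<close> kills U, self-adjointness makes its values on U' orthogonal to U,
  hence 0. If \<open>E i\<close> kills U, the eigenvectors in U' are orthogonal to U, hence 0. By
  symmetry all parameters agree.\<close>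

lemma displacement_eq:
  assumes irr: "irreducible_T_module W" "irreducible_T_module W'" and np: "\<not> perp W W'"
  shows "displacement W = displacement W'"
proof -
  have ne: "U \<noteq> {}" if "irreducible_T_module U" for U
    using that T_moduleD(1) vec.subspace_0 by (auto simp: irreducible_T_module_def irreducible_module_def)
  have Es: "(*v) (Es i) ` U' = {0}"
    if irr: "irreducible_T_module U" "irreducible_T_module U'" and np: "\<not> perp U U'"
      and z: "i \<le> D" "(*v) (Es i) ` U = {0}" for i U U'
  proof -
    have U: "is_T_module U" "is_T_module U'" using irr by (auto simp: irreducible_T_module_def irreducible_module_def)
    have "Es i *v f = 0" if "f \<in> U'" for f
    proof (rule irreducible_inter_perp[OF irr(2) U(1)])
      show "\<not> perp U' U" using np perp_sym by blast
      show "Es i *v f \<in> U'" using T_moduleD(4)[OF U(2)] that z by simp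
      show "hermitian (Es i *v f) z = 0" if "z \<in> U" for z
        using z(2) that by (subst hermitian_Es) (metis hermitian_0(2) imageI singletonD)
    qed
    then show ?thesis using ne[OF irr(2)] by auto
  qed
  have E: "E i ` U' = {0}"
    if irr: "irreducible_T_module U" "irreducible_T_module U'" and np: "\<not> perp U U'"
      and z: "E i ` U = {0}" for i U U'
  proof -
    have U: "is_T_module U" "is_T_module U'" using irr by (auto simp: irreducible_T_module_def irreducible_module_def)
    have "perp U (eigenspace i)"
      using z E_nonzero_iff[OF U(1)] by (intro no_eigenvector_perp U) blast
    then have "f = 0" if "f \<in> U'" "f \<in> eigenspace i" for f
    proof -
      have p: "perp (eigenspace i) U" using \<open>perp U (eigenspace i)\<close> by (rule perp_sym)
      have "\<not> perp U' U" using np perp_sym by blast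
      then show ?thesis
      proof (rule irreducible_inter_perp[OF irr(2) U(1) _ that(1)])
        show "hermitian f z = 0" if "z \<in> U" for z
          using p \<open>f \<in> eigenspace i\<close> that by (simp add: perp_def)
      qed
    qed
    then show ?thesis using E_nonzero_iff[OF U(2)] by blast
  qed
  have np': "\<not> perp W' W" using np perp_sym by blast
  have "(i \<le> D \<and> (*v) (Es i) ` W \<noteq> {0}) \<longleftrightarrow> (i \<le> D \<and> (*v) (Es i) ` W' \<noteq> {0})" for i
    using Es[OF irr np] Es[OF irr(2,1) np'] by blast
  moreover have "(i \<le> D \<and> E i ` W \<noteq> {0}) \<longleftrightarrow> (i \<le> D \<and> E i ` W' \<noteq> {0})" for i
    using E[OF irr np] E[OF irr(2,1) np'] by blast
  ultimately show ?thesis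
    by (simp only: displacement_def endpoint_def dual_endpoint_def diameter_def)
qed

lemma irreducible_in_nucleus:
  assumes irr: "irreducible_T_module W"
  shows "W \<subseteq> nucleus \<longleftrightarrow> displacement W = 0"
proof
  assume "displacement W = 0"
  then show "W \<subseteq> nucleus" unfolding nucleus_def using irr by (auto intro: vec.span_base)
next
  assume sub: "W \<subseteq> nucleus"
  show "displacement W = 0"
  proof (rule ccontr)
    assume "displacement W \<noteq> 0"
    \<comment> \<open>W is then orthogonal to every module spanning the nucleus; being contained in
      the nucleus, it is orthogonal to itself.\<close>
    then have p: "perp U W" if "irreducible_T_module U" "displacement U = 0" for U
      using displacement_eq[OF that(1) irr] that by auto
    have "hermitian f w = 0" if "f \<in> nucleus" "w \<in> W" for f w
      using that(1) unfolding nucleus_def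
    proof (induction rule: vec.span_induct_alt)
      case (step t y z)
      then obtain U where "irreducible_T_module U" "displacement U = 0" "y \<in> U" by auto
      then have "hermitian y w = 0" using p that by (auto simp: perp_def)
      then show ?case using step by (simp add: hermitian_add hermitian_scale)
    qed simp
    then have "w = 0" if "w \<in> W" for w using sub that by (intro hermitian_self_eq_0) auto
    then have "W \<subseteq> {0}" by auto
    moreover have "vec.subspace W" "W \<noteq> {0}"
      using irr T_moduleD(1) by (auto simp: irreducible_T_module_def irreducible_module_def)
    ultimately show False using vec.subspace_0 by blast
  qed
qed

end

subsection \<open>The \<open>T\<close>-module of an \<open>\<H>\<close>-module\<close>

context grassmann
begin

text \<open>The subtracted term of \<open>\<theta> i\<close>. Its increments [N - k] - [k] are the
  scalars of \<open>L_R\<close>, so eig h - eig i is the i-th eigenvalue of R L on level h.\<close>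

definition eig :: "nat \<Rightarrow> nat" where
  "eig i = gauss q i * gauss q (N - i + 1)"

lemma gauss_strict_mono: "i < j \<Longrightarrow> gauss q i < gauss q j"
proof (induction j)
  case (Suc j)
  have "gauss q j < gauss q (Suc j)" using q_ge_2 by (simp add: gauss_Suc)
  with Suc show ?case by (cases "i = j") auto
qed simp

lemma eig_Suc: "k < N \<Longrightarrow> eig (Suc k) + gauss q k = eig k + gauss q (N - k)"
proof -
  assume k: "k < N"
  then have "N - Suc k + 1 = N - k" "N - k + 1 = Suc (N - k)" by auto
  then show ?thesis by (simp add: eig_def gauss_Suc_left algebra_simps)
qed

text \<open>The increment [N - k] - [k] is positive for k < D because N > 2D.\<close>

lemma eig_strict_mono: "i < h \<Longrightarrow> h \<le> D \<Longrightarrow> eig i < eig h"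
proof (induction h)
  case (Suc h)
  have "eig (Suc h) + gauss q h = eig h + gauss q (N - h)" using Suc.prems N_gt by (intro eig_Suc) simp
  moreover have "gauss q h < gauss q (N - h)" using Suc.prems N_gt by (intro gauss_strict_mono) simp
  ultimately have "eig h < eig (Suc h)" by simp
  with Suc show ?case by (cases "i = h") auto
qed simp

lemma eig_Suc_complex:
  assumes "k < N"
  shows "(of_nat (gauss q (N - k)) - of_nat (gauss q k) :: complex) = of_nat (eig (Suc k)) - of_nat (eig k)"
  using arg_cong[OF eig_Suc[OF assms], of "of_nat :: nat \<Rightarrow> complex"] by (simp add: algebra_simps)

lemma qint_eq: "complex_of_real (qint l) = of_nat (gauss q l)"
proof -
  have "complex_of_real (qint l) = (qc ^ l - 1) / (qc - 1)" by (simp add: qint_def)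
  then show ?thesis using qc_neq by (simp flip: gauss_complex)
qed

lemma theta_eq: "complex_of_real (\<theta> i) = of_nat (eig D) - of_nat (eig i) - of_nat (gauss q D)"
proof -
  have "gauss q (N - D + 1) = q * gauss q (N - D) + 1" by (simp add: gauss_Suc_left)
  then show ?thesis
    by (simp add: \<theta>_def qint_eq eig_def gauss_Suc_left algebra_simps)
qed

lemma eigenspace_iff:
  assumes "f \<in> V"
  shows "f \<in> eigenspace i \<longleftrightarrow> R *v (L *v f) = (of_nat (eig D) - of_nat (eig i)) *s f"
  using assms by (auto simp: eigenspace_def A_eq theta_eq vec_eq_iff algebra_simps)

lemma R_level: "f \<in> supported (level h) \<Longrightarrow> R *v f \<in> supported (level (Suc h))"
  unfolding R_def by (rule rel_mat_mult_supported) (auto simp: covers_def)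

lemma L_level: "f \<in> supported (level (Suc h)) \<Longrightarrow> L *v f \<in> supported (level h)"
  unfolding L_def by (rule rel_mat_mult_supported) (auto simp: covers_def)

lemma Esij_level:
  assumes "f \<in> supported (level h)" "Esij i j *v f \<noteq> 0"
  shows "i + j = h"
proof -
  obtain u where "(Esij i j *v f) $ u \<noteq> 0" using assms(2) by (auto simp: vec_eq_iff)
  then have "u \<in> Pij i j" "f $ u \<noteq> 0" by (auto simp: Esij_def diag_on_mult_vec split: if_splits)
  moreover from this have "u \<in> level h" using assms(1) unfolding supported_def by blast
  ultimately show ?thesis by (auto simp: Pij_iff)
qed

lemma V_level: "V = supported (level D)"
  by (simp add: V_def X_level)

end

context lowest_vector
begin

lemma M_level_0:
  assumes f: "f \<in> M" "f \<in> supported (level h)" and h: "h < a + b"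
  shows "f = 0"
proof (rule ccontr)
  assume "f \<noteq> 0"
  moreover have "f \<in> Psi" using f(1) H_moduleD(2)[OF M_H_module] by blast
  ultimately obtain i j where ij: "Esij i j *v f \<noteq> 0" using Psi_component by blast
  have "i + j = h" by (rule Esij_level[OF f(2) ij])
  moreover have "Esij i j *v f \<in> (*v) (Esij i j) ` M" using f by blast
  then have "a \<le> i \<and> b \<le> j" using ij by (auto simp: Esij_M split: if_splits)
  ultimately show False using h by simp
qed

text \<open>Lowering takes an eigenvector on level h + 1 for index i to one on level h for the same
  i, or to 0. Descent ends below level a + b, where \<open>M\<close> has nothing; on the way back, L
  f = 0 forces f = 0 as the eigenvalue is nonzero.\<close>

lemma M_eigenvector_0:
  assumes "f \<in> M" "f \<in> supported (level h)" "h \<le> D" "i < a + b"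
    and "R *v (L *v f) = (of_nat (eig h) - of_nat (eig i)) *s f"
  shows "f = 0"
  using assms
proof (induction h arbitrary: f)
  case 0
  show ?case by (rule M_level_0[OF 0(1,2)]) (use 0(4) in linarith)
next
  case (Suc h)
  show ?case
  proof (cases "Suc h < a + b")
    case True
    then show ?thesis using M_level_0[OF Suc.prems(1,2)] by blast
  next
    case False
    let ?g = "L *v f"
    have g: "?g \<in> supported (level h)" using Suc.prems by (intro L_level) auto
    have "L *v (R *v ?g) = (of_nat (eig (Suc h)) - of_nat (eig i)) *s ?g"
      using Suc.prems by (simp only: vector_scalar_commute)
    then have "R *v (L *v ?g) = (of_nat (eig (Suc h)) - of_nat (eig i)) *s ?g -
        (of_nat (gauss q (N - h)) - of_nat (gauss q h)) *s ?g"
      unfolding L_R[OF g] by (simp only: eq_diff_eq)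
    also have "(of_nat (gauss q (N - h)) - of_nat (gauss q h) :: complex) = of_nat (eig (Suc h)) - of_nat (eig h)"
      using Suc.prems(3) N_gt by (intro eig_Suc_complex) simp
    also have "(of_nat (eig (Suc h)) - of_nat (eig i)) *s ?g - (of_nat (eig (Suc h)) - of_nat (eig h)) *s ?g =
        (of_nat (eig h) - of_nat (eig i)) *s ?g"
      by (simp add: vec_eq_iff algebra_simps)
    finally have "R *v (L *v ?g) = (of_nat (eig h) - of_nat (eig i)) *s ?g" .
    then have "?g = 0"
      using Suc.prems g H_module_L_R(1)[OF M_H_module] by (intro Suc.IH) auto
    then have "(of_nat (eig (Suc h)) - of_nat (eig i) :: complex) *s f = 0" using Suc.prems by simp
    moreover have "eig i < eig (Suc h)" using eig_strict_mono[of i "Suc h"] False Suc.prems by simp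
    then have "(of_nat (eig (Suc h)) - of_nat (eig i) :: complex) \<noteq> 0" by simp
    ultimately show ?thesis by (simp only: vec.scale_eq_0_iff) simp
  qed
qed

text \<open>The index a + b does occur: raising v gives eigenvectors on every level up to D, nonzero
  since L undoes R up to a nonzero factor.\<close>

lemma R_power:
  defines "z \<equiv> \<lambda>k. ((*v) R ^^ k) v"
  assumes "a + b + k \<le> D"
  shows "z k \<in> M" "z k \<in> supported (level (a + b + k))" "z k \<noteq> 0"
    "R *v (L *v z k) = (of_nat (eig (a + b + k)) - of_nat (eig (a + b))) *s z k"
proof -
  have "z k \<in> M \<and> z k \<in> supported (level (a + b + k)) \<and> z k \<noteq> 0 \<and>
    R *v (L *v z k) = (of_nat (eig (a + b + k)) - of_nat (eig (a + b))) *s z k"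
    using assms(2)
  proof (induction k)
    case 0
    have "v \<in> M" using w_in_M[of 0 0] by (simp add: w_def)
    moreover have "v \<noteq> 0" using w_neq_0[of 0 0] by (simp add: w_def)
    moreover have "L *v v = 0" by (simp add: L_eq L1_v L2_v)
    ultimately show ?case using hom_level[OF v_hom] by (simp add: z_def)
  next
    case (Suc k)
    let ?h = "a + b + k"
    have z: "z (Suc k) = R *v z k" by (simp add: z_def)
    have IH: "z k \<in> M" "z k \<in> supported (level ?h)" "z k \<noteq> 0"
      "R *v (L *v z k) = (of_nat (eig ?h) - of_nat (eig (a + b))) *s z k"
      using Suc by auto
    have d: "(of_nat (gauss q (N - ?h)) - of_nat (gauss q ?h) :: complex) = of_nat (eig (Suc ?h)) - of_nat (eig ?h)"
      using Suc.prems N_gt by (intro eig_Suc_complex) simp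
    have LR: "L *v (R *v z k) = (of_nat (eig (Suc ?h)) - of_nat (eig (a + b))) *s z k"
      unfolding L_R[OF IH(2)] IH(4) d vec.scale_left_distrib[symmetric] by simp
    have "eig (a + b) < eig (Suc ?h)" using Suc.prems by (intro eig_strict_mono) auto
    then have "(of_nat (eig (Suc ?h)) - of_nat (eig (a + b)) :: complex) \<noteq> 0" by simp
    then have "L *v (R *v z k) \<noteq> 0" using LR IH(3) by (simp only: vec.scale_eq_0_iff) simp
    then have "z (Suc k) \<noteq> 0" by (auto simp: z)
    moreover have "R *v (L *v z (Suc k)) = (of_nat (eig (Suc ?h)) - of_nat (eig (a + b))) *s z (Suc k)"
      by (simp only: z LR vector_scalar_commute)
    ultimately show ?case
      using H_module_L_R(2)[OF M_H_module IH(1)] R_level[OF IH(2)] by (simp add: z)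
  qed
  then show "z k \<in> M" "z k \<in> supported (level (a + b + k))" "z k \<noteq> 0"
    "R *v (L *v z k) = (of_nat (eig (a + b + k)) - of_nat (eig (a + b))) *s z k"
    by auto
qed

lemma T_module: "is_T_module (M \<inter> V)"
  by (rule H_module_inter_V[OF M_H_module])

lemma dual_endpoint_eq:
  assumes "a + b \<le> D"
  shows "dual_endpoint (M \<inter> V) = a + b"
  unfolding dual_endpoint_def
proof (rule Least_equality)
  obtain k where k: "a + b + k = D" using assms le_Suc_ex by blast
  let ?z = "((*v) R ^^ k) v"
  have z: "?z \<in> M" "?z \<in> V" "?z \<noteq> 0" "R *v (L *v ?z) = (of_nat (eig D) - of_nat (eig (a + b))) *s ?z"
    using R_power[of k] k by (simp_all add: V_level)
  then have "?z \<in> eigenspace (a + b)" by (simp add: eigenspace_iff)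
  then show "a + b \<le> D \<and> E (a + b) ` (M \<inter> V) \<noteq> {0}"
    unfolding E_nonzero_iff[OF T_module] using z assms by blast
next
  fix i assume "i \<le> D \<and> E i ` (M \<inter> V) \<noteq> {0}"
  then obtain f where f: "f \<in> M" "f \<in> V" "f \<in> eigenspace i" "f \<noteq> 0"
    unfolding E_nonzero_iff[OF T_module] by blast
  then show "a + b \<le> i"
    using M_eigenvector_0[of f D i] by (auto simp: V_level eigenspace_iff[unfolded V_level] not_le[symmetric])
qed

lemma Esij_inter_V:
  assumes "i + j = D"
  shows "(*v) (Esij i j) ` (M \<inter> V) = (*v) (Esij i j) ` M"
proof (intro equalityI subsetI)
  fix g assume "g \<in> (*v) (Esij i j) ` M"
  then obtain f where f: "f \<in> M" "g = Esij i j *v f" by blast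
  then have "g \<in> M" using H_module_Esij[OF M_H_module] by simp
  moreover have "g \<in> V" using hom_level[OF Esij_hom[of i j f]] f assms by (simp add: V_level)
  moreover have "Esij i j *v g = g" using Esij_of_hom[OF Esij_hom] f by simp
  ultimately show "g \<in> (*v) (Esij i j) ` (M \<inter> V)" by (metis IntI image_eqI)
qed auto

lemma Es_inter_V:
  assumes "j \<le> D"
  shows "(*v) (Es j) ` (M \<inter> V) = vec.span (if a \<le> D - j \<and> b \<le> j then {w (D - j - a) (j - b)} else {})"
  using assms by (simp add: Es_eq Esij_inter_V Esij_M)

text \<open>The bounds on j = D - i obtained from a \<le> i \<le> a + m and b \<le> j \<le> b +
  n.\<close>

abbreviation lo :: nat where "lo \<equiv> max b (D - a - m)"
abbreviation hi :: nat where "hi \<equiv> min (D - a) (b + n)"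

lemma Es_nonzero_iff: "j \<le> D \<and> (*v) (Es j) ` (M \<inter> V) \<noteq> {0} \<longleftrightarrow> j \<in> {lo..hi}"
proof -
  have "vec.span {f} = {0} \<longleftrightarrow> f = 0" for f :: "complex ^ 'v set"
    using vec.span_base[of f "{f}"] by auto
  then have "(*v) (Es j) ` (M \<inter> V) \<noteq> {0} \<longleftrightarrow> a \<le> D - j \<and> b \<le> j \<and> D - j - a \<le> m \<and> j - b \<le> n"
    if "j \<le> D"
    unfolding Es_inter_V[OF that] by (cases "a \<le> D - j \<and> b \<le> j") (simp add: w_eq_0_iff, auto)
  then show ?thesis
    using a_m_le by (cases "j \<le> D") auto
qed

lemma module_nonzero_iff: "M \<inter> V \<noteq> {0} \<longleftrightarrow> lo \<le> hi"
proof
  assume "lo \<le> hi"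
  then have "lo \<le> D" "(*v) (Es lo) ` (M \<inter> V) \<noteq> {0}" using Es_nonzero_iff[of lo] by auto
  moreover have "(*v) (Es lo) ` {0} = {0}" by simp
  ultimately show "M \<inter> V \<noteq> {0}" by metis
next
  assume "M \<inter> V \<noteq> {0}"
  then obtain f where f: "f \<in> M" "f \<in> V" "f \<noteq> 0"
    using vec.subspace_0[OF T_moduleD(1)[OF T_module]] by blast
  then obtain i j where ij: "Esij i j *v f \<noteq> 0"
    using Psi_component H_moduleD(2)[OF M_H_module] by blast
  have D: "i + j = D" using Esij_level[OF _ ij] f(2) by (simp only: V_level)
  then have "Es j *v f \<noteq> 0" using ij by (auto simp: Es_eq)
  then have "j \<in> {lo..hi}" using Es_nonzero_iff[of j] f D by auto
  then show "lo \<le> hi" by auto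
qed

lemma endpoint_eq:
  assumes "lo \<le> hi"
  shows "endpoint (M \<inter> V) = lo"
  unfolding endpoint_def Es_nonzero_iff using assms by (intro Least_equality) auto

lemma diameter_eq:
  assumes "lo \<le> hi"
  shows "diameter (M \<inter> V) = int hi - int lo"
proof -
  have "int (Suc h - l) - 1 = int h - int l" if "l \<le> h" for l h using that by simp
  then show ?thesis
    unfolding diameter_def Es_nonzero_iff Collect_mem_eq card_atLeastAtMost using assms by blast
qed

text \<open>Endpoint plus diameter is lo + (hi - lo) = hi, and the dual endpoint is a + b.\<close>

lemma displacement_eq_0_iff:
  assumes "lo \<le> hi"
  shows "displacement (M \<inter> V) = 0 \<longleftrightarrow> a + b + hi = D"
proof -
  have "a + b \<le> D" using assms a_m_le by auto
  then show ?thesis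
    using endpoint_eq[OF assms] diameter_eq[OF assms]
    unfolding displacement_def dual_endpoint_eq[OF \<open>a + b \<le> D\<close>] by linarith
qed

lemma qc_power_inj: "qc ^ i = qc ^ j \<longleftrightarrow> i = j"
proof -
  have "qc ^ i = qc ^ j \<longleftrightarrow> q ^ i = q ^ j" by (metis of_nat_eq_iff of_nat_power)
  then show ?thesis using q_ge_2 by (simp add: power_inject_exp)
qed

text \<open>The product of \<open>c_m\<close> and \<open>c_n\<close> eliminates c.\<close>

lemma N_eq: "N = 2 * a + m + 2 * b + n"
proof -
  have "qc ^ (D - a - m + (N - D - b - n)) = qc ^ (a + b)"
    unfolding power_add c_n using c_m by (simp add: mult_ac)
  then have "D - a - m + (N - D - b - n) = a + b" by (simp only: qc_power_inj)
  then show ?thesis using a_m_le b_n_le N_gt by linarith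
qed

lemma b_0:
  assumes "b = 0"
  shows "2 * a + m = D" "n = N - D"
proof -
  have "v = c *s v" using Q_j0[of v a] v_hom Q_v assms by simp
  moreover have "v \<noteq> 0" using w_neq_0[of 0 0] by (simp add: w_def)
  ultimately have "c = 1" by (metis vec.scale_cancel_right vec.scale_one)
  then have "D - a - m = a" using c_m by (simp add: qc_power_inj)
  then show "2 * a + m = D" using a_m_le by linarith
  then show "n = N - D" using N_eq assms by linarith
qed

lemma displacement_0_imp_b_0:
  assumes "lo \<le> hi" "displacement (M \<inter> V) = 0"
  shows "b = 0"
proof (rule ccontr)
  assume "b \<noteq> 0"
  have "a + b + hi = D" using assms displacement_eq_0_iff by simp
  \<comment> \<open>A positive b excludes hi = D - a, so the minimum is b + n.\<close>
  with \<open>b \<noteq> 0\<close> have "a + b + (b + n) = D" by (simp add: min_def split: if_splits)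
  then show False using N_eq a_m_le N_gt by linarith
qed

section \<open>Irreducibility of the degree D part\<close>

lemma L1_w':
  obtains s where "L1 *v w k l = s *s w (k - 1) l" "0 < k \<Longrightarrow> k \<le> m \<Longrightarrow> s \<noteq> 0" "k = 0 \<Longrightarrow> s = 0"
proof (cases k)
  case 0
  then show thesis using that[of 0] by (simp add: L1_w_0)
next
  case (Suc k')
  show thesis
  proof (cases "k' < m")
    case True
    then obtain s where s: "s \<noteq> 0" "\<And>l. L1 *v w (Suc k') l = (qc ^ l * s) *s w k' l" using L1_w by blast
    then show thesis using that[of "qc ^ l * s"] Suc qc_neq by simp
  next
    case False
    then show thesis using that[of 0] Suc by (simp add: w_eq_0)
  qed
qed

lemma L2_w':
  obtains s where "L2 *v w k l = s *s w k (l - 1)" "0 < l \<Longrightarrow> l \<le> n \<Longrightarrow> s \<noteq> 0" "l = 0 \<Longrightarrow> s = 0"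
proof (cases l)
  case 0
  then show thesis using that[of 0] by (simp add: L2_w_0)
next
  case (Suc l')
  show thesis
  proof (cases "l' < n")
    case True
    then obtain s where s: "s \<noteq> 0" "\<And>k. L2 *v w k (Suc l') = s *s w k l'" using L2_w by blast
    then show thesis using that[of s] Suc by simp
  next
    case False
    then show thesis using that[of 0] Suc by (simp add: w_eq_0)
  qed
qed

lemma Esij_w: "Esij i j *v w k l = (if a + k = i \<and> b + l = j then w k l else 0)"
  using Esij_of_hom[OF w_hom] by simp

text \<open>\<open>R1 L1\<close> and \<open>R2 L2\<close> act as scalars, while \<open>R1 L2\<close>
  and \<open>R2 L1\<close> move one step along the line of constant k + l. The last two clauses
  cover the ends, where the truncated index names the wrong vector.\<close>

lemma A_w:
  assumes D: "a + k + (b + l) = D"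
  obtains s1 s2 s3 where
    "A *v w k l = s1 *s w (Suc k) (l - 1) + s2 *s w (k - 1) (Suc l) + s3 *s w k l"
    "0 < l \<Longrightarrow> l \<le> n \<Longrightarrow> s1 \<noteq> 0" "0 < k \<Longrightarrow> k \<le> m \<Longrightarrow> s2 \<noteq> 0"
    "l = 0 \<Longrightarrow> s1 = 0" "k = 0 \<Longrightarrow> s2 = 0"
proof -
  obtain t1 where t1: "L1 *v w k l = t1 *s w (k - 1) l" "0 < k \<Longrightarrow> k \<le> m \<Longrightarrow> t1 \<noteq> 0" "k = 0 \<Longrightarrow> t1 = 0"
    using L1_w' by blast
  obtain t2 where t2: "L2 *v w k l = t2 *s w k (l - 1)" "0 < l \<Longrightarrow> l \<le> n \<Longrightarrow> t2 \<noteq> 0" "l = 0 \<Longrightarrow> t2 = 0"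
    using L2_w' by blast
  have "w k l \<in> V" using hom_level[OF w_hom[of k l]] D by (simp add: V_level)
  moreover have "R1 *v (L1 *v w k l) = t1 *s w k l"
    unfolding t1(1) using t1(3) by (cases k) (simp_all add: R1_w vector_scalar_commute)
  moreover have "R1 *v (L2 *v w k l) = t2 *s w (Suc k) (l - 1)"
    unfolding t2(1) by (simp add: R1_w vector_scalar_commute)
  moreover have "R2 *v (L1 *v w k l) = (t1 * inverse (qc ^ (k - 1))) *s w (k - 1) (Suc l)"
    unfolding t1(1) by (simp add: R2_w vector_scalar_commute vec.scale_scale)
  moreover have "R2 *v (L2 *v w k l) = (t2 * inverse (qc ^ k)) *s w k l"
    unfolding t2(1) using t2(3) by (cases l) (simp_all add: R2_w vector_scalar_commute vec.scale_scale)
  ultimately have "A *v w k l = t1 *s w k l + t2 *s w (Suc k) (l - 1) +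
     ((t1 * inverse (qc ^ (k - 1))) *s w (k - 1) (Suc l) + (t2 * inverse (qc ^ k)) *s w k l) -
     of_nat (gauss q D) *s w k l"
    by (simp only: A_eq R_eq L_eq matrix_vector_right_distrib add_ac)
  then have "A *v w k l = t2 *s w (Suc k) (l - 1) + (t1 * inverse (qc ^ (k - 1))) *s w (k - 1) (Suc l) +
     (t1 + t2 * inverse (qc ^ k) - of_nat (gauss q D)) *s w k l"
    by (simp add: vec_eq_iff algebra_simps)
  then show thesis by (rule that) (use t1 t2 qc_neq in auto)
qed

lemma T_submodule_steps:
  assumes W: "is_T_module W" and w: "w k l \<in> W" and D: "a + k + (b + l) = D" and kl: "k \<le> m" "l \<le> n"
  shows "0 < l \<Longrightarrow> w (Suc k) (l - 1) \<in> W" "0 < k \<Longrightarrow> w (k - 1) (Suc l) \<in> W"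
proof -
  obtain s1 s2 s3 where s: "A *v w k l = s1 *s w (Suc k) (l - 1) + s2 *s w (k - 1) (Suc l) + s3 *s w k l"
    "0 < l \<Longrightarrow> l \<le> n \<Longrightarrow> s1 \<noteq> 0" "0 < k \<Longrightarrow> k \<le> m \<Longrightarrow> s2 \<noteq> 0"
    "l = 0 \<Longrightarrow> s1 = 0" "k = 0 \<Longrightarrow> s2 = 0"
    using A_w[OF D] by blast
  note S = T_moduleD[OF W]
  have E: "Esij i j *v (A *v w k l) \<in> W" if "i + j = D" for i j
  proof -
    have "Es j *v (A *v w k l) \<in> W" using S(3,4) w that by simp
    then show ?thesis using that by (auto simp: Es_eq)
  qed
  have scale: "f \<in> W" if "t *s f \<in> W" "t \<noteq> 0" for t f
    using vec.subspace_scale[OF S(1) that(1), of "inverse t"] that(2) by (simp add: vec.scale_scale)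
  show "w (Suc k) (l - 1) \<in> W" if l: "0 < l"
  proof -
    have "Esij (a + Suc k) (b + (l - 1)) *v (A *v w k l) = s1 *s w (Suc k) (l - 1)"
    proof -
      \<comment> \<open>The projection kills the other neighbour also at k = 0, where k - 1 is
        truncated.\<close>
      have "a + (k - 1) \<noteq> a + Suc k" by arith
      then show ?thesis
        using l by (simp add: s(1) matrix_vector_right_distrib vector_scalar_commute Esij_w)
    qed
    then show ?thesis using E[of "a + Suc k" "b + (l - 1)"] D l s(2) kl scale by simp
  qed
  show "w (k - 1) (Suc l) \<in> W" if k: "0 < k"
  proof -
    have "Esij (a + (k - 1)) (b + Suc l) *v (A *v w k l) = s2 *s w (k - 1) (Suc l)"
    proof -
      have "b + (l - 1) \<noteq> b + Suc l" by arith
      then show ?thesis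
        using k by (simp add: s(1) matrix_vector_right_distrib vector_scalar_commute Esij_w)
    qed
    then show ?thesis using E[of "a + (k - 1)" "b + Suc l"] D k s(3) kl scale by simp
  qed
qed

lemma T_submodule_up:
  assumes W: "is_T_module W" and w: "w k l \<in> W" and D: "a + k + (b + l) = D" and kl: "k + d \<le> m" "d \<le> l" "l \<le> n"
  shows "w (k + d) (l - d) \<in> W"
  using kl
proof (induction d)
  case (Suc d)
  then show ?case using T_submodule_steps(1)[OF W, of "k + d" "l - d"] D by (simp add: diff_Suc)
qed (use w in simp)

lemma T_submodule_down:
  assumes W: "is_T_module W" and w: "w k l \<in> W" and D: "a + k + (b + l) = D" and kl: "k \<le> m" "d \<le> k" "l + d \<le> n"
  shows "w (k - d) (l + d) \<in> W"
  using kl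
proof (induction d)
  case (Suc d)
  then show ?case using T_submodule_steps(2)[OF W, of "k - d" "l + d"] D by (simp add: diff_Suc)
qed (use w in simp)

lemma T_submodule_all:
  assumes W: "is_T_module W" and w: "w k l \<in> W" and D: "a + k + (b + l) = D" and kl: "k \<le> m" "l \<le> n"
    and k'l': "k' + l' = k + l"
  shows "w k' l' \<in> W"
proof (cases "k' \<le> m \<and> l' \<le> n")
  case False
  then have "w k' l' = 0" using w_eq_0_iff by blast
  then show ?thesis using T_moduleD(1)[OF W] by (simp add: vec.subspace_0)
next
  case True
  show ?thesis
  proof (cases "k \<le> k'")
    case True
    then show ?thesis
      using T_submodule_up[OF W w D, of "k' - k"] k'l' kl \<open>k' \<le> m \<and> l' \<le> n\<close>
      by (metis (no_types, lifting) add_diff_cancel_left' add_le_cancel_left diff_diff_left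
          le_add_diff_inverse le_add1 ordered_cancel_comm_monoid_diff_class.add_diff_inverse
          Nat.le_diff_conv2 add.commute)
  next
    case False
    then have "l + (k - k') = l'" "k - (k - k') = k'" using k'l' by auto
    then show ?thesis
      using T_submodule_down[OF W w D, of "k - k'"] kl True by simp
  qed
qed

text \<open>Homogeneous parts are at most one-dimensional, so a nonzero submodule contains some
  nonzero w k l; steps along the line then reach all the others.\<close>

lemma irreducible:
  assumes "lo \<le> hi"
  shows "irreducible_T_module (M \<inter> V)"
  unfolding irreducible_T_module_def irreducible_module_def
proof (intro conjI allI impI)
  show "is_T_module (M \<inter> V)" by (rule T_module)
  show "M \<inter> V \<noteq> {0}" using assms module_nonzero_iff by simp
  fix W assume "is_T_module W \<and> W \<subseteq> M \<inter> V"
  then have W: "is_T_module W" and sub: "W \<subseteq> M \<inter> V" by auto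
  note S = T_moduleD[OF W]
  show "W = {0} \<or> W = M \<inter> V"
  proof (cases "W = {0}")
    case False
    then obtain f where f: "f \<in> W" "f \<noteq> 0" using vec.subspace_0[OF S(1)] by blast
    have comp: "g \<in> W" if g: "g \<in> M \<inter> V" and all: "\<And>j. j \<le> D \<Longrightarrow> Es j *v g \<in> W" for g
    proof -
      have "g = (\<Sum>j\<le>D. Esij (D - j) j *v g)" using g by (intro V_components) auto
      also have "\<dots> \<in> W" using all by (intro vec.subspace_sum S(1)) (auto simp: Es_eq)
      finally show ?thesis .
    qed
    have span: "Es j *v g \<in> vec.span (if a \<le> D - j \<and> b \<le> j then {w (D - j - a) (j - b)} else {})"
      if "g \<in> M \<inter> V" "j \<le> D" for g j
      using Es_inter_V[OF that(2)] that(1) by blast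
    have "\<exists>j\<le>D. Es j *v f \<noteq> 0"
    proof (rule ccontr)
      assume "\<not> ?thesis"
      then have "(\<Sum>j\<le>D. Esij (D - j) j *v f) = 0" by (intro sum.neutral) (auto simp: Es_eq)
      then show False using V_components[of f] f sub by auto
    qed
    then obtain j where j: "j \<le> D" "Es j *v f \<noteq> 0" by blast
    then have aj: "a \<le> D - j" "b \<le> j" and "Es j *v f \<in> vec.span {w (D - j - a) (j - b)}"
      using span[of f j] f(1) sub by (cases "a \<le> D - j \<and> b \<le> j"; auto)+
    then obtain t where t: "Es j *v f = t *s w (D - j - a) (j - b)"
      by (auto simp: vec.span_singleton)
    let ?k = "D - j - a" and ?l = "j - b"
    have "t \<noteq> 0" "w ?k ?l \<noteq> 0" using t j by auto
    have "inverse t *s (Es j *v f) \<in> W" using S(1,4) f j by (intro vec.subspace_scale) auto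
    then have wW: "w ?k ?l \<in> W" using \<open>t \<noteq> 0\<close> by (simp add: t vec.scale_scale)
    have kl: "?k \<le> m" "?l \<le> n" using \<open>w ?k ?l \<noteq> 0\<close> w_eq_0_iff by blast+
    have D: "a + ?k + (b + ?l) = D" using aj j by simp
    have "g \<in> W" if g: "g \<in> M \<inter> V" for g
    proof (rule comp[OF g])
      fix j' assume j': "j' \<le> D"
      show "Es j' *v g \<in> W"
      proof (cases "a \<le> D - j' \<and> b \<le> j'")
        case True
        have "w (D - j' - a) (j' - b) \<in> W"
          using True j' D by (intro T_submodule_all[OF W wW D kl]) auto
        then have "vec.span {w (D - j' - a) (j' - b)} \<subseteq> W"
          using S(1) by (intro vec.span_minimal) auto
        then show ?thesis using span[OF g j'] True by auto
      next
        case False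
        then have "Es j' *v g = 0" using span[OF g j'] by (auto split: if_splits)
        then show ?thesis using vec.subspace_0[OF S(1)] by simp
      qed
    qed
    then show ?thesis using sub by blast
  qed simp
qed

lemma support_eqD:
  assumes eq: "\<And>i j. i \<le> D \<Longrightarrow> j \<le> N - D \<Longrightarrow>
      (a \<le> i \<and> i \<le> a + m \<and> b \<le> j \<and> j \<le> b + n) \<longleftrightarrow> (\<alpha> \<le> i \<and> i \<le> D - \<alpha>)"
    and \<alpha>: "2 * \<alpha> \<le> D"
  shows "a = \<alpha>" "b = 0"
proof -
  \<comment> \<open>Two corners suffice: (\<alpha>, 0) must lie in the support of \<open>M\<close>,
    and (a, b) in the prescribed rectangle.\<close>
  have 1: "a \<le> \<alpha>" "\<alpha> \<le> a + m" "b = 0" using eq[of \<alpha> 0] \<alpha> by auto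
  then show "b = 0" by simp
  have "\<alpha> \<le> a" using eq[of a b] a_m_le b_n_le by auto
  then show "a = \<alpha>" using 1 by simp
qed

theorem alpha_dominant_iff:
  "alpha_dominant_with_gap M \<alpha> \<longleftrightarrow>
    irreducible_T_module (M \<inter> V) \<and> M \<inter> V \<subseteq> nucleus \<and> int (endpoint (M \<inter> V)) = \<alpha>"
proof
  assume dom: "alpha_dominant_with_gap M \<alpha>"
  then obtain \<alpha>' where \<alpha>': "\<alpha> = int \<alpha>'" "2 * \<alpha>' \<le> D"
    using nonneg_int_cases[of \<alpha>] by (auto simp: alpha_dominant_with_gap_def)
  have eq: "(a \<le> i \<and> i \<le> a + m \<and> b \<le> j \<and> j \<le> b + n) \<longleftrightarrow> (\<alpha>' \<le> i \<and> i \<le> D - \<alpha>')"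
    if ij: "i \<le> D" "j \<le> N - D" for i j
  proof -
    have "vec.dim ((*v) (Esij i j) ` M) = (if \<alpha> \<le> int i \<and> int i \<le> int D - 0 - \<alpha> \<and>
            0 + 0 \<le> int j \<and> int j \<le> int N - int D - 0 then 1 else 0)"
      using dom ij unfolding alpha_dominant_with_gap_def has_type_def by blast
    then show ?thesis
      using \<alpha>' ij N_gt unfolding dim_Esij_M by (auto split: if_splits)
  qed
  have ab: "a = \<alpha>'" "b = 0" using support_eqD[OF eq \<alpha>'(2)] by auto
  note b0 = b_0[OF ab(2)]
  \<comment> \<open>With b = 0, b + n = N - D exceeds D, so the minimum is D - a; and D - a - m = a
    because 2a + m = D.\<close>
  have hilo: "hi = D - a" "lo = a" using b0 ab N_gt by auto
  then have le: "lo \<le> hi" using b0 by simp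
  have "displacement (M \<inter> V) = 0" using displacement_eq_0_iff[OF le] hilo ab a_m_le by simp
  then show "irreducible_T_module (M \<inter> V) \<and> M \<inter> V \<subseteq> nucleus \<and> int (endpoint (M \<inter> V)) = \<alpha>"
    using irreducible[OF le] irreducible_in_nucleus endpoint_eq[OF le] hilo ab \<alpha>' by simp
next
  assume *: "irreducible_T_module (M \<inter> V) \<and> M \<inter> V \<subseteq> nucleus \<and> int (endpoint (M \<inter> V)) = \<alpha>"
  then have "M \<inter> V \<noteq> {0}" by (auto simp: irreducible_T_module_def irreducible_module_def)
  then have le: "lo \<le> hi" using module_nonzero_iff by simp
  have "displacement (M \<inter> V) = 0" using * irreducible_in_nucleus by blast
  then have b: "b = 0" using displacement_0_imp_b_0[OF le] by simp
  note b0 = b_0[OF b]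
  have "lo = a" using b0 b by auto
  then have \<alpha>: "\<alpha> = int a" using * endpoint_eq[OF le] by simp
  have "(a \<le> i \<and> i \<le> a + m \<and> b \<le> j \<and> j \<le> b + n) \<longleftrightarrow> \<alpha> \<le> int i \<and> int i \<le> int D - 0 - \<alpha> \<and>
            0 + 0 \<le> int j \<and> int j \<le> int N - int D - 0" if "j \<le> N - D" for i j
    using b0 b \<alpha> that N_gt by auto
  then show "alpha_dominant_with_gap M \<alpha>"
    using b0 \<alpha> N_gt unfolding alpha_dominant_with_gap_def has_type_def dim_Esij_M by auto
qed

end

theorem lemma6p6:
  fixes scale :: "'a::{field,finite} \<Rightarrow> 'v::{ab_group_add,finite} \<Rightarrow> 'v"
    and q N D :: nat
    and x :: "'v set"
    and \<Omega> :: "(complex ^ 'v set) set"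
    and \<alpha> :: int
  assumes "grassmann scale q N D x"
    and "grassmann.irreducible_H_module scale q N D x \<Omega>"
  shows "grassmann.alpha_dominant_with_gap scale N D x \<Omega> \<alpha> \<longleftrightarrow>
    grassmann.irreducible_T_module scale D x (grassmann.tilde scale D x \<Omega>) \<and>
    grassmann.tilde scale D x \<Omega> \<subseteq> grassmann.nucleus scale q N D x \<and>
    int (grassmann.endpoint scale D x (grassmann.tilde scale D x \<Omega>)) = \<alpha>"
proof -
  interpret grassmann scale q N D x by fact
  from assms(2) obtain a b m n c v where lv: "lowest_vector scale q N D x a b m n c v"
    and \<Omega>: "\<Omega> = lowest_vector.M scale x v"
    by (rule irreducible_H_module_lowest_vector)
  interpret lowest_vector scale q N D x a b m n c v by (rule lv)
  show ?thesis
    unfolding \<Omega> tilde_eq[OF M_H_module] by (rule alpha_dominant_iff)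
qed

end
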